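(* Let $p\ge q$, and let $p_1+p_2=p$ and $q_1+q_2=q$ be partitions of $p$ and $q$. Fix $\beta\in\{1,2,4\}$, and let $m_1=\min(p_1,q_2)$ and $m_2=\min(p_2,q_1)$. For any $U\in\mathrm{U}_\beta(p,q)$, there exist $U_p\in\mathrm{U}_\beta(p)$, $U_q\in\mathrm{U}_\beta(q)$, $V_1\in\mathrm{U}_\beta(p_1,q_1)$, $V_2\in\mathrm{U}_\beta(p_2,q_2)$, $m_1$ unique (up to order and signs) real numbers $\theta_1,\dots,\theta_{m_1}$, and $m_2$ unique (up to order and signs) real numbers $\gamma_1,\dots,\gamma_{m_2}$ such that $$U=\begin{bmatrix} U_p & 0 \\ 0 & U_q \end{bmatrix}P_2^T\begin{bmatrix} H^\theta & 0 \\ 0 & H^\gamma \end{bmatrix}P_2\,V,$$ where $H^\theta=H^\theta_{\max(p_1,q_2),\,m_1}$, $H^\gamma=H^\gamma_{\max(p_2,q_1),\,m_2}$, and $$V=P_1^T\begin{bmatrix} V_1 & 0 \\ 0 & V_2 \end{bmatrix}P_1.$$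
   Context: $\beta=1,2,4$ correspond to $\mathbb{F}=\mathbb{R},\mathbb{C},\mathbb{H}$ (reals, complexes, real quaternions), and $\dagger$ denotes the (real/complex/quaternionic) conjugate transpose. $\mathrm{U}_\beta(n)=\{G\in\mathbb{F}^{n\times n}:G^\dagger G=I_n\}$ and $\mathrm{U}_\beta(p,q)=\{G\in\mathbb{F}^{(p+q)\times(p+q)}:G^\dagger I_{p,q}G=I_{p,q}\}$ with $I_{p,q}=\operatorname{diag}(I_p,-I_q)$. For $m\ge n$ and $\theta\in\mathbb{R}^n$, the $(m+n)\times(m+n)$ matrix $$H^\theta_{m,n}=\begin{bmatrix} Ch & 0 & Sh \\ 0 & I_{m-n} & 0 \\ Sh & 0 & Ch \end{bmatrix},\quad Ch=\operatorname{diag}(\cosh\theta_1,\dots,\cosh\theta_n),\ Sh=\operatorname{diag}(\sinh\theta_1,\dots,\sinh\theta_n).$$ The permutation matrices are $$P_1=\begin{bmatrix} I_{p_1} & 0 & 0 & 0 \\ 0 & 0 & I_{q_1} & 0 \\ 0 & I_{p_2} & 0 & 0 \\ 0 & 0 & 0 & I_{q_2} \end{bmatrix},\qquad P_2=\begin{bmatrix} I_{p_1} & 0 & 0 & 0 \\ 0 & 0 & 0 & I_{q_2} \\ 0 & I_{p_2} & 0 & 0 \\ 0 & 0 & I_{q_1} & 0 \end{bmatrix},$$ with column block sizes $p_1,p_2,q_1,q_2$ in both cases. Thus $A\mapsto P_1^TAP_1$ rearranges block indices from the order $(p_1,q_1,p_2,q_2)$ to $(p_1,p_2,q_1,q_2)$,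 and $A\mapsto P_2^TAP_2$ from the order $(p_1,q_2,p_2,q_1)$ to $(p_1,p_2,q_1,q_2)$. *)

theory Defs
  imports Complex_Main "HOL-Combinatorics.Permutations" "Jordan_Normal_Form.Matrix"
begin

section \<open>Real quaternions\<close>

text \<open>\<open>Quat a b c d\<close> is the quaternion $a + bi + cj + dk$.\<close>

codatatype quat = Quat (qRe: real) (qIm1: real) (qIm2: real) (qIm3: real)

lemma quat_eq_iff:
  "x = y \<longleftrightarrow> qRe x = qRe y \<and> qIm1 x = qIm1 y \<and> qIm2 x = qIm2 y \<and> qIm3 x = qIm3 y"
  by (auto intro: quat.expand)

instantiation quat :: real_div_algebra
begin

primcorec zero_quat where
  "qRe 0 = 0"
| "qIm1 0 = 0"
| "qIm2 0 = 0"
| "qIm3 0 = 0"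

primcorec one_quat where
  "qRe 1 = 1"
| "qIm1 1 = 0"
| "qIm2 1 = 0"
| "qIm3 1 = 0"

primcorec plus_quat where
  "qRe (x + y) = qRe x + qRe y"
| "qIm1 (x + y) = qIm1 x + qIm1 y"
| "qIm2 (x + y) = qIm2 x + qIm2 y"
| "qIm3 (x + y) = qIm3 x + qIm3 y"

primcorec uminus_quat where
  "qRe (- x) = - qRe x"
| "qIm1 (- x) = - qIm1 x"
| "qIm2 (- x) = - qIm2 x"
| "qIm3 (- x) = - qIm3 x"

primcorec minus_quat where
  "qRe (x - y) = qRe x - qRe y"
| "qIm1 (x - y) = qIm1 x - qIm1 y"
| "qIm2 (x - y) = qIm2 x - qIm2 y"
| "qIm3 (x - y) = qIm3 x - qIm3 y"

primcorec scaleR_quat where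
  "qRe (scaleR r x) = r * qRe x"
| "qIm1 (scaleR r x) = r * qIm1 x"
| "qIm2 (scaleR r x) = r * qIm2 x"
| "qIm3 (scaleR r x) = r * qIm3 x"

primcorec times_quat where
  "qRe (x * y) = qRe x * qRe y - qIm1 x * qIm1 y - qIm2 x * qIm2 y - qIm3 x * qIm3 y"
| "qIm1 (x * y) = qRe x * qIm1 y + qIm1 x * qRe y + qIm2 x * qIm3 y - qIm3 x * qIm2 y"
| "qIm2 (x * y) = qRe x * qIm2 y - qIm1 x * qIm3 y + qIm2 x * qRe y + qIm3 x * qIm1 y"
| "qIm3 (x * y) = qRe x * qIm3 y + qIm1 x * qIm2 y - qIm2 x * qIm1 y + qIm3 x * qRe y"

definition inverse_quat :: "quat \<Rightarrow> quat" where
  "inverse x = (let r = (qRe x)\<^sup>2 + (qIm1 x)\<^sup>2 + (qIm2 x)\<^sup>2 + (qIm3 x)\<^sup>2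
                in Quat (qRe x / r) (- qIm1 x / r) (- qIm2 x / r) (- qIm3 x / r))"

definition divide_quat :: "quat \<Rightarrow> quat \<Rightarrow> quat" where
  "x div y = x * inverse y" for x y :: quat

instance
proof
  fix x y :: quat
  let ?r = "(qRe x)\<^sup>2 + (qIm1 x)\<^sup>2 + (qIm2 x)\<^sup>2 + (qIm3 x)\<^sup>2"
  show "x div y = x * inverse y" by (rule divide_quat_def)
  show "inverse (0::quat) = 0" by (simp add: inverse_quat_def quat_eq_iff)
  assume "x \<noteq> 0"
  then have r: "?r \<noteq> 0"
    by (auto simp: quat_eq_iff add_nonneg_eq_0_iff)
  have div_r: "a / ?r + b / ?r + c / ?r + d / ?r = (a + b + c + d) / ?r" for a b c d
    by (simp add: add_divide_distrib)
  have one: "qRe x * qRe x / ?r + qIm1 x * qIm1 x / ?r + qIm2 x * qIm2 x / ?r + qIm3 x * qIm3 x / ?r = 1"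
    unfolding div_r using r by (simp add: power2_eq_square)
  show "inverse x * x = 1" "x * inverse x = 1"
    using one by (simp_all add: quat_eq_iff inverse_quat_def Let_def mult.commute)
qed (simp_all add: quat_eq_iff algebra_simps)

end

instantiation quat :: conjugate
begin

primcorec conjugate_quat :: "quat \<Rightarrow> quat" where
  "qRe (conjugate x) = qRe x"
| "qIm1 (conjugate x) = - qIm1 x"
| "qIm2 (conjugate x) = - qIm2 x"
| "qIm3 (conjugate x) = - qIm3 x"

instance by standard (simp_all add: quat_eq_iff)

end


section \<open>Unitary and indefinite unitary groups\<close>

text \<open>
  Here \<open>'a\<close> stands for one of \<open>real\<close>, \<open>complex\<close>, \<open>quat\<close>. The library's
  \<open>mat_adjoint\<close> requires a commutative field, so the conjugate transpose is
  defined for the weaker class \<open>conjugate\<close>, which also covers quaternions.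
\<close>

definition ctranspose :: "'a::conjugate mat \<Rightarrow> 'a mat" where
  "ctranspose A = transpose_mat (map_mat conjugate A)"

definition dsum :: "'a::zero mat \<Rightarrow> 'a mat \<Rightarrow> 'a mat" where
  "dsum A B = four_block_mat A (0\<^sub>m (dim_row A) (dim_col B)) (0\<^sub>m (dim_row B) (dim_col A)) B"

definition signature_mat :: "nat \<Rightarrow> nat \<Rightarrow> 'a::ring_1 mat" where
  "signature_mat p q = dsum (1\<^sub>m p) (- 1\<^sub>m q)"

definition unitary_group :: "nat \<Rightarrow> 'a::{ring_1,conjugate} mat set" where
  "unitary_group n = {G \<in> carrier_mat n n. ctranspose G * G = 1\<^sub>m n}"

definition indef_unitary_group :: "nat \<Rightarrow> nat \<Rightarrow> 'a::{ring_1,conjugate} mat set" where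
  "indef_unitary_group p q =
     {G \<in> carrier_mat (p + q) (p + q).
        ctranspose G * signature_mat p q * G = signature_mat p q}"


section \<open>The hyperbolic factor and the permutation matrices\<close>

text \<open>
  \<open>hyp_mat m n \<theta>\<close> (for $m \ge n$, $\theta \in R^n$) has block rows and columns of
  sizes $n$, $m - n$, $n$. Since \<open>four_block_mat\<close> is $2 \times 2$, the first two
  block rows and columns are grouped; the off-diagonal blocks are the column
  $[Sh; 0]$ and the row $[Sh, 0]$, completed by empty blocks.
\<close>

definition hyp_mat :: "nat \<Rightarrow> nat \<Rightarrow> real vec \<Rightarrow> 'a::real_algebra_1 mat" where
  "hyp_mat m n \<theta> =
     (let Ch = mat_diag n (\<lambda>i. of_real (cosh (\<theta> $ i)));
          Sh = mat_diag n (\<lambda>i. of_real (sinh (\<theta> $ i)))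
      in four_block_mat
           (dsum Ch (1\<^sub>m (m - n)))
           (four_block_mat Sh (0\<^sub>m n 0) (0\<^sub>m (m - n) n) (0\<^sub>m (m - n) 0))
           (four_block_mat Sh (0\<^sub>m n (m - n)) (0\<^sub>m 0 n) (0\<^sub>m 0 (m - n)))
           Ch)"

text \<open>
  Column block sizes are $p_1, p_2, q_1, q_2$ in both matrices; row block sizes are
  $p_1, q_1, p_2, q_2$ in \<open>perm_mat1\<close> and $p_1, q_2, p_2, q_1$ in \<open>perm_mat2\<close>.
\<close>

definition perm_mat1 :: "nat \<Rightarrow> nat \<Rightarrow> nat \<Rightarrow> nat \<Rightarrow> 'a::{zero,one} mat" where
  "perm_mat1 p1 p2 q1 q2 =
     four_block_mat
       (four_block_mat (1\<^sub>m p1) (0\<^sub>m p1 p2) (0\<^sub>m q1 p1) (0\<^sub>m q1 p2))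
       (four_block_mat (0\<^sub>m p1 q1) (0\<^sub>m p1 q2) (1\<^sub>m q1) (0\<^sub>m q1 q2))
       (four_block_mat (0\<^sub>m p2 p1) (1\<^sub>m p2) (0\<^sub>m q2 p1) (0\<^sub>m q2 p2))
       (four_block_mat (0\<^sub>m p2 q1) (0\<^sub>m p2 q2) (0\<^sub>m q2 q1) (1\<^sub>m q2))"

definition perm_mat2 :: "nat \<Rightarrow> nat \<Rightarrow> nat \<Rightarrow> nat \<Rightarrow> 'a::{zero,one} mat" where
  "perm_mat2 p1 p2 q1 q2 =
     four_block_mat
       (four_block_mat (1\<^sub>m p1) (0\<^sub>m p1 p2) (0\<^sub>m q2 p1) (0\<^sub>m q2 p2))
       (four_block_mat (0\<^sub>m p1 q1) (0\<^sub>m p1 q2) (0\<^sub>m q2 q1) (1\<^sub>m q2))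
       (four_block_mat (0\<^sub>m p2 p1) (1\<^sub>m p2) (0\<^sub>m q1 p1) (0\<^sub>m q1 p2))
       (four_block_mat (0\<^sub>m p2 q1) (0\<^sub>m p2 q2) (1\<^sub>m q1) (0\<^sub>m q1 q2))"


section \<open>The factorization\<close>

definition kah_factorization ::
  "nat \<Rightarrow> nat \<Rightarrow> nat \<Rightarrow> nat \<Rightarrow> 'a::{real_algebra_1,conjugate} mat \<Rightarrow> real vec \<Rightarrow> real vec \<Rightarrow> bool"
  where
  "kah_factorization p1 p2 q1 q2 U \<theta> \<gamma> \<longleftrightarrow>
     (\<exists>Up \<in> unitary_group (p1 + p2). \<exists>Uq \<in> unitary_group (q1 + q2).
      \<exists>V1 \<in> indef_unitary_group p1 q1. \<exists>V2 \<in> indef_unitary_group p2 q2.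
        let P1 = perm_mat1 p1 p2 q1 q2;
            P2 = perm_mat2 p1 p2 q1 q2;
            H\<theta> = hyp_mat (max p1 q2) (min p1 q2) \<theta>;
            H\<gamma> = hyp_mat (max p2 q1) (min p2 q1) \<gamma>;
            V = transpose_mat P1 * dsum V1 V2 * P1
        in U = dsum Up Uq * transpose_mat P2 * dsum H\<theta> H\<gamma> * P2 * V)"

definition eq_up_to_order_signs :: "real vec \<Rightarrow> real vec \<Rightarrow> bool" where
  "eq_up_to_order_signs x y \<longleftrightarrow>
     dim_vec x = dim_vec y \<and>
     (\<exists>\<pi> s. \<pi> permutes {..<dim_vec x} \<and>
        (\<forall>i < dim_vec x. s i \<in> {1, -1} \<and> x $ i = s i * y $ (\<pi> i)))"

end

theory Submission
  imports Defs
begin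

text \<open>
  Let \<open>S\<close> be the signature matrix, and let \<open>J\<close> be the diagonal sign matrix with signs
  $+,-,+,-$ on the blocks of sizes $p_1, p_2, q_1, q_2$. The admissible factors \<open>V\<close> are exactly the
  \<open>S\<close>-unitary matrices commuting with \<open>J\<close>, and the middle factor $A_\phi$ satisfies
  $A_\phi J = J A_{-\phi}$. Hence $U = k A_\phi V$ is equivalent to
  $U J U^{-1} = k A_{2\phi} J k^\dagger$, which involves only the compact factor $k$.

  For uniqueness, compare the top left blocks: they are unitarily similar to diagonal matrices with entries
  $\pm\cosh 2\phi_i$, so these numbers agree with multiplicities. For existence, the matrix
  $M = U J U^{-1}$ satisfies $M^2 = 1$ and $M^\dagger = S M S$. After its two diagonal blocks are
  diagonalized, $M^2 = 1$ forces the eigenvalues to have modulus at least one and those of modulus larger than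
  one to occur with opposite signs and equal multiplicities in the two blocks. Inertia gives the number of
  positive eigenvalues of each block, and the normalized off-diagonal columns of $M$ complete the change of basis.
  All arguments use only an involution with positive norm, so they apply to the three scalar types at once.
\<close>

section \<open>Division algebras with a positive involution\<close>

text \<open>Over the quaternions there is neither a determinant nor a characteristic polynomial, and
  only real scalars are central. So the linear algebra rests on elimination in homogeneous systems,
  eigenvectors come from a variational argument, and multiplicities are compared by double counting
  squared norms of entries. The matrix U J U^{-1} is the right object because it forgets exactly the
  factor \<open>V\<close>: it does not change when \<open>U\<close> is multiplied on the right by an
  invertible matrix commuting with \<open>J\<close>, and \<open>V\<close> is recovered by dividing
  the other two factors off \<open>U\<close>. The angle doubles because J also inverts the
  hyperbolic factor when it is moved across it. Since cosh is even, only the moduli of the angles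
  survive, which is the sign ambiguity in the statement. The two families are told apart by sign: in
  the top left block nonzero entries of \<theta> give eigenvalues above 1, and nonzero entries of
  \<gamma> give eigenvalues below -1. Eigenvalues of modulus one also come from the identity parts
  of the hyperbolic factors, so zero angles are recovered only by counting what is left
  over.\<close>

class star_div_algebra = real_div_algebra + conjugate +
  fixes re :: "'a \<Rightarrow> real"
  assumes conjugate_plus: "conjugate (x + y) = conjugate x + conjugate y"
    and conjugate_times: "conjugate (x * y) = conjugate y * conjugate x"
    and conjugate_scaleR_one: "conjugate (scaleR r 1) = scaleR r 1"
    and plus_conjugate: "x + conjugate x = scaleR (2 * re x) 1"
    and times_conjugate: "x * conjugate x = scaleR (re (x * conjugate x)) 1"
    and re_times_conjugate_pos: "x \<noteq> 0 \<Longrightarrow> re (x * conjugate x) > 0"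

instantiation real :: star_div_algebra
begin
definition re_real :: "real \<Rightarrow> real" where "re_real x = x"
instance
proof
  fix x :: real
  show "x \<noteq> 0 \<Longrightarrow> re (x * conjugate x) > 0"
    by (auto simp: re_real_def zero_less_mult_iff)
qed (simp_all add: re_real_def)
end

instantiation complex :: star_div_algebra
begin
definition re_complex :: "complex \<Rightarrow> real" where "re_complex z = Re z"
instance
  by standard
    (simp_all add: re_complex_def complex_eq_iff sum_squares_gt_zero_iff)
end

instantiation quat :: star_div_algebra
begin
definition re_quat :: "quat \<Rightarrow> real" where "re_quat x = qRe x"
instance
proof
  fix x :: quat
  show "x \<noteq> 0 \<Longrightarrow> re (x * conjugate x) > 0"
  proof -
    assume "x \<noteq> 0"
    then have "qRe x \<noteq> 0 \<or> qIm1 x \<noteq> 0 \<or> qIm2 x \<noteq> 0 \<or> qIm3 x \<noteq> 0"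
      by (auto simp: quat_eq_iff)
    moreover have "qRe x * qRe x \<ge> 0" "qIm1 x * qIm1 x \<ge> 0" "qIm2 x * qIm2 x \<ge> 0" "qIm3 x * qIm3 x \<ge> 0"
      by simp_all
    moreover have "a \<noteq> 0 \<Longrightarrow> a * a > 0" for a :: real
      by (auto simp: zero_less_mult_iff)
    ultimately have "0 < qRe x * qRe x + qIm1 x * qIm1 x + qIm2 x * qIm2 x + qIm3 x * qIm3 x"
      by (smt (verit))
    then show "re (x * conjugate x) > 0" by (simp add: re_quat_def)
  qed
qed (simp_all add: re_quat_def quat_eq_iff algebra_simps)
end

section \<open>Conjugation and the real part\<close>

lemma conjugate_of_real [simp]: "conjugate (of_real r :: 'a::star_div_algebra) = of_real r"
  by (simp add: of_real_def conjugate_scaleR_one)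

lemma conjugate_0 [simp]: "conjugate (0 :: 'a::star_div_algebra) = 0"
  using conjugate_of_real[of 0] by simp

lemma conjugate_1 [simp]: "conjugate (1 :: 'a::star_div_algebra) = 1"
  using conjugate_of_real[of 1] by simp

lemma conjugate_uminus [simp]: "conjugate (- x) = - conjugate (x :: 'a::star_div_algebra)"
  using conjugate_plus[of x "- x"] by (simp add: add_eq_0_iff)

lemma conjugate_minus: "conjugate (x - y) = conjugate x - conjugate (y :: 'a::star_div_algebra)"
  using conjugate_plus[of x "- y"] by simp

lemma conjugate_sum: "conjugate (sum f A) = (\<Sum>x\<in>A. conjugate (f x :: 'a::star_div_algebra))"
  by (induction A rule: infinite_finite_induct) (simp_all add: conjugate_plus)

lemma of_real_commute: "x * of_real r = of_real r * (x :: 'a::real_algebra_1)"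
  by (simp add: of_real_def)

lemma plus_conjugate_of_real: "x + conjugate x = of_real (re x) + of_real (re (x :: 'a::star_div_algebra))"
  using scaleR_left_distrib[of "re x" "re x" "1::'a"] by (simp add: of_real_def plus_conjugate)

text \<open>The axiom \<open>plus_conjugate\<close> determines \<open>re\<close> because the real
  numbers embed injectively. The rules for \<open>re\<close> thus reduce to identities for
  \<open>x + conjugate x\<close>.\<close>

lemma re_unique:
  assumes "x + conjugate x = of_real r + of_real r"
  shows "re (x :: 'a::star_div_algebra) = r"
proof -
  have "(of_real (re x + re x) :: 'a) = of_real (r + r)"
    using assms plus_conjugate_of_real[of x] unfolding of_real_add by metis
  then show ?thesis unfolding of_real_eq_iff by simp
qed

lemma re_of_real [simp]: "re (of_real r :: 'a::star_div_algebra) = r"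
  by (rule re_unique) simp

lemma re_0 [simp]: "re (0 :: 'a::star_div_algebra) = 0"
  using re_of_real[of 0] by simp

lemma re_plus [simp]: "re (x + y) = re x + re (y :: 'a::star_div_algebra)"
proof (rule re_unique)
  have "x + y + conjugate (x + y) = (x + conjugate x) + (y + conjugate y)"
    by (simp add: conjugate_plus)
  then show "x + y + conjugate (x + y) = of_real (re x + re y) + of_real (re x + re y)"
    by (simp add: plus_conjugate_of_real distrib_left add_ac)
qed

lemma re_uminus [simp]: "re (- x) = - re (x :: 'a::star_div_algebra)"
  using re_plus[of x "- x"] by simp

lemma re_minus [simp]: "re (x - y) = re x - re (y :: 'a::star_div_algebra)"
  using re_plus[of x "- y"] by simp

lemma re_sum: "re (sum f A) = (\<Sum>x\<in>A. re (f x :: 'a::star_div_algebra))"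
  by (induction A rule: infinite_finite_induct) simp_all

lemma re_of_real_times [simp]: "re (of_real r * x) = r * re (x :: 'a::star_div_algebra)"
proof (rule re_unique)
  have "of_real r * x + conjugate (of_real r * x) = of_real r * (x + conjugate x)"
    by (simp add: conjugate_times of_real_commute[of "conjugate x"] distrib_left)
  then show "of_real r * x + conjugate (of_real r * x) = of_real (r * re x) + of_real (r * re x)"
    by (simp add: plus_conjugate_of_real distrib_left add_ac)
qed

lemma re_times_of_real [simp]: "re (x * of_real r) = r * re (x :: 'a::star_div_algebra)"
  by (simp add: of_real_commute[of x])

lemma re_conjugate [simp]: "re (conjugate x) = re (x :: 'a::star_div_algebra)"
  by (rule re_unique) (metis add.commute conjugate_id plus_conjugate_of_real)

lemma self_conjugate_of_real:
  "conjugate x = x \<Longrightarrow> x = of_real (re (x :: 'a::star_div_algebra))"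
proof -
  assume "conjugate x = x"
  then have "x + x = of_real (re x) + of_real (re x)"
    using plus_conjugate_of_real[of x] by simp
  then show ?thesis by (metis scaleR_half_double)
qed

section \<open>The squared norm of a scalar\<close>

definition nsq :: "'a::star_div_algebra \<Rightarrow> real" where
  "nsq x = re (x * conjugate x)"

lemma times_conjugate_nsq: "x * conjugate x = of_real (nsq x)"
  by (simp add: of_real_def nsq_def times_conjugate[symmetric])

text \<open>The two orders of the product agree despite noncommutativity: after multiplication by a
  nonzero \<open>x\<close> from the left both sides are \<open>x * of_real (nsq x)\<close>, because
  norms are central, and \<open>x\<close> can be cancelled.\<close>

lemma conjugate_times_nsq: "conjugate x * x = of_real (nsq x)"
proof (cases "x = 0")
  case False
  have "x * (conjugate x * x) = x * of_real (nsq x)"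
    by (simp add: mult.assoc[symmetric] times_conjugate_nsq of_real_commute[of x])
  then show ?thesis using False by (metis mult_left_cancel)
qed (simp add: nsq_def)

lemma nsq_0 [simp]: "nsq 0 = 0"
  by (simp add: nsq_def)

lemma nsq_pos_iff [simp]: "nsq x > 0 \<longleftrightarrow> x \<noteq> 0"
  using re_times_conjugate_pos[of x] by (auto simp: nsq_def)

lemma nsq_nonneg [simp]: "nsq x \<ge> 0"
  using nsq_pos_iff[of x] by (cases "x = 0") (auto intro: less_imp_le simp del: nsq_pos_iff)

lemma nsq_eq_0_iff [simp]: "nsq x = 0 \<longleftrightarrow> x = 0"
  using nsq_pos_iff[of x] by (metis less_irrefl nsq_0)

lemma nsq_conjugate [simp]: "nsq (conjugate x) = nsq x"
  unfolding nsq_def using arg_cong[OF conjugate_times_nsq[of x], of re]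
  by (simp add: nsq_def)

lemma nsq_uminus [simp]: "nsq (- x) = nsq x"
  by (simp add: nsq_def)

lemma nsq_times: "nsq (x * y) = nsq x * nsq y"
proof -
  have "x * y * conjugate (x * y) = x * (y * conjugate y) * conjugate x"
    by (simp add: conjugate_times mult.assoc)
  also have "\<dots> = of_real (nsq y) * (x * conjugate x)"
    by (simp add: times_conjugate_nsq of_real_commute[of x] mult.assoc)
  also have "\<dots> = of_real (nsq y * nsq x)"
    by (simp add: times_conjugate_nsq)
  finally have "re (x * y * conjugate (x * y)) = nsq y * nsq x" by simp
  then show ?thesis by (simp add: nsq_def)
qed

lemma re_conjugate_times_commute: "re (conjugate y * x) = re (conjugate x * y)"
  by (metis conjugate_id conjugate_times re_conjugate)

text \<open>Polarization: both \<open>nsq (x + y)\<close> and \<open>nsq (x - y)\<close> are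
  nonnegative. This arithmetic mean form of the Cauchy-Schwarz inequality avoids square
  roots.\<close>

lemma re_conjugate_times_le: "\<bar>re (conjugate x * y)\<bar> \<le> (nsq x + nsq y) / 2"
proof -
  have sq: "re (conjugate z * z) = nsq z" for z :: 'a
    by (simp add: conjugate_times_nsq)
  have "nsq (x + y) = nsq x + nsq y + 2 * re (conjugate x * y)"
    unfolding sq[symmetric]
    by (simp add: conjugate_plus distrib_left distrib_right re_conjugate_times_commute[of y x])
  moreover have "nsq (x - y) = nsq x + nsq y - 2 * re (conjugate x * y)"
    unfolding sq[symmetric]
    by (simp add: conjugate_minus left_diff_distrib right_diff_distrib re_conjugate_times_commute[of y x])
  ultimately have "2 * re (conjugate x * y) \<le> nsq x + nsq y"
    and "- (2 * re (conjugate x * y)) \<le> nsq x + nsq y"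
    using nsq_nonneg[of "x + y"] nsq_nonneg[of "x - y"] by linarith+
  then show ?thesis by simp
qed

text \<open>Gaussian elimination, one equation and one unknown at a time. With coefficients on the
  left and unknowns on the right it needs no commutativity. The later dimension arguments rest on
  this lemma.\<close>

lemma underdetermined_system_nontrivial:
  fixes A :: "'i \<Rightarrow> 'j \<Rightarrow> 'a::division_ring"
  assumes "finite I" and "finite J" and "card I < card J"
  shows "\<exists>x. (\<exists>j\<in>J. x j \<noteq> 0) \<and> (\<forall>i\<in>I. (\<Sum>j\<in>J. A i j * x j) = 0)"
  using assms
proof (induction I arbitrary: J A rule: finite_induct)
  case empty
  then have "J \<noteq> {}" by auto
  then show ?case by (auto intro!: exI[of _ "\<lambda>_. 1"])
next
  case (insert r I)
  note fin = \<open>finite J\<close>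
  show ?case
  proof (cases "\<forall>j\<in>J. A r j = 0")
    case True
    have "card I < card J" using insert by simp
    then obtain x where "\<exists>j\<in>J. x j \<noteq> 0" "\<forall>i\<in>I. (\<Sum>j\<in>J. A i j * x j) = 0"
      using insert.IH[of J A] fin by blast
    with True show ?thesis by (intro exI[of _ x]) auto
  next
    case False
    then obtain k where k: "k \<in> J" "A r k \<noteq> 0" by blast
    let ?J = "J - {k}"
    \<comment> \<open>Subtracting a left multiple of the pivot row \<open>r\<close> removes the
      unknown \<open>k\<close> from equation \<open>i\<close>.\<close>
    let ?B = "\<lambda>i j. A i j - A i k * inverse (A r k) * A r j"
    have "card I < card ?J" using insert k by simp
    then obtain x where x: "\<exists>j\<in>?J. x j \<noteq> 0" "\<forall>i\<in>I. (\<Sum>j\<in>?J. ?B i j * x j) = 0"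
      using insert.IH[of ?J ?B] fin by blast
    define s where "s = (\<Sum>j\<in>?J. A r j * x j)"
    \<comment> \<open>The value at \<open>k\<close> solves the pivot equation for the eliminated
      unknown.\<close>
    define y where "y = x(k := - (inverse (A r k) * s))"
    have split: "(\<Sum>j\<in>J. A i j * y j) = (\<Sum>j\<in>?J. A i j * x j) - A i k * (inverse (A r k) * s)" for i
    proof -
      have "(\<Sum>j\<in>J. A i j * y j) = A i k * y k + (\<Sum>j\<in>?J. A i j * y j)"
        using k fin by (simp add: sum.remove)
      also have "(\<Sum>j\<in>?J. A i j * y j) = (\<Sum>j\<in>?J. A i j * x j)"
        by (rule sum.cong) (auto simp: y_def)
      finally show ?thesis by (simp add: y_def)
    qed
    have "(\<Sum>j\<in>J. A r j * y j) = 0"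
      unfolding split using k by (simp add: s_def mult.assoc[symmetric])
    moreover have "(\<Sum>j\<in>J. A i j * y j) = 0" if "i \<in> I" for i
    proof -
      have "(\<Sum>j\<in>?J. ?B i j * x j) = (\<Sum>j\<in>?J. A i j * x j) - A i k * (inverse (A r k) * s)"
        by (simp add: s_def left_diff_distrib sum_subtractf sum_distrib_left mult.assoc)
      then show ?thesis using x(2) that split by simp
    qed
    moreover have "\<exists>j\<in>J. y j \<noteq> 0" using x(1) by (auto simp: y_def)
    ultimately show ?thesis by (intro exI[of _ y]) auto
  qed
qed

section \<open>Self-adjoint matrices\<close>

lemma re_1 [simp]: "re (1 :: 'a::star_div_algebra) = 1"
  using re_of_real[of 1] by simp

text \<open>Vectors are functions of which only the values below \<open>n\<close> matter. Scalars
  act from the right, so that a matrix acting from the left is linear over a noncommutative division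
  algebra.\<close>

definition ip :: "nat \<Rightarrow> (nat \<Rightarrow> 'a::star_div_algebra) \<Rightarrow> (nat \<Rightarrow> 'a) \<Rightarrow> 'a" where
  "ip n u v = (\<Sum>i<n. conjugate (u i) * v i)"

definition mv :: "nat \<Rightarrow> (nat \<Rightarrow> nat \<Rightarrow> 'a::star_div_algebra) \<Rightarrow> (nat \<Rightarrow> 'a) \<Rightarrow> nat \<Rightarrow> 'a" where
  "mv n A v i = (\<Sum>j<n. A i j * v j)"

definition nrm2 :: "nat \<Rightarrow> (nat \<Rightarrow> 'a::star_div_algebra) \<Rightarrow> real" where
  "nrm2 n v = (\<Sum>i<n. nsq (v i))"

definition qform :: "nat \<Rightarrow> (nat \<Rightarrow> nat \<Rightarrow> 'a::star_div_algebra) \<Rightarrow> (nat \<Rightarrow> 'a) \<Rightarrow> real" where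
  "qform n A v = re (ip n v (mv n A v))"

definition selfadj :: "nat \<Rightarrow> (nat \<Rightarrow> nat \<Rightarrow> 'a::star_div_algebra) \<Rightarrow> bool" where
  "selfadj n A \<longleftrightarrow> (\<forall>i<n. \<forall>j<n. conjugate (A j i) = A i j)"

lemma ip_self: "ip n v v = of_real (nrm2 n v)"
  by (simp add: ip_def nrm2_def conjugate_times_nsq)

lemma conjugate_ip: "conjugate (ip n u v) = ip n v u"
  by (simp add: ip_def conjugate_sum conjugate_times)

lemma ip_cong: "(\<And>i. i < n \<Longrightarrow> u i = u' i) \<Longrightarrow> (\<And>i. i < n \<Longrightarrow> v i = v' i) \<Longrightarrow> ip n u v = ip n u' v'"
  by (simp add: ip_def)

lemma ip_add_right: "ip n u (\<lambda>i. v i + w i) = ip n u v + ip n u w"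
  by (simp add: ip_def distrib_left sum.distrib)

lemma ip_add_left: "ip n (\<lambda>i. v i + w i) u = ip n v u + ip n w u"
  by (simp add: ip_def distrib_right conjugate_plus sum.distrib)

lemma ip_times_right: "ip n u (\<lambda>i. v i * c) = ip n u v * c"
  by (simp add: ip_def sum_distrib_right mult.assoc)

lemma ip_times_left: "ip n (\<lambda>i. v i * c) u = conjugate c * ip n v u"
  by (simp add: ip_def sum_distrib_left mult.assoc conjugate_times)

lemma mv_add: "mv n A (\<lambda>i. v i + w i) = (\<lambda>i. mv n A v i + mv n A w i)"
  by (simp add: mv_def fun_eq_iff distrib_left sum.distrib)

lemma mv_times: "mv n A (\<lambda>i. v i * c) = (\<lambda>i. mv n A v i * c)"
  by (simp add: mv_def fun_eq_iff sum_distrib_right mult.assoc)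

lemma mv_add_scalar:
  "i < n \<Longrightarrow> mv n (\<lambda>i j. A i j + (if i = j then of_real c else 0)) v i = mv n A v i + v i * of_real c"
  by (simp add: mv_def distrib_right sum.distrib if_distrib[of "\<lambda>x. x * _"] sum.delta' of_real_commute[of "v i"]
      cong: if_cong)

lemma ip_mv_selfadj:
  assumes "selfadj n A"
  shows "ip n u (mv n A v) = ip n (mv n A u) v"
proof -
  have "ip n u (mv n A v) = (\<Sum>i<n. \<Sum>j<n. conjugate (u i) * (A i j * v j))"
    by (simp add: ip_def mv_def sum_distrib_left)
  also have "\<dots> = (\<Sum>j<n. \<Sum>i<n. conjugate (u i) * (A i j * v j))"
    by (rule sum.swap)
  also have "\<dots> = (\<Sum>j<n. \<Sum>i<n. conjugate (A j i * u i) * v j)"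
    using assms by (intro sum.cong refl) (simp add: selfadj_def conjugate_times mult.assoc)
  also have "\<dots> = ip n (mv n A u) v"
    by (simp add: ip_def mv_def conjugate_sum sum_distrib_right)
  finally show ?thesis .
qed

lemma nrm2_nonneg [simp]: "nrm2 n v \<ge> 0"
  by (simp add: nrm2_def sum_nonneg)

lemma nrm2_eq_0_iff: "nrm2 n v = 0 \<longleftrightarrow> (\<forall>i<n. v i = 0)"
  by (auto simp: nrm2_def sum_nonneg_eq_0_iff)

lemma nsq_le_nrm2: "i < n \<Longrightarrow> nsq (v i) \<le> nrm2 n v"
  unfolding nrm2_def by (rule member_le_sum) auto

section \<open>Positive semidefinite forms and solvability\<close>

lemma quadratic_nonneg_discriminant:
  fixes a b c :: real
  assumes "\<And>t. 0 \<le> a + 2 * t * b + t\<^sup>2 * c" and "c \<ge> 0"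
  shows "b\<^sup>2 \<le> a * c"
proof (cases "c = 0")
  case True
  have "b = 0"
  proof (rule ccontr)
    assume "b \<noteq> 0"
    \<comment> \<open>At this \<open>t\<close> the affine function \<open>a + 2 * t * b\<close>
      takes the value -1.\<close>
    then show False using assms(1)[of "- (a + 1) / (2 * b)"] True by (simp add: field_simps)
  qed
  then show ?thesis using True by simp
next
  case False
  then have "c > 0" using assms(2) by simp
  \<comment> \<open>The value at the minimizer \<open>- b / c\<close> of the parabola.\<close>
  have "0 \<le> (a + 2 * (- b / c) * b + (- b / c)\<^sup>2 * c) * c"
    using assms(1)[of "- b / c"] \<open>c > 0\<close> by (intro mult_nonneg_nonneg) auto
  also have "\<dots> = a * c - b\<^sup>2"
    using \<open>c > 0\<close> by (simp add: field_simps power2_eq_square)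
  finally show ?thesis by simp
qed

text \<open>The form is nonnegative at \<open>u + t v\<close> for every real \<open>t\<close>, so
  the discriminant is not positive. Only real multiples are tested, hence the bound concerns the
  real part of the mixed term.\<close>

lemma psd_Cauchy_Schwarz:
  assumes "selfadj n A" and psd: "\<And>u. qform n A u \<ge> 0"
  shows "(re (ip n u (mv n A v)))\<^sup>2 \<le> qform n A u * qform n A v"
proof (rule quadratic_nonneg_discriminant)
  fix t
  have "re (ip n v (mv n A u)) = re (ip n u (mv n A v))"
    by (metis assms(1) conjugate_ip ip_mv_selfadj re_conjugate)
  then have "qform n A (\<lambda>i. u i + v i * of_real t) = qform n A u + 2 * t * re (ip n u (mv n A v)) + t\<^sup>2 * qform n A v"
    by (simp add: qform_def mv_add mv_times ip_add_left ip_add_right ip_times_left ip_times_right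
        distrib_left power2_eq_square)
  then show "0 \<le> qform n A u + 2 * t * re (ip n u (mv n A v)) + t\<^sup>2 * qform n A v"
    using psd by metis
qed (rule psd)

lemma qform_bounded:
  obtains R where "R > 0" and "\<And>u. \<bar>qform n A u\<bar> \<le> R * nrm2 n u"
proof
  \<comment> \<open>The entry in row \<open>i\<close> and column \<open>j\<close> contributes at
    most \<open>(1 + nsq (A i j)) / 2\<close> times the squared norm. The constant finally used is
    \<open>?R + 1\<close>, which is positive even for \<open>n = 0\<close>.\<close>
  let ?R = "(\<Sum>i<n. \<Sum>j<n. (1 + nsq (A i j)) / 2)"
  have R0: "?R \<ge> 0" by (intro sum_nonneg) (simp add: add_nonneg_nonneg)
  then show "?R + 1 > 0" by simp
  fix u
  have "qform n A u = (\<Sum>i<n. \<Sum>j<n. re (conjugate (u i) * (A i j * u j)))"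
    by (simp add: qform_def ip_def mv_def re_sum sum_distrib_left)
  then have "\<bar>qform n A u\<bar> \<le> (\<Sum>i<n. \<Sum>j<n. \<bar>re (conjugate (u i) * (A i j * u j))\<bar>)"
    by (auto intro: order_trans[OF sum_abs] sum_mono)
  also have "\<dots> \<le> (\<Sum>i<n. \<Sum>j<n. (1 + nsq (A i j)) / 2 * nrm2 n u)"
  proof (intro sum_mono)
    fix i j assume ij: "i \<in> {..<n}" "j \<in> {..<n}"
    have "\<bar>re (conjugate (u i) * (A i j * u j))\<bar> \<le> (nsq (u i) + nsq (A i j) * nsq (u j)) / 2"
      using re_conjugate_times_le[of "u i" "A i j * u j"] by (simp add: nsq_times)
    also have "\<dots> \<le> (nrm2 n u + nsq (A i j) * nrm2 n u) / 2"
      using ij by (intro divide_right_mono add_mono mult_left_mono nsq_le_nrm2) auto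
    also have "\<dots> = (1 + nsq (A i j)) / 2 * nrm2 n u" by (simp add: field_simps)
    finally show "\<bar>re (conjugate (u i) * (A i j * u j))\<bar> \<le> (1 + nsq (A i j)) / 2 * nrm2 n u" .
  qed
  also have "\<dots> = ?R * nrm2 n u" by (simp add: sum_distrib_right)
  also have "\<dots> \<le> (?R + 1) * nrm2 n u" by (intro mult_right_mono) auto
  finally show "\<bar>qform n A u\<bar> \<le> (?R + 1) * nrm2 n u" .
qed

text \<open>Adjoin \<open>- b\<close> as column \<open>n\<close>: a system of \<open>n\<close>
  equations in \<open>n + 1\<close> unknowns has a nontrivial solution. Injectivity forces its last
  coordinate to be nonzero, and dividing by it on the right solves the original system.\<close>

lemma injective_imp_solvable:
  assumes inj: "\<And>v. (\<forall>i<n. mv n A v i = 0) \<Longrightarrow> \<forall>i<n. v i = 0"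
  shows "\<exists>x. \<forall>i<n. mv n A x i = b i"
proof -
  let ?A = "\<lambda>i j. if j = n then - b i else A i j"
  obtain x where x: "\<exists>j\<in>{..n}. x j \<noteq> 0" "\<forall>i\<in>{..<n}. (\<Sum>j\<in>{..n}. ?A i j * x j) = 0"
    using underdetermined_system_nontrivial[of "{..<n}" "{..n}" ?A] by auto
  have eq: "mv n A x i = b i * x n" if "i < n" for i
  proof -
    have "(\<Sum>j\<in>{..n}. ?A i j * x j) = (\<Sum>j<n. ?A i j * x j) - b i * x n"
      by (simp add: lessThan_Suc_atMost[symmetric])
    also have "(\<Sum>j<n. ?A i j * x j) = mv n A x i"
      unfolding mv_def by (rule sum.cong) auto
    finally show ?thesis using x(2) that by simp
  qed
  have "x n \<noteq> 0"
  proof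
    assume "x n = 0"
    then have "\<forall>i<n. x i = 0" using inj[of x] eq by simp
    then show False using x(1) \<open>x n = 0\<close> by (metis atMost_iff le_neq_implies_less)
  qed
  then have "mv n A (\<lambda>i. x i * inverse (x n)) i = b i" if "i < n" for i
    unfolding mv_times using eq[OF that] by (simp add: mult.assoc)
  then show ?thesis by blast
qed

text \<open>With a right inverse \<open>C\<close> of \<open>A\<close>, the Cauchy-Schwarz inequality
  for \<open>v\<close> and \<open>C v\<close> bounds the square of \<open>nrm2 n v\<close> by
  \<open>qform n A v * qform n C v\<close>, whose last factor is at most
  \<open>R * nrm2 n v\<close>. Hence \<open>inverse R\<close> serves as \<open>e\<close>.\<close>

lemma psd_injective_coercive:
  assumes "selfadj n A" and psd: "\<And>u. qform n A u \<ge> 0"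
    and inj: "\<And>v. (\<forall>i<n. mv n A v i = 0) \<Longrightarrow> \<forall>i<n. v i = 0"
  obtains e where "e > 0" and "\<And>u. e * nrm2 n u \<le> qform n A u"
proof -
  have "\<exists>x. \<forall>i<n. mv n A x i = (if i = k then 1 else 0)" for k
    by (rule injective_imp_solvable) (rule inj)
  then obtain X where X: "\<And>k i. i < n \<Longrightarrow> mv n A (X k) i = (if i = k then 1 else 0)"
    by metis
  define C where "C = (\<lambda>i k. X k i)"
  have AC: "mv n A (mv n C v) i = v i" if "i < n" for v i
  proof -
    have "mv n A (mv n C v) i = (\<Sum>j<n. \<Sum>k<n. A i j * (X k j * v k))"
      by (simp add: mv_def C_def sum_distrib_left)
    also have "\<dots> = (\<Sum>k<n. \<Sum>j<n. A i j * (X k j * v k))" by (rule sum.swap)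
    also have "\<dots> = (\<Sum>k<n. mv n A (X k) i * v k)"
      by (simp add: mv_def sum_distrib_right mult.assoc)
    also have "\<dots> = v i"
      using that by (simp add: X if_distrib[of "\<lambda>x. x * _"] sum.delta' cong: if_cong)
    finally show ?thesis .
  qed
  obtain R where R: "R > 0" "\<And>u. \<bar>qform n C u\<bar> \<le> R * nrm2 n u"
    using qform_bounded by blast
  have bound: "inverse R * nrm2 n v \<le> qform n A v" for v
  proof (cases "nrm2 n v = 0")
    case True
    then show ?thesis using psd by simp
  next
    case False
    let ?w = "mv n C v"
    have "ip n v (mv n A ?w) = ip n v v" by (rule ip_cong) (simp_all add: AC)
    then have "(nrm2 n v)\<^sup>2 \<le> qform n A v * qform n A ?w"
      using psd_Cauchy_Schwarz[OF assms(1) psd, of v ?w] by (simp add: ip_self)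
    also have "qform n A ?w = qform n C v"
    proof -
      have "ip n ?w (mv n A ?w) = ip n ?w v" by (rule ip_cong) (simp_all add: AC)
      then show ?thesis unfolding qform_def by (metis conjugate_ip re_conjugate)
    qed
    also have "qform n A v * qform n C v \<le> qform n A v * (R * nrm2 n v)"
      using R(2)[of v] psd by (intro mult_left_mono) auto
    finally have "nrm2 n v * nrm2 n v \<le> (qform n A v * R) * nrm2 n v"
      by (simp add: power2_eq_square mult_ac)
    then have "nrm2 n v \<le> qform n A v * R"
      using False nrm2_nonneg[of n v] by (simp add: mult_le_cancel_right)
    then show ?thesis using R(1) by (simp add: field_simps)
  qed
  show thesis using that[of "inverse R"] R(1) bound by simp
qed

lemma qform_add_scalar:
  "qform n (\<lambda>i j. A i j + (if i = j then of_real c else 0)) v = qform n A v + c * nrm2 n v"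
proof -
  have "ip n v (mv n (\<lambda>i j. A i j + (if i = j then of_real c else 0)) v)
      = ip n v (\<lambda>i. mv n A v i + v i * of_real c)"
    by (rule ip_cong) (simp_all add: mv_add_scalar)
  then show ?thesis by (simp add: qform_def ip_add_right ip_times_right ip_self)
qed

lemma selfadj_add_scalar:
  "selfadj n A \<Longrightarrow> selfadj n (\<lambda>i j. A i j + (if i = j then of_real c else 0))"
  by (auto simp: selfadj_def conjugate_plus)

text \<open>
  No compactness is needed: if the infimum of the Rayleigh quotient were not an eigenvalue,
  the shifted matrix would be invertible, hence bounded below by a positive multiple of the norm.
\<close>

lemma lowest_eigenvector:
  assumes "selfadj n A" and "n > 0"
  obtains l w where "\<exists>i<n. w i \<noteq> 0" and "\<And>i. i < n \<Longrightarrow> mv n A w i = w i * of_real l"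
    and "\<And>u. l * nrm2 n u \<le> qform n A u"
proof -
  \<comment> \<open>The lower bounds of the Rayleigh quotient, stated without division so that the
    zero vector needs no exception. Their supremum is the infimum of the quotient.\<close>
  define L where "L = {l. \<forall>u. l * nrm2 n u \<le> qform n A u}"
  obtain R where R: "R > 0" "\<And>u. \<bar>qform n A u\<bar> \<le> R * nrm2 n u"
    using qform_bounded by blast
  have "- R * nrm2 n u \<le> qform n A u" for u
    using R(2)[of u] by (simp add: abs_le_iff)
  then have "- R \<in> L" by (auto simp: L_def)
  \<comment> \<open>A unit vector; the value of the form at it bounds \<open>L\<close> from
    above.\<close>
  define u0 :: "nat \<Rightarrow> 'a" where "u0 = (\<lambda>i. if i = 0 then 1 else 0)"
  have "nrm2 n u0 = (\<Sum>i<n. if i = 0 then 1 else 0)"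
    unfolding nrm2_def u0_def by (rule sum.cong) (auto simp: nsq_def)
  then have u0: "nrm2 n u0 = 1" using \<open>n > 0\<close> by simp
  have bdd: "bdd_above L"
    using u0 by (intro bdd_aboveI[of _ "qform n A u0"]) (auto simp: L_def dest: spec[of _ u0])
  define l where "l = Sup L"
  have l: "l * nrm2 n u \<le> qform n A u" for u
  proof (cases "nrm2 n u = 0")
    case True
    then show ?thesis using R(2)[of u] by simp
  next
    case False
    then have pos: "nrm2 n u > 0" using nrm2_nonneg[of n u] by linarith
    have "l \<le> qform n A u / nrm2 n u"
      unfolding l_def
    proof (rule cSup_least)
      show "L \<noteq> {}" using \<open>- R \<in> L\<close> by blast
      show "x \<le> qform n A u / nrm2 n u" if "x \<in> L" for x
        using that pos by (simp add: L_def pos_le_divide_eq)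
    qed
    then show ?thesis using pos by (simp add: field_simps)
  qed
  define B where "B = (\<lambda>i j. A i j + (if i = j then of_real (- l) else 0))"
  have B: "selfadj n B" "qform n B u = qform n A u - l * nrm2 n u" for u
    unfolding B_def using selfadj_add_scalar[OF assms(1), of "- l"] by (simp_all only: qform_add_scalar)
  have "\<exists>w. (\<forall>i<n. mv n B w i = 0) \<and> (\<exists>i<n. w i \<noteq> 0)"
  proof (rule ccontr)
    assume "\<not> ?thesis"
    \<comment> \<open>If the shifted matrix were injective, coercivity would raise the lower bound
      \<open>l\<close> to \<open>l + e\<close>.\<close>
    then obtain e where e: "e > 0" "\<And>u. e * nrm2 n u \<le> qform n B u"
      using psd_injective_coercive[OF B(1)] l B(2) by (smt (verit))
    then have "l + e \<in> L" by (auto simp: L_def B(2) algebra_simps)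
    then have "l + e \<le> l" unfolding l_def using bdd by (intro cSup_upper)
    then show False using e(1) by simp
  qed
  then obtain w where w: "\<And>i. i < n \<Longrightarrow> mv n B w i = 0" "\<exists>i<n. w i \<noteq> 0" by blast
  have "mv n A w i = w i * of_real l" if "i < n" for i
    using w(1)[OF that] mv_add_scalar[OF that, of A "- l" w] unfolding B_def by simp
  then show thesis using that w(2) l by blast
qed

text \<open>
  Raising the known eigenvalues above all the others forces the lowest eigenvector of the modified
  matrix to be a new one, orthogonal to the known eigenvectors.
\<close>

lemma extend_eigenvectors:
  assumes sa: "selfadj n A" and "k < n"
    and orth: "\<And>a b. a < k \<Longrightarrow> b < k \<Longrightarrow> ip n (v a) (v b) = (if a = b then 1 else 0)"
    and eig: "\<And>a i. a < k \<Longrightarrow> i < n \<Longrightarrow> mv n A (v a) i = v a i * of_real (d a)"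
  obtains w l where "ip n w w = 1" and "\<And>a. a < k \<Longrightarrow> ip n (v a) w = 0"
    and "\<And>i. i < n \<Longrightarrow> mv n A w i = w i * of_real l"
proof -
  obtain R where R: "R > 0" "\<And>u. \<bar>qform n A u\<bar> \<le> R * nrm2 n u"
    using qform_bounded by blast
  \<comment> \<open>The known eigenvalues are at least \<open>- R\<close>, so after adding
    \<open>C\<close> they are at least \<open>R + 1\<close>, whereas the lowest eigenvalue of
    \<open>B\<close> turns out to be at most \<open>R\<close>.\<close>
  define C where "C = 2 * R + 1"
  define B where "B = (\<lambda>i j. A i j + of_real C * (\<Sum>a<k. v a i * conjugate (v a j)))"
  have B: "selfadj n B"
    using sa by (auto simp: selfadj_def B_def conjugate_plus conjugate_times conjugate_sum
        of_real_commute[of "sum _ _"])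
  have mvB: "mv n B u i = mv n A u i + of_real C * (\<Sum>a<k. v a i * ip n (v a) u)" for u i
  proof -
    have "mv n B u i = mv n A u i + (\<Sum>j<n. of_real C * (\<Sum>a<k. v a i * conjugate (v a j)) * u j)"
      by (simp add: mv_def B_def distrib_right sum.distrib)
    also have "(\<Sum>j<n. of_real C * (\<Sum>a<k. v a i * conjugate (v a j)) * u j)
        = of_real C * (\<Sum>j<n. \<Sum>a<k. v a i * (conjugate (v a j) * u j))"
      by (simp add: sum_distrib_left sum_distrib_right mult.assoc)
    also have "(\<Sum>j<n. \<Sum>a<k. v a i * (conjugate (v a j) * u j))
        = (\<Sum>a<k. \<Sum>j<n. v a i * (conjugate (v a j) * u j))" by (rule sum.swap)
    also have "\<dots> = (\<Sum>a<k. v a i * ip n (v a) u)"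
      by (simp add: ip_def sum_distrib_left)
    finally show ?thesis .
  qed
  have "n > 0" using \<open>k < n\<close> by simp
  obtain l w where w: "\<exists>i<n. w i \<noteq> 0" "\<And>i. i < n \<Longrightarrow> mv n B w i = w i * of_real l"
    and l: "\<And>u. l * nrm2 n u \<le> qform n B u"
    by (rule lowest_eigenvector[OF B \<open>n > 0\<close>]) blast
  \<comment> \<open>Since \<open>k < n\<close>, some nonzero vector is orthogonal to all known
    eigenvectors, and on it the forms of \<open>B\<close> and \<open>A\<close> agree.\<close>
  have "l \<le> R"
  proof -
    obtain u where u: "\<exists>j<n. u j \<noteq> 0" "\<And>a. a < k \<Longrightarrow> ip n (v a) u = 0"
      using underdetermined_system_nontrivial[of "{..<k}" "{..<n}" "\<lambda>a j. conjugate (v a j)"] \<open>k < n\<close>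
      unfolding ip_def by auto
    have "nrm2 n u \<noteq> 0" using u(1) nrm2_eq_0_iff[of n u] by blast
    then have pos: "nrm2 n u > 0" using nrm2_nonneg[of n u] by linarith
    have "mv n B u = mv n A u" by (rule ext) (simp add: mvB u)
    then have "qform n B u = qform n A u" by (simp add: qform_def)
    then have "l * nrm2 n u \<le> R * nrm2 n u" using l[of u] R(2)[of u] by simp
    then show ?thesis using pos by simp
  qed
  have orth_w: "ip n (v a) w = 0" if a: "a < k" for a
  proof -
    have eigB: "mv n B (v a) i = v a i * of_real (d a + C)" if "i < n" for i
    proof -
      have "(\<Sum>b<k. v b i * ip n (v b) (v a)) = (\<Sum>b<k. if b = a then v b i else 0)"
        using a by (intro sum.cong) (auto simp: orth)
      also have "\<dots> = v a i" using a by simp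
      finally show ?thesis using eig[OF a that]
        by (simp add: mvB distrib_left of_real_commute[of "v a i"])
    qed
    have "qform n A (v a) = d a"
    proof -
      have "ip n (v a) (mv n A (v a)) = ip n (v a) (\<lambda>i. v a i * of_real (d a))"
        by (rule ip_cong) (simp_all add: eig a)
      then show ?thesis by (simp add: qform_def ip_times_right orth a)
    qed
    moreover have "nrm2 n (v a) = 1"
      using ip_self[of n "v a"] orth[OF a a] by (metis of_real_1 of_real_eq_iff)
    ultimately have "- R \<le> d a" using R(2)[of "v a"] by simp
    then have ne: "d a + C \<noteq> l" using \<open>l \<le> R\<close> R(1) by (simp add: C_def)
    \<comment> \<open>Eigenvectors of the self-adjoint \<open>B\<close> for different eigenvalues
      are orthogonal.\<close>
    have "ip n (v a) (mv n B w) = ip n (v a) w * of_real l"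
      unfolding ip_times_right[symmetric] by (rule ip_cong) (simp_all add: w)
    moreover have "ip n (mv n B (v a)) w = of_real (d a + C) * ip n (v a) w"
    proof -
      have "ip n (mv n B (v a)) w = ip n (\<lambda>i. v a i * of_real (d a + C)) w"
        by (rule ip_cong) (simp_all add: eigB del: of_real_add)
      then show ?thesis unfolding ip_times_left conjugate_of_real .
    qed
    ultimately have "of_real (d a + C) * ip n (v a) w = of_real l * ip n (v a) w"
      using ip_mv_selfadj[OF B, of "v a" w] of_real_commute[of "ip n (v a) w" l] by metis
    then show ?thesis using ne by (metis mult_right_cancel of_real_eq_iff)
  qed
  have eigA: "mv n A w i = w i * of_real l" if "i < n" for i
    using w(2)[OF that] mvB[of w i] by (simp add: orth_w)
  define s where "s = inverse (sqrt (nrm2 n w))"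
  have "nrm2 n w \<noteq> 0" using w(1) nrm2_eq_0_iff[of n w] by blast
  then have pos: "nrm2 n w > 0" using nrm2_nonneg[of n w] by linarith
  let ?w = "\<lambda>i. w i * of_real s"
  have "s * (nrm2 n w * s) = 1"
    using pos real_sqrt_pow2[of "nrm2 n w"] by (simp add: s_def field_simps power2_eq_square)
  then have "ip n ?w ?w = 1"
    by (simp add: ip_times_left ip_times_right ip_self flip: of_real_mult)
  moreover have "ip n (v a) ?w = 0" if "a < k" for a
    by (simp add: ip_times_right orth_w that)
  moreover have "mv n A ?w i = ?w i * of_real l" if "i < n" for i
    using that by (simp add: mv_times eigA mult.assoc of_real_commute[of "of_real l" s])
  ultimately show thesis using that by blast
qed

text \<open>The induction is on the number \<open>k\<close> of eigenvectors while \<open>n\<close>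
  and \<open>A\<close> stay fixed, so \<open>A\<close> is never restricted to an orthogonal
  complement.\<close>

lemma spectral_theorem_vectors:
  assumes sa: "selfadj n A" and "k \<le> n"
  shows "\<exists>v d. (\<forall>a<k. \<forall>b<k. ip n (v a) (v b) = (if a = b then 1 else 0)) \<and>
    (\<forall>a<k. \<forall>i<n. mv n A (v a) i = v a i * of_real (d a))"
  using \<open>k \<le> n\<close>
proof (induction k)
  case (Suc k)
  from Suc.IH[OF Suc_leD[OF Suc.prems]] obtain v d
    where "(\<forall>a<k. \<forall>b<k. ip n (v a) (v b) = (if a = b then 1 else 0)) \<and>
      (\<forall>a<k. \<forall>i<n. mv n A (v a) i = v a i * of_real (d a))"
    by (elim exE)
  then have v: "\<And>a b. a < k \<Longrightarrow> b < k \<Longrightarrow> ip n (v a) (v b) = (if a = b then 1 else 0)"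
    "\<And>a i. a < k \<Longrightarrow> i < n \<Longrightarrow> mv n A (v a) i = v a i * of_real (d a)"
    by blast+
  have "k < n" using Suc.prems by simp
  obtain w l where w: "ip n w w = 1" "\<And>a. a < k \<Longrightarrow> ip n (v a) w = 0"
    "\<And>i. i < n \<Longrightarrow> mv n A w i = w i * of_real l"
    using extend_eigenvectors[OF sa \<open>k < n\<close>, where v = v and d = d, OF v] by metis
  have w': "ip n w (v a) = 0" if "a < k" for a
    using w(2)[OF that] conjugate_ip[of n "v a" w] by simp
  show ?case
    by (rule exI[of _ "v(k := w)"], rule exI[of _ "d(k := l)"])
      (auto simp: less_Suc_eq v w w')
qed simp

section \<open>Matrix groups and the spectral theorem\<close>

lemma ctranspose_dim [simp]: "dim_row (ctranspose A) = dim_col A" "dim_col (ctranspose A) = dim_row A"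
  by (simp_all add: ctranspose_def)

lemma ctranspose_carrier [simp]: "A \<in> carrier_mat m n \<Longrightarrow> ctranspose A \<in> carrier_mat n m"
  by (simp add: ctranspose_def)

lemma ctranspose_index [simp]:
  "i < dim_col A \<Longrightarrow> j < dim_row A \<Longrightarrow> ctranspose A $$ (i, j) = conjugate (A $$ (j, i))"
  by (simp add: ctranspose_def)

lemma ctranspose_ctranspose [simp]: "ctranspose (ctranspose A) = A"
  by (rule eq_matI) auto

lemma index_mult_mat_sum:
  assumes "A \<in> carrier_mat a b" "B \<in> carrier_mat b c" "i < a" "j < c"
  shows "(A * B) $$ (i, j) = (\<Sum>k<b. A $$ (i, k) * B $$ (k, j))"
  using assms by (auto simp: scalar_prod_def atLeast0LessThan intro!: sum.cong)

lemma ctranspose_mult: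
  fixes A B :: "'a::star_div_algebra mat"
  assumes A: "A \<in> carrier_mat a b" and B: "B \<in> carrier_mat b c"
  shows "ctranspose (A * B) = ctranspose B * ctranspose A"
proof (rule eq_matI)
  fix i j assume "i < dim_row (ctranspose B * ctranspose A)" "j < dim_col (ctranspose B * ctranspose A)"
  then have ij: "i < c" "j < a" using A B by auto
  then show "ctranspose (A * B) $$ (i, j) = (ctranspose B * ctranspose A) $$ (i, j)"
    using A B ij
    by (simp add: index_mult_mat_sum[OF A B] conjugate_sum conjugate_times
        index_mult_mat_sum[OF ctranspose_carrier[OF B] ctranspose_carrier[OF A]] del: index_mult_mat(1))
qed (use A B in auto)

section \<open>Real diagonal matrices and inverses\<close>

definition rdiag :: "nat \<Rightarrow> (nat \<Rightarrow> real) \<Rightarrow> 'a::real_algebra_1 mat" where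
  "rdiag n f = mat n n (\<lambda>(i, j). if i = j then of_real (f i) else 0)"

lemma rdiag_carrier [simp]: "rdiag n f \<in> carrier_mat n n"
  by (simp add: rdiag_def)

lemma rdiag_dim [simp]: "dim_row (rdiag n f) = n" "dim_col (rdiag n f) = n"
  by (simp_all add: rdiag_def)

lemma rdiag_index: "i < n \<Longrightarrow> j < n \<Longrightarrow> rdiag n f $$ (i, j) = (if i = j then of_real (f i) else 0)"
  by (simp add: rdiag_def)

lemma rdiag_mult_index:
  assumes "A \<in> carrier_mat n m" "i < n" "j < m"
  shows "(rdiag n f * A) $$ (i, j) = of_real (f i) * A $$ (i, j)"
proof -
  have "(rdiag n f * A) $$ (i, j) = (\<Sum>k<n. if k = i then of_real (f i) * A $$ (i, j) else 0)"
    unfolding index_mult_mat_sum[OF rdiag_carrier assms]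
    using assms by (intro sum.cong) (auto simp: rdiag_index)
  then show ?thesis using assms by simp
qed

lemma mult_rdiag_index:
  assumes "A \<in> carrier_mat m n" "i < m" "j < n"
  shows "(A * rdiag n f) $$ (i, j) = A $$ (i, j) * of_real (f j)"
proof -
  have "(A * rdiag n f) $$ (i, j) = (\<Sum>k<n. if k = j then A $$ (i, j) * of_real (f j) else 0)"
    unfolding index_mult_mat_sum[OF assms(1) rdiag_carrier assms(2,3)]
    using assms by (intro sum.cong) (auto simp: rdiag_index)
  then show ?thesis using assms by simp
qed

lemma rdiag_mult_rdiag: "rdiag n f * rdiag n g = rdiag n (\<lambda>i. f i * g i)"
  by (rule eq_matI) (auto simp: rdiag_mult_index[of _ n n] rdiag_index simp del: index_mult_mat(1))

lemma rdiag_one: "rdiag n (\<lambda>_. 1) = 1\<^sub>m n"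
  by (rule eq_matI) (auto simp: rdiag_index)

lemma ctranspose_rdiag [simp]: "ctranspose (rdiag n f :: 'a::star_div_algebra mat) = rdiag n f"
  by (rule eq_matI) (auto simp: rdiag_index)

text \<open>\<open>B\<close> is injective because \<open>A\<close> undoes it, so it has a right
  inverse \<open>C\<close>, built column by column, and \<open>A = A * (B * C) = C\<close>. This
  takes the place of a determinant argument.\<close>

lemma left_inverse_imp_right_inverse:
  fixes A B :: "'a::star_div_algebra mat"
  assumes A: "A \<in> carrier_mat n n" and B: "B \<in> carrier_mat n n" and AB: "A * B = 1\<^sub>m n"
  shows "B * A = 1\<^sub>m n"
proof -
  let ?f = "\<lambda>i j. B $$ (i, j)"
  have inj: "\<forall>i<n. v i = 0" if v: "\<forall>i<n. mv n ?f v i = 0" for v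
  proof (intro allI impI)
    fix i assume i: "i < n"
    let ?v = "mat n 1 (\<lambda>(i, j). v i)"
    have vc: "?v \<in> carrier_mat n 1" by simp
    have "B * ?v = 0\<^sub>m n 1"
    proof (rule eq_matI)
      fix i j assume "i < dim_row (0\<^sub>m n 1 :: 'a mat)" "j < dim_col (0\<^sub>m n 1 :: 'a mat)"
      then have ij: "i < n" "j < 1" by auto
      then show "(B * ?v) $$ (i, j) = 0\<^sub>m n 1 $$ (i, j)"
        unfolding index_mult_mat_sum[OF B vc ij] using v by (simp add: mv_def)
    qed (use B in auto)
    then have "A * (B * ?v) = 0\<^sub>m n 1" using A by simp
    moreover have "A * (B * ?v) = A * B * ?v" using A B vc by (metis assoc_mult_mat)
    ultimately have "?v = 0\<^sub>m n 1" unfolding AB by (metis left_mult_one_mat vc)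
    then have "?v $$ (i, 0) = 0\<^sub>m n 1 $$ (i, 0)" by (simp only:)
    then show "v i = 0" using i by simp
  qed
  have "\<exists>x. \<forall>i<n. mv n ?f x i = (if i = k then 1 else 0)" for k
    by (rule injective_imp_solvable) (rule inj)
  then obtain X where X: "\<And>k i. i < n \<Longrightarrow> mv n ?f (X k) i = (if i = k then 1 else 0)"
    by metis
  define C where "C = mat n n (\<lambda>(i, k). X k i)"
  have C: "C \<in> carrier_mat n n" by (simp add: C_def)
  have BC: "B * C = 1\<^sub>m n"
  proof (rule eq_matI)
    fix i k assume "i < dim_row (1\<^sub>m n :: 'a mat)" "k < dim_col (1\<^sub>m n :: 'a mat)"
    then have ik: "i < n" "k < n" by auto
    have "(B * C) $$ (i, k) = mv n ?f (X k) i"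
      unfolding index_mult_mat_sum[OF B C ik] mv_def using ik
      by (intro sum.cong) (auto simp: C_def)
    then show "(B * C) $$ (i, k) = 1\<^sub>m n $$ (i, k)" using X ik by simp
  qed (use B C in auto)
  have "A = A * (B * C)" unfolding BC using A by simp
  also have "\<dots> = A * B * C" using A B C by (metis assoc_mult_mat)
  also have "\<dots> = C" unfolding AB using C by simp
  finally show ?thesis using BC by simp
qed

lemma mult_mat_cancel_left:
  fixes A :: "'a::semiring_1 mat"
  assumes "A * B = 1\<^sub>m n" "A \<in> carrier_mat n n" "B \<in> carrier_mat n n" "C \<in> carrier_mat n m"
  shows "A * (B * C) = C"
  unfolding assoc_mult_mat[OF assms(2,3,4), symmetric] assms(1)
  using assms(4) by (rule left_mult_one_mat)

section \<open>Unitary matrices\<close>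

lemma unitary_groupD:
  assumes "G \<in> unitary_group n"
  shows "G \<in> carrier_mat n n" and "ctranspose G * G = 1\<^sub>m n"
  using assms by (simp_all add: unitary_group_def)

lemma unitary_group_right:
  fixes G :: "'a::star_div_algebra mat"
  assumes "G \<in> unitary_group n"
  shows "G * ctranspose G = 1\<^sub>m n"
  by (rule left_inverse_imp_right_inverse[OF ctranspose_carrier])
    (rule unitary_groupD[OF assms])+

lemma unitary_group_ctranspose:
  fixes G :: "'a::star_div_algebra mat"
  assumes "G \<in> unitary_group n"
  shows "ctranspose G \<in> unitary_group n"
  using unitary_groupD[OF assms] unitary_group_right[OF assms] by (simp add: unitary_group_def)

lemma unitary_group_mult:
  fixes G H :: "'a::star_div_algebra mat"
  assumes "G \<in> unitary_group n" "H \<in> unitary_group n"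
  shows "G * H \<in> unitary_group n"
proof -
  note GH = unitary_groupD[OF assms(1)] unitary_groupD[OF assms(2)]
  have "ctranspose (G * H) * (G * H) = ctranspose H * (ctranspose G * (G * H))"
    using GH by (simp add: ctranspose_mult[of _ n n _ n] assoc_mult_mat[of _ n n _ n _ n])
  also have "\<dots> = 1\<^sub>m n"
    using GH by (simp add: mult_mat_cancel_left[of _ _ n])
  finally have "ctranspose (G * H) * (G * H) = 1\<^sub>m n" .
  then show ?thesis using GH by (simp add: unitary_group_def)
qed

lemma unitary_group_col_sum:
  fixes G :: "'a::star_div_algebra mat"
  assumes G: "G \<in> unitary_group n" and j: "j < n"
  shows "(\<Sum>i<n. nsq (G $$ (i, j))) = 1"
proof -
  note c = unitary_groupD(1)[OF G]
  have "(ctranspose G * G) $$ (j, j) = of_real (\<Sum>i<n. nsq (G $$ (i, j)))"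
    unfolding index_mult_mat_sum[OF ctranspose_carrier[OF c] c j j]
    using c j by (auto simp: conjugate_times_nsq intro!: sum.cong)
  then show ?thesis using unitary_groupD(2)[OF G] j by (metis index_one_mat(1) of_real_1 of_real_eq_iff)
qed

lemma unitary_group_row_sum:
  fixes G :: "'a::star_div_algebra mat"
  assumes G: "G \<in> unitary_group n" and i: "i < n"
  shows "(\<Sum>j<n. nsq (G $$ (i, j))) = 1"
proof -
  have "(\<Sum>j<n. nsq (ctranspose G $$ (j, i))) = 1"
    by (rule unitary_group_col_sum[OF unitary_group_ctranspose[OF G] i])
  then show ?thesis using unitary_groupD(1)[OF G] i by simp
qed

text \<open>The entries of an intertwiner vanish unless the eigenvalues agree, and
  the squared norms of the entries of a unitary matrix form a doubly stochastic matrix.\<close>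

lemma unitary_intertwiner_multiplicities:
  fixes G :: "'a::star_div_algebra mat"
  assumes G: "G \<in> unitary_group n" and eq: "G * rdiag n d = rdiag n d' * G"
  shows "card {j \<in> {..<n}. d j = c} = card {i \<in> {..<n}. d' i = c}"
proof -
  note Gc = unitary_groupD(1)[OF G]
  let ?J = "{j \<in> {..<n}. d j = c}" and ?I = "{i \<in> {..<n}. d' i = c}"
  have z: "G $$ (i, j) = 0" if "i < n" "j < n" "d j \<noteq> d' i" for i j
  proof -
    have "G $$ (i, j) * of_real (d j) = of_real (d' i) * G $$ (i, j)"
      using arg_cong[OF eq, of "\<lambda>M. M $$ (i, j)"] Gc that
      by (simp add: mult_rdiag_index[OF Gc] rdiag_mult_index[OF Gc] del: index_mult_mat(1))
    then have "of_real (d j) * G $$ (i, j) = of_real (d' i) * G $$ (i, j)"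
      by (simp add: of_real_commute[of "G $$ (i, j)"])
    then show ?thesis using that by (metis mult_right_cancel of_real_eq_iff)
  qed
  then have z': "G $$ (i, j) \<noteq> 0 \<Longrightarrow> i < n \<Longrightarrow> j < n \<Longrightarrow> d j = d' i" for i j by blast
  have "real (card ?J) = (\<Sum>j\<in>?J. \<Sum>i<n. nsq (G $$ (i, j)))"
    by (simp add: unitary_group_col_sum[OF G])
  also have "\<dots> = (\<Sum>j\<in>?J. \<Sum>i\<in>?I. nsq (G $$ (i, j)))"
    by (rule sum.cong[OF refl], rule sum.mono_neutral_right) (auto dest: z')
  also have "\<dots> = (\<Sum>i\<in>?I. \<Sum>j\<in>?J. nsq (G $$ (i, j)))" by (rule sum.swap)
  also have "\<dots> = (\<Sum>i\<in>?I. \<Sum>j<n. nsq (G $$ (i, j)))"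
    by (rule sum.cong[OF refl], rule sum.mono_neutral_left) (auto dest: z')
  also have "\<dots> = real (card ?I)"
    by (simp add: unitary_group_row_sum[OF G])
  finally show ?thesis by simp
qed

lemma spectral_theorem:
  fixes H :: "'a::star_div_algebra mat"
  assumes H: "H \<in> carrier_mat n n" and sa: "ctranspose H = H"
  obtains G d where "G \<in> unitary_group n" and "ctranspose G * H * G = rdiag n d"
proof -
  let ?h = "\<lambda>i j. H $$ (i, j)"
  have "selfadj n ?h"
    unfolding selfadj_def using H sa by (metis carrier_matD ctranspose_index)
  from spectral_theorem_vectors[OF this order_refl] obtain v d where vd:
    "(\<forall>a<n. \<forall>b<n. ip n (v a) (v b) = (if a = b then 1 else 0)) \<and>
     (\<forall>a<n. \<forall>i<n. mv n ?h (v a) i = v a i * of_real (d a))"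
    by (elim exE)
  then have orth: "\<And>a b. a < n \<Longrightarrow> b < n \<Longrightarrow> ip n (v a) (v b) = (if a = b then 1 else 0)"
    and eig: "\<And>a i. a < n \<Longrightarrow> i < n \<Longrightarrow> mv n ?h (v a) i = v a i * of_real (d a)"
    by blast+
  define G where "G = mat n n (\<lambda>(i, a). v a i)"
  have G: "G \<in> carrier_mat n n" by (simp add: G_def)
  have GG: "ctranspose G * G = 1\<^sub>m n"
  proof (rule eq_matI)
    fix a b assume "a < dim_row (1\<^sub>m n :: 'a mat)" "b < dim_col (1\<^sub>m n :: 'a mat)"
    then have ab: "a < n" "b < n" by auto
    have "(ctranspose G * G) $$ (a, b) = ip n (v a) (v b)"
      unfolding index_mult_mat_sum[OF ctranspose_carrier[OF G] G ab] ip_def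
      using ab by (intro sum.cong) (auto simp: G_def)
    then show "(ctranspose G * G) $$ (a, b) = 1\<^sub>m n $$ (a, b)" using orth ab by simp
  qed (use G in auto)
  have HG: "H * G = G * rdiag n d"
  proof (rule eq_matI)
    fix i a assume "i < dim_row (G * rdiag n d)" "a < dim_col (G * rdiag n d)"
    then have ia: "i < n" "a < n" using G by auto
    have "(H * G) $$ (i, a) = mv n ?h (v a) i"
      unfolding index_mult_mat_sum[OF H G ia] mv_def
      using ia by (intro sum.cong) (auto simp: G_def)
    also have "\<dots> = G $$ (i, a) * of_real (d a)"
      using eig ia by (simp add: G_def)
    also have "\<dots> = (G * rdiag n d) $$ (i, a)"
      by (rule mult_rdiag_index[OF G ia, symmetric])
    finally show "(H * G) $$ (i, a) = (G * rdiag n d) $$ (i, a)" .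
  qed (use H G in auto)
  have "ctranspose G * H * G = ctranspose G * (H * G)"
    using G H by (simp add: assoc_mult_mat[of _ n n _ n _ n])
  also have "\<dots> = ctranspose G * G * rdiag n d"
    unfolding HG using G by (simp add: assoc_mult_mat[of _ n n _ n _ n])
  finally have "ctranspose G * H * G = rdiag n d" by (simp add: GG)
  then show thesis using that G GG by (simp add: unitary_group_def)
qed

section \<open>Hyperbolic rotations\<close>

text \<open>All hyperbolic rotations at once, one for each pair formed by \<open>i\<close> and
  \<open>\<tau> i\<close>, without reference to block sizes. At a fixed point of
  \<open>\<tau>\<close> both summands fall on the diagonal, which is why \<open>compat\<close> below
  demands the angle 0 there.\<close>

definition hmat :: "nat \<Rightarrow> (nat \<Rightarrow> nat) \<Rightarrow> (nat \<Rightarrow> real) \<Rightarrow> 'a::real_algebra_1 mat" where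
  "hmat n \<tau> \<phi> = mat n n (\<lambda>(i, j). of_real
     ((if j = i then cosh (\<phi> i) else 0) + (if j = \<tau> i then sinh (\<phi> i) else 0)))"

lemma hmat_carrier [simp]: "hmat n \<tau> \<phi> \<in> carrier_mat n n"
  by (simp add: hmat_def)

lemma hmat_dim [simp]: "dim_row (hmat n \<tau> \<phi>) = n" "dim_col (hmat n \<tau> \<phi>) = n"
  by (simp_all add: hmat_def)

lemma hmat_index:
  "i < n \<Longrightarrow> j < n \<Longrightarrow> hmat n \<tau> \<phi> $$ (i, j) =
     of_real ((if j = i then cosh (\<phi> i) else 0) + (if j = \<tau> i then sinh (\<phi> i) else 0))"
  by (simp add: hmat_def)

text \<open>Makes a commutation rule for two factors applicable at the front of a right-associated
  product.\<close>

lemma mult_mat_extend: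
  fixes A :: "'a::semiring_0 mat"
  assumes "A * B = C * D" "A \<in> carrier_mat n n" "B \<in> carrier_mat n n" "C \<in> carrier_mat n n"
    "D \<in> carrier_mat n n" "X \<in> carrier_mat n n"
  shows "A * (B * X) = C * (D * X)"
  unfolding assoc_mult_mat[OF assms(2,3,6), symmetric] assoc_mult_mat[OF assms(4,5,6), symmetric]
    assms(1) ..

text \<open>\<open>s\<close> and \<open>e\<close> are the diagonals of \<open>S\<close> and
  \<open>J\<close>. Both change sign along a pair joined by \<open>\<tau>\<close>, so conjugation by
  either sign matrix reverses the angles of \<open>hmat\<close>.\<close>

locale signed_pairing =
  fixes n :: nat and \<tau> :: "nat \<Rightarrow> nat" and s e :: "nat \<Rightarrow> real"
  assumes \<tau>_less: "i < n \<Longrightarrow> \<tau> i < n"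
    and \<tau>_\<tau>: "i < n \<Longrightarrow> \<tau> (\<tau> i) = i"
    and s_cases: "i < n \<Longrightarrow> s i = 1 \<or> s i = -1"
    and e_cases: "i < n \<Longrightarrow> e i = 1 \<or> e i = -1"
    and s_\<tau>: "i < n \<Longrightarrow> \<tau> i \<noteq> i \<Longrightarrow> s (\<tau> i) = - s i"
    and e_\<tau>: "i < n \<Longrightarrow> \<tau> i \<noteq> i \<Longrightarrow> e (\<tau> i) = - e i"
begin

abbreviation S :: "'a::real_algebra_1 mat" where "S \<equiv> rdiag n s"
abbreviation J :: "'a::real_algebra_1 mat" where "J \<equiv> rdiag n e"

definition compat :: "(nat \<Rightarrow> real) \<Rightarrow> bool" where
  "compat \<phi> \<longleftrightarrow> (\<forall>i<n. \<phi> (\<tau> i) = \<phi> i \<and> (\<tau> i = i \<longrightarrow> \<phi> i = 0))"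

lemma compat_scale: "compat \<phi> \<Longrightarrow> compat (\<lambda>i. c * \<phi> i)"
  by (simp add: compat_def)

lemma compat_uminus: "compat \<phi> \<Longrightarrow> compat (\<lambda>i. - \<phi> i)"
  by (simp add: compat_def)

lemma hmat_mult_index:
  fixes A :: "'a::real_algebra_1 mat"
  assumes "A \<in> carrier_mat n n" "i < n" "j < n"
  shows "(hmat n \<tau> \<phi> * A) $$ (i, j) =
    of_real (cosh (\<phi> i)) * A $$ (i, j) + of_real (sinh (\<phi> i)) * A $$ (\<tau> i, j)"
proof -
  have "(hmat n \<tau> \<phi> * A) $$ (i, j) =
    (\<Sum>k<n. (if k = i then of_real (cosh (\<phi> i)) * A $$ (i, j) else 0) +
      (if k = \<tau> i then of_real (sinh (\<phi> i)) * A $$ (\<tau> i, j) else 0))"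
    unfolding index_mult_mat_sum[OF hmat_carrier assms]
    using assms by (intro sum.cong) (auto simp: hmat_index distrib_right)
  then show ?thesis using assms \<tau>_less[OF assms(2)] by (simp add: sum.distrib)
qed

text \<open>On each pair this is the addition theorem for hyperbolic rotations of the plane;
  \<open>compat\<close> ensures that both rows of a pair carry the same angle.\<close>

lemma hmat_mult_hmat:
  assumes "compat \<phi>" "compat \<psi>"
  shows "hmat n \<tau> \<phi> * hmat n \<tau> \<psi> = (hmat n \<tau> (\<lambda>i. \<phi> i + \<psi> i) :: 'a::real_algebra_1 mat)"
proof (rule eq_matI)
  fix i j assume "i < dim_row (hmat n \<tau> (\<lambda>i. \<phi> i + \<psi> i) :: 'a mat)"
    "j < dim_col (hmat n \<tau> (\<lambda>i. \<phi> i + \<psi> i) :: 'a mat)"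
  then have ij: "i < n" "j < n" by auto
  have "\<psi> (\<tau> i) = \<psi> i" using assms(2) ij by (simp add: compat_def)
  then show "(hmat n \<tau> \<phi> * hmat n \<tau> \<psi>) $$ (i, j) = (hmat n \<tau> (\<lambda>i. \<phi> i + \<psi> i) :: 'a mat) $$ (i, j)"
    unfolding hmat_mult_index[OF hmat_carrier ij]
    using ij \<tau>_less[OF ij(1)] \<tau>_\<tau>[OF ij(1)]
    by (auto simp: hmat_index cosh_add sinh_add algebra_simps simp flip: of_real_mult of_real_add)
qed simp_all

lemma hmat_0: "hmat n \<tau> (\<lambda>_. 0) = 1\<^sub>m n"
  by (rule eq_matI) (auto simp: hmat_index)

lemma hmat_inverse:
  assumes "compat \<phi>"
  shows "hmat n \<tau> \<phi> * hmat n \<tau> (\<lambda>i. - \<phi> i) = 1\<^sub>m n" and "hmat n \<tau> (\<lambda>i. - \<phi> i) * hmat n \<tau> \<phi> = 1\<^sub>m n"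
  using hmat_mult_hmat[OF assms compat_uminus[OF assms]] hmat_mult_hmat[OF compat_uminus[OF assms] assms]
  by (simp_all add: hmat_0)

text \<open>A sinh entry joins two indices at which \<open>f\<close> has opposite values, so moving
  \<open>rdiag n f\<close> across it changes its sign. At fixed points of \<open>\<tau>\<close> the
  sinh vanishes.\<close>

lemma hmat_rdiag:
  assumes "compat \<phi>" and f: "\<And>i. i < n \<Longrightarrow> \<tau> i \<noteq> i \<Longrightarrow> f (\<tau> i) = - f i"
  shows "hmat n \<tau> \<phi> * rdiag n f = (rdiag n f * hmat n \<tau> (\<lambda>i. - \<phi> i) :: 'a::real_algebra_1 mat)"
proof (rule eq_matI)
  fix i j assume "i < dim_row (rdiag n f * hmat n \<tau> (\<lambda>i. - \<phi> i) :: 'a mat)"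
    "j < dim_col (rdiag n f * hmat n \<tau> (\<lambda>i. - \<phi> i) :: 'a mat)"
  then have ij: "i < n" "j < n" by auto
  have "\<phi> i = 0" if "\<tau> i = i" using that assms(1) ij by (simp add: compat_def)
  then show "(hmat n \<tau> \<phi> * rdiag n f) $$ (i, j) = (rdiag n f * hmat n \<tau> (\<lambda>i. - \<phi> i) :: 'a mat) $$ (i, j)"
    unfolding rdiag_mult_index[OF hmat_carrier ij] mult_rdiag_index[OF hmat_carrier ij]
    using ij f[OF ij(1)] by (cases "\<tau> i = i") (auto simp: hmat_index simp flip: of_real_mult of_real_minus)
qed simp_all

lemma hmat_S: "compat \<phi> \<Longrightarrow> hmat n \<tau> \<phi> * S = S * hmat n \<tau> (\<lambda>i. - \<phi> i)"
  by (rule hmat_rdiag) (simp_all add: s_\<tau>)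

lemma hmat_J: "compat \<phi> \<Longrightarrow> hmat n \<tau> \<phi> * J = J * hmat n \<tau> (\<lambda>i. - \<phi> i)"
  by (rule hmat_rdiag) (simp_all add: e_\<tau>)

lemma ctranspose_hmat:
  assumes "compat \<phi>"
  shows "ctranspose (hmat n \<tau> \<phi>) = (hmat n \<tau> \<phi> :: 'a::star_div_algebra mat)"
proof (rule eq_matI)
  fix i j assume "i < dim_row (hmat n \<tau> \<phi> :: 'a mat)" "j < dim_col (hmat n \<tau> \<phi> :: 'a mat)"
  then have ij: "i < n" "j < n" by auto
  have "i = \<tau> j \<longleftrightarrow> j = \<tau> i" using \<tau>_\<tau> ij by auto
  moreover have "\<phi> (\<tau> i) = \<phi> i" using assms ij by (simp add: compat_def)
  ultimately show "ctranspose (hmat n \<tau> \<phi>) $$ (i, j) = (hmat n \<tau> \<phi> :: 'a mat) $$ (i, j)"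
    using ij by (auto simp: hmat_index simp del: of_real_add)
qed simp_all

lemma SS: "S * S = 1\<^sub>m n"
proof -
  have "S * S = (rdiag n (\<lambda>i. s i * s i) :: 'a mat)" by (rule rdiag_mult_rdiag)
  also have "\<dots> = rdiag n (\<lambda>_. 1)"
    by (rule eq_matI) (use s_cases in \<open>force simp: rdiag_index\<close>)+
  finally show ?thesis by (simp add: rdiag_one)
qed

lemma JJ: "J * J = 1\<^sub>m n"
proof -
  have "J * J = (rdiag n (\<lambda>i. e i * e i) :: 'a mat)" by (rule rdiag_mult_rdiag)
  also have "\<dots> = rdiag n (\<lambda>_. 1)"
    by (rule eq_matI) (use e_cases in \<open>force simp: rdiag_index\<close>)+
  finally show ?thesis by (simp add: rdiag_one)
qed

lemma SJ: "S * J = J * S"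
  by (simp add: rdiag_mult_rdiag mult.commute)

section \<open>The \<open>S\<close>-unitary matrices and the reflections they define\<close>

definition S_unitary :: "'a::star_div_algebra mat \<Rightarrow> bool" where
  "S_unitary U \<longleftrightarrow> U \<in> carrier_mat n n \<and> ctranspose U * S * U = S"

lemma S_unitary_carrier: "S_unitary U \<Longrightarrow> U \<in> carrier_mat n n"
  by (simp add: S_unitary_def)

text \<open>\<open>S * ctranspose U * S\<close> is a left inverse of \<open>U\<close>, hence also a
  right inverse.\<close>

lemma S_unitary_right:
  fixes U :: "'a::star_div_algebra mat"
  assumes "S_unitary U"
  shows "U * S * ctranspose U = S"
proof -
  note U = S_unitary_carrier[OF assms]
  have "S * (ctranspose U * S) * U = S * (ctranspose U * S * U)"
    using U by (simp add: assoc_mult_mat[of _ n n _ n _ n] mult_carrier_mat[of _ n n _ n])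
  also have "\<dots> = 1\<^sub>m n" using assms by (simp add: S_unitary_def SS)
  finally have "U * (S * (ctranspose U * S)) = 1\<^sub>m n"
    by (rule left_inverse_imp_right_inverse[rotated 2]) (use U in \<open>auto intro: mult_carrier_mat\<close>)
  then have "U * (S * (ctranspose U * S)) * S = S" by simp
  moreover have "U * (S * (ctranspose U * S)) * S = U * (S * (ctranspose U * (S * S)))"
    using U by (simp add: assoc_mult_mat[of _ n n _ n _ n] mult_carrier_mat[of _ n n _ n])
  ultimately show ?thesis
    using U by (simp add: SS assoc_mult_mat[of _ n n _ n _ n])
qed

text \<open>By \<open>S\<close>-unitarity, \<open>reflection U\<close> is $U J U^{-1}$.\<close>

definition reflection :: "'a::star_div_algebra mat \<Rightarrow> 'a mat" where
  "reflection U = U * J * S * ctranspose U * S"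

lemma reflection_carrier: "U \<in> carrier_mat n n \<Longrightarrow> reflection U \<in> carrier_mat n n"
  by (simp add: reflection_def mult_carrier_mat[of _ n n _ n])

text \<open>The maximal compact subgroup of the \<open>S\<close>-unitary group; for the concrete
  block sizes it consists of the matrices \<open>dsum Up Uq\<close>.\<close>

definition K_group :: "'a::star_div_algebra mat set" where
  "K_group = {k \<in> unitary_group n. k * S = S * k}"

lemma K_groupD:
  assumes "k \<in> K_group"
  shows "k \<in> carrier_mat n n" "ctranspose k * k = 1\<^sub>m n" "k * ctranspose k = 1\<^sub>m n"
    "k * S = S * k" "ctranspose k * S = S * ctranspose k"
proof -
  have u: "k \<in> unitary_group n" and c: "k * S = S * k" using assms by (simp_all add: K_group_def)
  show k: "k \<in> carrier_mat n n" "ctranspose k * k = 1\<^sub>m n" "k * ctranspose k = 1\<^sub>m n" "k * S = S * k"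
    using unitary_groupD[OF u] unitary_group_right[OF u] c by auto
  have "ctranspose (S * k) = ctranspose (k * S)" using c by simp
  then show "ctranspose k * S = S * ctranspose k"
    using k(1) by (simp add: ctranspose_mult[of _ n n _ n])
qed

lemma K_group_ctranspose: "k \<in> K_group \<Longrightarrow> ctranspose k \<in> K_group"
  using K_groupD[of k] by (simp add: K_group_def unitary_group_ctranspose)

lemma K_group_mult: 
  assumes "k \<in> K_group" "l \<in> K_group"
  shows "k * l \<in> K_group"
proof -
  note k = K_groupD[OF assms(1)] and l = K_groupD[OF assms(2)]
  have "k * l * S = k * (S * l)" using k l by (simp add: assoc_mult_mat[of _ n n _ n _ n])
  also have "\<dots> = S * (k * l)"
    using mult_mat_extend[OF k(4) k(1) _ _ k(1) l(1)] by simp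
  finally show ?thesis using assms by (simp add: K_group_def unitary_group_mult)
qed

lemma S_unitary_K_mult:
  assumes "k \<in> K_group" "S_unitary U"
  shows "S_unitary (k * U)"
proof -
  note k = K_groupD[OF assms(1)] and U = S_unitary_carrier[OF assms(2)]
  have "ctranspose (k * U) * S * (k * U) = ctranspose U * (ctranspose k * (S * (k * U)))"
    using k(1) U by (simp add: ctranspose_mult[of _ n n _ n] assoc_mult_mat[of _ n n _ n _ n] mult_carrier_mat[of _ n n _ n])
  also have "S * (k * U) = k * (S * U)"
    using mult_mat_extend[OF k(4) k(1) _ _ k(1) U] by simp
  also have "ctranspose k * \<dots> = S * U"
    using k U by (intro mult_mat_cancel_left[of _ _ n]) (auto simp: mult_carrier_mat[of _ n n _ n])
  also have "ctranspose U * \<dots> = S"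
    using assms(2) U by (simp add: S_unitary_def assoc_mult_mat[of _ n n _ n _ n])
  finally show ?thesis using k U by (simp add: S_unitary_def)
qed

text \<open>\<open>ctranspose k\<close> is the inverse of \<open>k\<close> and commutes with
  \<open>S\<close>, so the compact factor acts on reflections by conjugation.\<close>

lemma reflection_K_mult:
  assumes "k \<in> K_group" "U \<in> carrier_mat n n"
  shows "reflection (k * U) = k * reflection U * ctranspose k"
  using K_groupD(1,5)[OF assms(1)] assms(2) unfolding reflection_def
  by (simp add: ctranspose_mult[of _ n n _ n] assoc_mult_mat[of _ n n _ n _ n] mult_carrier_mat[of _ n n _ n])

lemma reflection_factorization:
  fixes U :: "'a::star_div_algebra mat"
  assumes k: "k \<in> K_group" and \<phi>: "compat \<phi>" and V: "S_unitary V" "V * J = J * V"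
    and U: "U = k * hmat n \<tau> \<phi> * V"
  shows "reflection U = k * hmat n \<tau> (\<lambda>i. 2 * \<phi> i) * J * ctranspose k"
proof -
  let ?A = "hmat n \<tau> \<phi> :: 'a mat" and ?A' = "hmat n \<tau> (\<lambda>i. - \<phi> i) :: 'a mat"
  note kc = K_groupD[OF k] and Vc = S_unitary_carrier[OF V(1)]
  note [simp] = kc(1) Vc mult_carrier_mat[of _ n n _ n] assoc_mult_mat[of _ n n _ n _ n]
  have "reflection (?A * V) = ?A * (V * (J * (S * (ctranspose V * (?A * S)))))"
    by (simp add: reflection_def ctranspose_mult[of _ n n _ n] ctranspose_hmat[OF \<phi>])
  \<comment> \<open>\<open>V\<close> is moved across \<open>J\<close>, and \<open>?A\<close> across
    \<open>S\<close> with reversed angles. This brings \<open>V\<close> together with its inverse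
    \<open>S * ctranspose V * S\<close>, and the pair cancels.\<close>
  also have "\<dots> = ?A * (J * (V * (S * (ctranspose V * (S * ?A')))))"
    using mult_mat_extend[OF V(2), where n = n] by (simp add: hmat_S[OF \<phi>])
  also have "V * (S * (ctranspose V * (S * ?A'))) = ?A'"
  proof -
    have "V * (S * (ctranspose V * (S * ?A'))) = (V * S * ctranspose V) * (S * ?A')" by simp
    also have "\<dots> = S * (S * ?A')" using S_unitary_right[OF V(1)] by simp
    also have "\<dots> = ?A'" by (rule mult_mat_cancel_left[OF SS]) auto
    finally show ?thesis .
  qed
  also have "J * ?A' = ?A * J" by (simp add: hmat_J[OF \<phi>])
  also have "?A * (?A * J) = hmat n \<tau> (\<lambda>i. 2 * \<phi> i) * J"
  proof -
    have "?A * (?A * J) = ?A * ?A * J" by simp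
    also have "?A * ?A = hmat n \<tau> (\<lambda>i. 2 * \<phi> i)"
      using hmat_mult_hmat[OF \<phi> \<phi>] by (simp only: mult_2)
    finally show ?thesis .
  qed
  finally have "reflection (?A * V) = hmat n \<tau> (\<lambda>i. 2 * \<phi> i) * J" .
  then have "reflection (k * (?A * V)) = k * (hmat n \<tau> (\<lambda>i. 2 * \<phi> i) * J) * ctranspose k"
    using reflection_K_mult[OF k, of "?A * V"] mult_carrier_mat[OF hmat_carrier Vc] by simp
  moreover have "k * (?A * V) = U" unfolding U by simp
  ultimately show ?thesis by simp
qed

lemma factorization_of_reflection:
  fixes U :: "'a::star_div_algebra mat"
  assumes k: "k \<in> K_group" and \<phi>: "compat \<phi>" and U: "S_unitary U"
    and M: "reflection U = k * hmat n \<tau> (\<lambda>i. 2 * \<phi> i) * J * ctranspose k"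
  obtains V where "S_unitary V" "V * J = J * V" "U = k * hmat n \<tau> \<phi> * V"
proof -
  let ?A = "hmat n \<tau> \<phi> :: 'a mat" and ?A' = "hmat n \<tau> (\<lambda>i. - \<phi> i) :: 'a mat"
    and ?A2 = "hmat n \<tau> (\<lambda>i. 2 * \<phi> i) :: 'a mat"
  note kc = K_groupD[OF k] and Uc = S_unitary_carrier[OF U]
  note c = kc(1) Uc mult_carrier_mat[of _ n n _ n] 
  note [simp] = c assoc_mult_mat[of _ n n _ n _ n]
  define W where "W = ctranspose k * U"
  \<comment> \<open>The desired factorization forces this choice. \<open>S\<close>-unitarity is
    inherited from \<open>W\<close>; the assumed form of the reflection yields commutation with
    \<open>J\<close>.\<close>
  define V where "V = ?A' * W"
  have Wc [simp]: "W \<in> carrier_mat n n" and Vc [simp]: "V \<in> carrier_mat n n"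
    by (simp_all add: V_def W_def)
  have WS: "S_unitary W" unfolding W_def by (rule S_unitary_K_mult[OF K_group_ctranspose[OF k] U])
  have "ctranspose V * S * V = ctranspose W * (?A' * (S * (?A' * W)))"
    by (simp add: V_def ctranspose_mult[of _ n n _ n] ctranspose_hmat compat_uminus \<phi>)
  also have "S * (?A' * W) = ?A * (S * W)"
    using mult_mat_extend[OF hmat_S[OF \<phi>, symmetric], where n = n and X = W] by simp
  also have "?A' * \<dots> = S * W"
    by (rule mult_mat_cancel_left[OF hmat_inverse(2)[OF \<phi>]]) auto
  also have "ctranspose W * (S * W) = S" using WS by (simp add: S_unitary_def)
  finally have VS: "S_unitary V" by (simp add: S_unitary_def)
  have "reflection W = ctranspose k * reflection U * k"
    unfolding W_def using reflection_K_mult[OF K_group_ctranspose[OF k], of U] by simp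
  also have "\<dots> = ctranspose k * (k * (?A2 * (J * (ctranspose k * k))))"
    unfolding M by simp
  also have "ctranspose k * k = 1\<^sub>m n" by (rule kc(2))
  also have "ctranspose k * (k * (?A2 * (J * 1\<^sub>m n))) = ?A2 * (J * 1\<^sub>m n)"
    by (rule mult_mat_cancel_left[OF kc(2)]) auto
  also have "\<dots> = ?A2 * J" by simp
  finally have MW: "reflection W = ?A2 * J" .
  have "reflection W * W = W * (J * (S * (ctranspose W * S * W)))"
    by (simp add: reflection_def)
  also have "\<dots> = W * (J * (S * S))" using WS by (simp add: S_unitary_def)
  also have "\<dots> = W * J" by (simp add: SS)
  \<comment> \<open>The conjugate of \<open>J\<close> by \<open>W\<close> is \<open>?A2 * J\<close>,
    written without an inverse.\<close>
  finally have WJ: "W * J = ?A2 * (J * W)" by (simp add: MW)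
  have "V * J = ?A' * (W * J)" by (simp add: V_def)
  also have "\<dots> = (?A' * ?A2) * (J * W)" unfolding WJ by simp
  also have "?A' * ?A2 = ?A"
    using hmat_mult_hmat[OF compat_uminus[OF \<phi>] compat_scale[OF \<phi>, of 2]] by simp
  also have "?A * (J * W) = J * (?A' * W)"
    using mult_mat_extend[OF hmat_J[OF \<phi>], where n = n and X = W] by simp
  finally have VJ: "V * J = J * V" by (simp add: V_def)
  have "k * ?A * V = k * (?A * (?A' * W))" by (simp add: V_def)
  also have "?A * (?A' * W) = W"
    by (rule mult_mat_cancel_left[OF hmat_inverse(1)[OF \<phi>] hmat_carrier hmat_carrier Wc])
  also have "k * W = U" unfolding W_def
    by (rule mult_mat_cancel_left[OF kc(3) kc(1) ctranspose_carrier[OF kc(1)] Uc])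
  finally show thesis using that VS VJ by simp
qed

lemma reflection_square:
  fixes U :: "'a::star_div_algebra mat"
  assumes U: "S_unitary U"
  shows "reflection U * reflection U = 1\<^sub>m n"
proof -
  note Uc = S_unitary_carrier[OF U]
  note [simp] = Uc mult_carrier_mat[of _ n n _ n] assoc_mult_mat[of _ n n _ n _ n]
  have "reflection U * reflection U = U * (J * (S * ((ctranspose U * S * U) * (J * (S * (ctranspose U * S))))))"
    by (simp add: reflection_def)
  also have "ctranspose U * S * U = S" using U by (simp add: S_unitary_def)
  also have "S * (S * (J * (S * (ctranspose U * S)))) = J * (S * (ctranspose U * S))"
    by (rule mult_mat_cancel_left[OF SS]) auto
  also have "J * (J * (S * (ctranspose U * S))) = S * (ctranspose U * S)"
    by (rule mult_mat_cancel_left[OF JJ]) auto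
  also have "U * (S * (ctranspose U * S)) = U * S * ctranspose U * S" by simp
  also have "\<dots> = 1\<^sub>m n" unfolding S_unitary_right[OF U] by (rule SS)
  finally show ?thesis .
qed

lemma ctranspose_reflection:
  fixes U :: "'a::star_div_algebra mat"
  assumes U: "U \<in> carrier_mat n n"
  shows "ctranspose (reflection U) = S * reflection U * S"
proof -
  note [simp] = U mult_carrier_mat[of _ n n _ n] assoc_mult_mat[of _ n n _ n _ n]
  have "S * reflection U * S = S * (U * (J * (S * (ctranspose U * (S * S)))))"
    by (simp add: reflection_def)
  also have "\<dots> = S * (U * (J * (S * ctranspose U)))"
    by (simp add: SS right_mult_one_mat[of _ n n])
  also have "J * (S * ctranspose U) = S * (J * ctranspose U)"
    using mult_mat_extend[OF SJ, where n = n and X = "ctranspose U"] by simp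
  also have "S * (U * (S * (J * ctranspose U))) = ctranspose (reflection U)"
    by (simp add: reflection_def ctranspose_mult[of _ n n _ n])
  finally show ?thesis by simp
qed

end

section \<open>Involutions with block diagonal form\<close>

context signed_pairing
begin

lemma s_sq: "i < n \<Longrightarrow> s i * s i = 1" and e_sq: "i < n \<Longrightarrow> e i * e i = 1"
  using s_cases[of i] e_cases[of i] by auto

lemma mult_hmat_index:
  fixes A :: "'a::real_algebra_1 mat"
  assumes "A \<in> carrier_mat n n" "i < n" "j < n" and \<phi>: "compat \<phi>"
  shows "(A * hmat n \<tau> \<phi>) $$ (i, j) =
    A $$ (i, j) * of_real (cosh (\<phi> j)) + A $$ (i, \<tau> j) * of_real (sinh (\<phi> j))"
proof -
  have "(A * hmat n \<tau> \<phi>) $$ (i, j) =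
    (\<Sum>k<n. (if k = j then A $$ (i, j) * of_real (cosh (\<phi> j)) else 0) +
      (if k = \<tau> j then A $$ (i, \<tau> j) * of_real (sinh (\<phi> j)) else 0))"
    unfolding index_mult_mat_sum[OF assms(1) hmat_carrier assms(2,3)]
  proof (rule sum.cong[OF refl])
    fix k assume k: "k \<in> {..<n}"
    have "j = \<tau> k \<longleftrightarrow> k = \<tau> j" using \<tau>_\<tau> k assms(3) by auto
    moreover have "\<phi> (\<tau> j) = \<phi> j" using \<phi> assms(3) by (simp add: compat_def)
    ultimately show "A $$ (i, k) * hmat n \<tau> \<phi> $$ (k, j) =
      (if k = j then A $$ (i, j) * of_real (cosh (\<phi> j)) else 0) +
      (if k = \<tau> j then A $$ (i, \<tau> j) * of_real (sinh (\<phi> j)) else 0)"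
      using k assms(3) by (auto simp: hmat_index distrib_left)
  qed
  then show ?thesis using assms \<tau>_less[OF assms(3)] by (simp add: sum.distrib)
qed

lemma reflection_conjugate:
  fixes U :: "'a::star_div_algebra mat"
  assumes U: "U \<in> carrier_mat n n" and ij: "i < n" "j < n"
  shows "conjugate (reflection U $$ (j, i)) = of_real (s i * s j) * reflection U $$ (i, j)"
proof -
  note Mc = reflection_carrier[OF U]
  have "conjugate (reflection U $$ (j, i)) = (S * reflection U * S) $$ (i, j)"
    using ctranspose_reflection[OF U] ctranspose_index[of i "reflection U" j] Mc ij by simp
  also have "\<dots> = of_real (s i) * reflection U $$ (i, j) * of_real (s j)"
    unfolding mult_rdiag_index[OF mult_carrier_mat[OF rdiag_carrier Mc] ij] rdiag_mult_index[OF Mc ij] ..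
  finally show ?thesis
    by (simp add: mult.assoc of_real_commute[of "reflection U $$ (i, j)"])
qed

text \<open>The condition concerns the two diagonal blocks, on which \<open>s\<close> is constant:
  each of them is a diagonal matrix. Entries between indices of different sign are
  arbitrary.\<close>

definition block_diagonal :: "'a::zero mat \<Rightarrow> bool" where
  "block_diagonal A \<longleftrightarrow> (\<forall>i<n. \<forall>j<n. i \<noteq> j \<longrightarrow> s i = s j \<longrightarrow> A $$ (i, j) = 0)"

section \<open>Entries of a reflection whose two diagonal blocks are diagonal\<close>

context
  fixes U M :: "'a::star_div_algebra mat" and d :: "nat \<Rightarrow> real"
  assumes U: "S_unitary U"
    and M: "M = reflection U"
    and block_diagonal: "block_diagonal M"
    and d: "d = (\<lambda>i. re (M $$ (i, i)))"
begin

lemma block_diag: "i < n \<Longrightarrow> j < n \<Longrightarrow> i \<noteq> j \<Longrightarrow> s i = s j \<Longrightarrow> M $$ (i, j) = 0"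
  using block_diagonal by (simp add: block_diagonal_def)

lemma M_carrier: "M \<in> carrier_mat n n"
  unfolding M by (rule reflection_carrier[OF S_unitary_carrier[OF U]])

lemma M_conjugate:
  "i < n \<Longrightarrow> j < n \<Longrightarrow> conjugate (M $$ (j, i)) = of_real (s i * s j) * M $$ (i, j)"
  unfolding M by (rule reflection_conjugate[OF S_unitary_carrier[OF U]])

lemma M_diag: "i < n \<Longrightarrow> M $$ (i, i) = of_real (d i)"
  using M_conjugate[of i i] unfolding d by (intro self_conjugate_of_real) (simp add: s_sq)

lemma M_opposite: "i < n \<Longrightarrow> j < n \<Longrightarrow> s i \<noteq> s j \<Longrightarrow> M $$ (j, i) = - conjugate (M $$ (i, j))"
  using M_conjugate[of j i] s_cases[of i] s_cases[of j] by auto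

lemma M_square:
  assumes "i < n" "j < n"
  shows "(\<Sum>k<n. M $$ (i, k) * M $$ (k, j)) = (if i = j then 1 else 0)"
  using reflection_square[OF U, folded M] index_mult_mat_sum[OF M_carrier M_carrier assms] assms
  by simp

text \<open>In the sum for this entry of \<open>M * M\<close> only the terms \<open>k = i\<close>
  and \<open>k = j\<close> survive, and the entry is 0 since \<open>i\<close> and \<open>j\<close>
  lie in different blocks. Hence \<open>d i + d j\<close> annihilates
  \<open>M $$ (i, j)\<close>.\<close>

lemma M_opposite_eigenvalues:
  assumes ij: "i < n" "j < n" "s i \<noteq> s j" and nz: "M $$ (i, j) \<noteq> 0"
  shows "d j = - d i"
proof -
  have "(\<Sum>k<n. M $$ (i, k) * M $$ (k, j)) =
    (\<Sum>k<n. (if k = i then M $$ (i, i) * M $$ (i, j) else 0) + (if k = j then M $$ (i, j) * M $$ (j, j) else 0))"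
  proof (rule sum.cong[OF refl])
    fix k assume k: "k \<in> {..<n}"
    show "M $$ (i, k) * M $$ (k, j) =
      (if k = i then M $$ (i, i) * M $$ (i, j) else 0) + (if k = j then M $$ (i, j) * M $$ (j, j) else 0)"
    proof (cases "s k = s i")
      case True
      then show ?thesis using ij k block_diag[of i k] by auto
    next
      case False
      then have "s k = s j" using ij k s_cases[of i] s_cases[of j] s_cases[of k] by auto
      then show ?thesis using ij k block_diag[of k j] by auto
    qed
  qed
  also have "\<dots> = M $$ (i, i) * M $$ (i, j) + M $$ (i, j) * M $$ (j, j)"
    using ij by (simp add: sum.distrib)
  also have "\<dots> = of_real (d i + d j) * M $$ (i, j)"
    using ij by (simp add: M_diag of_real_commute[of "M $$ (i, j)"] distrib_right)
  finally have "of_real (d i + d j) * M $$ (i, j) = (if i = j then 1 else 0)"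
    unfolding M_square[OF ij(1,2)] by (rule sym)
  moreover have "i \<noteq> j" using ij by auto
  ultimately have "of_real (d i + d j) * M $$ (i, j) = 0" by (simp only: if_False)
  then have "d i + d j = 0" using nz by (metis mult_eq_0_iff of_real_eq_0_iff)
  then show ?thesis by simp
qed

text \<open>This is \<open>M * M = 1\<close> inside one block, with \<open>M_opposite\<close>
  turning columns into conjugated rows: the rows of the off-diagonal block are orthogonal and have
  squared length \<open>(d i)\<^sup>2 - 1\<close>. They later supply the new basis vectors.\<close>

lemma M_opposite_rows:
  assumes ij: "i < n" "j < n" "s i = s j"
  shows "(\<Sum>k\<in>{k\<in>{..<n}. s k \<noteq> s i}. M $$ (i, k) * conjugate (M $$ (j, k))) =
    (if i = j then of_real ((d i)\<^sup>2 - 1) else 0)"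
proof -
  let ?T = "{k\<in>{..<n}. s k \<noteq> s i}" and ?T' = "{k\<in>{..<n}. s k = s i}"
  have "(\<Sum>k<n. M $$ (i, k) * M $$ (k, j)) =
    (\<Sum>k\<in>?T. M $$ (i, k) * M $$ (k, j)) + (\<Sum>k\<in>?T'. M $$ (i, k) * M $$ (k, j))"
  proof -
    have "{..<n} = ?T \<union> ?T'" by auto
    moreover have "sum g (?T \<union> ?T') = sum g ?T + sum g ?T'" for g :: "nat \<Rightarrow> 'a"
      by (rule sum.union_disjoint) auto
    ultimately show ?thesis by metis
  qed
  also have "(\<Sum>k\<in>?T'. M $$ (i, k) * M $$ (k, j)) = (\<Sum>k\<in>?T'. if k = i then M $$ (i, i) * M $$ (i, j) else 0)"
    using ij block_diag[of i] by (intro sum.cong) auto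
  also have "\<dots> = M $$ (i, i) * M $$ (i, j)" using ij by simp
  also have "\<dots> = (if i = j then of_real ((d i)\<^sup>2) else 0)"
    using ij block_diag[of i j] by (auto simp: M_diag power2_eq_square)
  also have "(\<Sum>k\<in>?T. M $$ (i, k) * M $$ (k, j)) = - (\<Sum>k\<in>?T. M $$ (i, k) * conjugate (M $$ (j, k)))"
    unfolding sum_negf[symmetric]
  proof (rule sum.cong[OF refl])
    fix k assume "k \<in> ?T"
    then have "M $$ (k, j) = - conjugate (M $$ (j, k))" using ij by (intro M_opposite) auto
    then show "M $$ (i, k) * M $$ (k, j) = - (M $$ (i, k) * conjugate (M $$ (j, k)))" by simp
  qed
  finally have "(if i = j then 1 else 0) =
      - (\<Sum>k\<in>?T. M $$ (i, k) * conjugate (M $$ (j, k))) + (if i = j then of_real ((d i)\<^sup>2) else 0)"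
    using M_square[OF ij(1,2)] by simp
  then show ?thesis by (simp add: algebra_simps split: if_splits)
qed

lemma M_opposite_nsq:
  assumes "i < n"
  shows "(\<Sum>k\<in>{k\<in>{..<n}. s k \<noteq> s i}. nsq (M $$ (i, k))) = (d i)\<^sup>2 - 1"
proof -
  have "of_real (\<Sum>k\<in>{k\<in>{..<n}. s k \<noteq> s i}. nsq (M $$ (i, k))) = (of_real ((d i)\<^sup>2 - 1) :: 'a)"
    using M_opposite_rows[OF assms assms refl] by (simp add: times_conjugate_nsq)
  then show ?thesis by (simp only: of_real_eq_iff)
qed

lemma abs_d_ge_1: "i < n \<Longrightarrow> 1 \<le> \<bar>d i\<bar>"
  using M_opposite_nsq[of i] sum_nonneg[of "{k\<in>{..<n}. s k \<noteq> s i}" "\<lambda>k. nsq (M $$ (i, k))"]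
  by (simp add: abs_le_square_iff[of 1, simplified])

lemma M_opposite_zero:
  assumes "i < n" "j < n" "s i \<noteq> s j" "\<bar>d i\<bar> = 1"
  shows "M $$ (i, j) = 0" "M $$ (j, i) = 0"
proof -
  have "(d i)\<^sup>2 = 1" using assms(4) by (metis power2_abs power_one)
  then have "(\<Sum>k\<in>{k\<in>{..<n}. s k \<noteq> s i}. nsq (M $$ (i, k))) = 0"
    using M_opposite_nsq[OF assms(1)] by simp
  then have "\<forall>k\<in>{k\<in>{..<n}. s k \<noteq> s i}. nsq (M $$ (i, k)) = 0"
    by (subst (asm) sum_nonneg_eq_0_iff) auto
  then show "M $$ (i, j) = 0" using assms(2,3) by auto
  then show "M $$ (j, i) = 0" using M_opposite[OF assms(1-3)] by simp
qed

text \<open>Double counting of \<open>nsq (M $$ (i, j))\<close> over \<open>?I\<close> and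
  \<open>?J\<close>. By \<open>M_opposite_eigenvalues\<close> the off-diagonal weight of each row in
  \<open>?I\<close> lies in \<open>?J\<close> and conversely; each such weight is
  \<open>v\<^sup>2 - 1\<close>, which is nonzero and cancels.\<close>

lemma opposite_multiplicities:
  assumes "\<bar>v\<bar> > 1"
  shows "card {i\<in>{..<n}. s i = 1 \<and> d i = v} = card {j\<in>{..<n}. s j = -1 \<and> d j = - v}"
proof -
  let ?I = "{i\<in>{..<n}. s i = 1 \<and> d i = v}" and ?J = "{j\<in>{..<n}. s j = -1 \<and> d j = - v}"
  have eqs: "d j = - d i" if "M $$ (i, j) \<noteq> 0" "i < n" "j < n" "s i \<noteq> s j" for i j
    using M_opposite_eigenvalues that by blast
  have "real (card ?I) * (v\<^sup>2 - 1) = (\<Sum>i\<in>?I. \<Sum>k\<in>{k\<in>{..<n}. s k \<noteq> s i}. nsq (M $$ (i, k)))"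
  proof -
    have "(\<Sum>i\<in>?I. \<Sum>k\<in>{k\<in>{..<n}. s k \<noteq> s i}. nsq (M $$ (i, k))) = (\<Sum>i\<in>?I. v\<^sup>2 - 1)"
      by (rule sum.cong[OF refl], subst M_opposite_nsq) auto
    then show ?thesis by simp
  qed
  also have "\<dots> = (\<Sum>i\<in>?I. \<Sum>j\<in>?J. nsq (M $$ (i, j)))"
  proof (rule sum.cong[OF refl], rule sum.mono_neutral_right)
    fix i assume i: "i \<in> ?I"
    show "\<forall>k\<in>{k\<in>{..<n}. s k \<noteq> s i} - ?J. nsq (M $$ (i, k)) = 0"
      using i eqs[of i] s_cases by fastforce
  qed auto
  also have "\<dots> = (\<Sum>j\<in>?J. \<Sum>i\<in>?I. nsq (M $$ (i, j)))" by (rule sum.swap)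
  also have "\<dots> = (\<Sum>j\<in>?J. \<Sum>i\<in>?I. nsq (M $$ (j, i)))"
  proof (intro sum.cong refl)
    fix i j assume "j \<in> ?J" "i \<in> ?I"
    then have "M $$ (i, j) = - conjugate (M $$ (j, i))" by (intro M_opposite) auto
    then show "nsq (M $$ (i, j)) = nsq (M $$ (j, i))" by simp
  qed
  also have "\<dots> = (\<Sum>j\<in>?J. \<Sum>k\<in>{k\<in>{..<n}. s k \<noteq> s j}. nsq (M $$ (j, k)))"
  proof (rule sum.cong[OF refl], rule sum.mono_neutral_left)
    fix j assume j: "j \<in> ?J"
    show "\<forall>k\<in>{k\<in>{..<n}. s k \<noteq> s j} - ?I. nsq (M $$ (j, k)) = 0"
      using j eqs[of j] s_cases by fastforce
  qed auto
  also have "\<dots> = (\<Sum>j\<in>?J. v\<^sup>2 - 1)"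
    by (rule sum.cong[OF refl], subst M_opposite_nsq) auto
  also have "\<dots> = real (card ?J) * (v\<^sup>2 - 1)" by simp
  finally have "real (card ?I) * (v\<^sup>2 - 1) = real (card ?J) * (v\<^sup>2 - 1)" .
  moreover have "v\<^sup>2 \<noteq> 1" using assms by (auto simp: power2_eq_1_iff)
  ultimately show ?thesis by simp
qed

text \<open>
  On vectors supported in the index set on the left, the Hermitian form of
  \<open>reflection U * S + S\<close> (up to signs) is positive definite, while the form factors through
  \<open>ctranspose U\<close> with as many positive directions as the right hand side counts.
\<close>

lemma sign_count_le:
  assumes \<sigma>: "\<sigma> = 1 \<or> \<sigma> = -1" and \<epsilon>: "\<epsilon> = 1 \<or> \<epsilon> = -1"
  shows "card {i\<in>{..<n}. s i = \<sigma> \<and> \<epsilon> * d i > 0} \<le> card {l\<in>{..<n}. s l = \<sigma> \<and> e l = \<epsilon>}"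
proof (rule ccontr)
  let ?I = "{i\<in>{..<n}. s i = \<sigma> \<and> \<epsilon> * d i > 0}" and ?E = "{l\<in>{..<n}. s l = \<sigma> \<and> e l = \<epsilon>}"
  note Uc = S_unitary_carrier[OF U]
  assume "\<not> ?thesis"
  \<comment> \<open>With fewer equations than unknowns, some nonzero \<open>v\<close> supported on
    \<open>?I\<close> has an image under \<open>ctranspose U\<close> that vanishes on
    \<open>?E\<close>.\<close>
  then obtain v where v: "\<exists>i\<in>?I. v i \<noteq> 0" "\<forall>l\<in>?E. (\<Sum>i\<in>?I. conjugate (U $$ (i, l)) * v i) = 0"
    using underdetermined_system_nontrivial[of ?E ?I "\<lambda>l i. conjugate (U $$ (i, l))"] by auto
  define w where "w l = (\<Sum>i\<in>?I. conjugate (U $$ (i, l)) * v i)" for l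
  \<comment> \<open>The diagonal of \<open>\<epsilon> * J * S + S\<close>, up to the sign
    \<open>\<sigma>\<close>. It equals 2 on \<open>?E\<close> and is at most 0 elsewhere; without
    the summand 1, the indices with both signs reversed would contribute positively.\<close>
  define f where "f l = (\<epsilon> * e l + 1) * (s l * \<sigma>)" for l
  have form: "(\<Sum>l<n. U $$ (i, l) * of_real (g l) * conjugate (U $$ (j, l))) = (U * rdiag n g * ctranspose U) $$ (i, j)"
    if "i < n" "j < n" for g i j
    unfolding index_mult_mat_sum[OF mult_carrier_mat[OF Uc rdiag_carrier] ctranspose_carrier[OF Uc] that]
    using Uc that by (intro sum.cong refl) (simp add: mult_rdiag_index[OF Uc] del: index_mult_mat(1))
  have UJSU: "U * rdiag n (\<lambda>l. e l * s l) * ctranspose U = M * S"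
  proof -
    have "M * S = U * (J * (S * (ctranspose U * (S * S))))"
      using Uc by (simp add: M reflection_def assoc_mult_mat[of _ n n _ n _ n] mult_carrier_mat[of _ n n _ n])
    also have "\<dots> = U * (J * S) * ctranspose U"
      using Uc by (simp add: SS assoc_mult_mat[of _ n n _ n _ n] mult_carrier_mat[of _ n n _ n] right_mult_one_mat[of _ n n])
    finally show ?thesis by (simp add: rdiag_mult_rdiag)
  qed
  have N: "(\<Sum>l<n. U $$ (i, l) * of_real (f l) * conjugate (U $$ (j, l))) =
      (if i = j then of_real (\<epsilon> * d i + 1) else 0)" if ij: "i \<in> ?I" "j \<in> ?I" for i j
  proof -
    have lt: "i < n" "j < n" using ij by auto
    have "U $$ (i, l) * of_real (f l) * conjugate (U $$ (j, l)) =
      of_real (\<epsilon> * \<sigma>) * (U $$ (i, l) * of_real (e l * s l) * conjugate (U $$ (j, l))) +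
      of_real \<sigma> * (U $$ (i, l) * of_real (s l) * conjugate (U $$ (j, l)))" for l
      by (simp add: f_def of_real_def algebra_simps)
    then have "(\<Sum>l<n. U $$ (i, l) * of_real (f l) * conjugate (U $$ (j, l))) =
      of_real (\<epsilon> * \<sigma>) * (\<Sum>l<n. U $$ (i, l) * of_real (e l * s l) * conjugate (U $$ (j, l))) +
      of_real \<sigma> * (\<Sum>l<n. U $$ (i, l) * of_real (s l) * conjugate (U $$ (j, l)))"
      by (simp only: sum.distrib sum_distrib_left)
    also have "\<dots> = of_real (\<epsilon> * \<sigma>) * (M * S) $$ (i, j) + of_real \<sigma> * S $$ (i, j)"
      unfolding form[OF lt] UJSU S_unitary_right[OF U] ..
    also have "\<dots> = of_real (\<epsilon> * \<sigma>) * (M $$ (i, j) * of_real (s j)) + of_real \<sigma> * S $$ (i, j)"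
      unfolding mult_rdiag_index[OF M_carrier lt] ..
    also have "\<dots> = (if i = j then of_real (\<epsilon> * d i + 1) else 0)"
    proof (cases "i = j")
      case True
      have "of_real (\<epsilon> * \<sigma>) * (M $$ (i, i) * of_real (s i)) + of_real \<sigma> * S $$ (i, i)
        = (of_real (\<epsilon> * \<sigma> * (d i * \<sigma>) + \<sigma> * \<sigma>) :: 'a)"
        using ij lt by (simp add: M_diag rdiag_index)
      moreover have "\<epsilon> * \<sigma> * (d i * \<sigma>) + \<sigma> * \<sigma> = \<epsilon> * d i + 1" using \<sigma> by auto
      ultimately have "of_real (\<epsilon> * \<sigma>) * (M $$ (i, i) * of_real (s i)) + of_real \<sigma> * S $$ (i, i)
        = (of_real (\<epsilon> * d i + 1) :: 'a)" by (simp only:)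
      then show ?thesis unfolding True[symmetric] if_P[OF refl] .
    next
      case False
      then have "M $$ (i, j) = 0" using ij by (intro block_diag) auto
      then show ?thesis using False lt by (simp add: rdiag_index)
    qed
    finally show ?thesis .
  qed
  have "of_real (\<Sum>l<n. f l * nsq (w l)) = (\<Sum>l<n. conjugate (w l) * of_real (f l) * w l)"
    unfolding of_real_sum
    by (intro sum.cong refl) (simp only: of_real_commute[of "conjugate _"] mult.assoc conjugate_times_nsq of_real_mult)
  also have "\<dots> = (\<Sum>l<n. \<Sum>i\<in>?I. \<Sum>j\<in>?I. conjugate (v i) * (U $$ (i, l) * of_real (f l) * conjugate (U $$ (j, l))) * v j)"
    by (simp add: w_def conjugate_sum conjugate_times sum_distrib_left sum_distrib_right mult.assoc)
      (rule sum.cong[OF refl], rule sum.swap)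
  also have "\<dots> = (\<Sum>i\<in>?I. \<Sum>j\<in>?I. \<Sum>l<n. conjugate (v i) * (U $$ (i, l) * of_real (f l) * conjugate (U $$ (j, l))) * v j)"
    by (subst sum.swap, rule sum.cong[OF refl], subst sum.swap, rule refl)
  also have "\<dots> = (\<Sum>i\<in>?I. \<Sum>j\<in>?I. conjugate (v i) * (\<Sum>l<n. U $$ (i, l) * of_real (f l) * conjugate (U $$ (j, l))) * v j)"
    by (simp only: sum_distrib_left sum_distrib_right)
  also have "\<dots> = (\<Sum>i\<in>?I. \<Sum>j\<in>?I. conjugate (v i) * (if i = j then of_real (\<epsilon> * d i + 1) else 0) * v j)"
    by (intro sum.cong refl) (simp only: N)
  also have "\<dots> = (\<Sum>i\<in>?I. \<Sum>j\<in>?I. if i = j then conjugate (v i) * of_real (\<epsilon> * d i + 1) * v i else 0)"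
    by (intro sum.cong refl) simp
  also have "\<dots> = (\<Sum>i\<in>?I. conjugate (v i) * of_real (\<epsilon> * d i + 1) * v i)"
    by (intro sum.cong refl) (simp add: sum.delta)
  also have "\<dots> = of_real (\<Sum>i\<in>?I. (\<epsilon> * d i + 1) * nsq (v i))"
    unfolding of_real_sum
    by (intro sum.cong refl) (simp only: of_real_commute[of "conjugate _"] mult.assoc conjugate_times_nsq of_real_mult)
  finally have eq: "(\<Sum>l<n. f l * nsq (w l)) = (\<Sum>i\<in>?I. (\<epsilon> * d i + 1) * nsq (v i))"
    by (simp only: of_real_eq_iff)
  have "(\<Sum>l<n. f l * nsq (w l)) \<le> 0"
  proof (rule sum_nonpos)
    fix l assume l: "l \<in> {..<n}"
    show "f l * nsq (w l) \<le> 0"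
    proof (cases "l \<in> ?E")
      case True
      then have "w l = 0" using v(2) by (simp add: w_def)
      then show ?thesis by simp
    next
      case False
      then have "f l \<le> 0" using l s_cases[of l] e_cases[of l] \<sigma> \<epsilon> by (auto simp: f_def)
      then show ?thesis by (simp add: mult_nonpos_nonneg)
    qed
  qed
  moreover have "(\<Sum>i\<in>?I. (\<epsilon> * d i + 1) * nsq (v i)) > 0"
  proof -
    obtain k where k: "k \<in> ?I" "v k \<noteq> 0" using v(1) by blast
    show ?thesis
    proof (rule sum_pos2[of _ k])
      show "0 < (\<epsilon> * d k + 1) * nsq (v k)" using k by (intro mult_pos_pos) auto
      show "0 \<le> (\<epsilon> * d i + 1) * nsq (v i)" if "i \<in> ?I" for i
        using that by (intro mult_nonneg_nonneg) auto
    qed (use k in auto)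
  qed
  ultimately show False using eq by simp
qed

text \<open>No \<open>d i\<close> is zero, so both families of sets, for
  \<open>\<epsilon> = 1\<close> and \<open>\<epsilon> = -1\<close>, partition the same block. With
  equal totals the two inequalities of \<open>sign_count_le\<close> are equalities.\<close>

lemma sign_count:
  assumes \<sigma>: "\<sigma> = 1 \<or> \<sigma> = -1" and \<epsilon>: "\<epsilon> = 1 \<or> \<epsilon> = -1"
  shows "card {i\<in>{..<n}. s i = \<sigma> \<and> \<epsilon> * d i > 0} = card {l\<in>{..<n}. s l = \<sigma> \<and> e l = \<epsilon>}"
proof -
  let ?I = "\<lambda>\<epsilon>. {i\<in>{..<n}. s i = \<sigma> \<and> \<epsilon> * d i > 0}" and ?E = "\<lambda>\<epsilon>. {l\<in>{..<n}. s l = \<sigma> \<and> e l = \<epsilon>}"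
  let ?A = "{i\<in>{..<n}. s i = \<sigma>}"
  have "?I 1 \<union> ?I (-1) = ?A" using abs_d_ge_1 by fastforce
  moreover have "card (?I 1 \<union> ?I (-1)) = card (?I 1) + card (?I (-1))"
    by (rule card_Un_disjoint) auto
  moreover have "?E 1 \<union> ?E (-1) = ?A" using e_cases by auto
  moreover have "card (?E 1 \<union> ?E (-1)) = card (?E 1) + card (?E (-1))"
    by (rule card_Un_disjoint) auto
  ultimately have "card (?I 1) + card (?I (-1)) = card (?E 1) + card (?E (-1))" by metis
  then show ?thesis
    using sign_count_le[OF \<sigma>, of 1] sign_count_le[OF \<sigma>, of "-1"] \<epsilon> by auto
qed

end

end

section \<open>Normal form under the compact group\<close>

lemma ex_bij_betw_nth:
  assumes "finite A" and "image_mset f (mset_set A) = mset xs"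
  obtains a where "bij_betw a {..<length xs} A" and "\<And>i. i < length xs \<Longrightarrow> f (a i) = xs ! i"
proof -
  obtain zs where zs: "set zs = A" "distinct zs" using finite_distinct_list[OF assms(1)] by blast
  then have "mset (map f zs) = mset xs" using assms(2) by (simp add: mset_set_set[symmetric])
  then obtain \<pi> where \<pi>: "\<pi> permutes {..<length (map f zs)}" "permute_list \<pi> (map f zs) = xs"
    using mset_eq_permutation[of xs "map f zs"] by metis
  define ws where "ws = permute_list \<pi> zs"
  have "\<pi> permutes {..<length zs}" using \<pi>(1) by simp
  then have "set ws = A" "distinct ws" "map f ws = xs"
    using zs \<pi>(2) by (simp_all add: ws_def permute_list_map)
  then show thesis
    using bij_betw_nth[of ws "{..<length xs}" A] by (intro that[of "nth ws"]) auto
qed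

text \<open>The leading values are matched with the trailing ones, as in \<open>hyp_mat\<close>.\<close>

lemma pair_equal_multiplicities:
  fixes f :: "'a \<Rightarrow> real" and g :: "'b \<Rightarrow> real"
  assumes fin: "finite A" "finite B"
    and ge: "\<And>x. x \<in> A \<Longrightarrow> f x \<ge> 1" "\<And>y. y \<in> B \<Longrightarrow> g y \<ge> 1"
    and mult: "\<And>v. v > 1 \<Longrightarrow> card {x \<in> A. f x = v} = card {y \<in> B. g y = v}"
    and m: "m = min (card A) (card B)"
  obtains a b where "bij_betw a {..<card A} A" and "bij_betw b {..<card B} B"
    and "\<And>i. i < m \<Longrightarrow> f (a i) = g (b (card B - m + i))"
    and "\<And>i. m \<le> i \<Longrightarrow> i < card A \<Longrightarrow> f (a i) = 1"
    and "\<And>i. i < card B - m \<Longrightarrow> g (b i) = 1"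
proof -
  define F where "F = image_mset f (mset_set A)"
  define G where "G = image_mset g (mset_set B)"
  have FG: "set_mset F \<subseteq> {1..}" "set_mset G \<subseteq> {1..}" "size F = card A" "size G = card B"
    using ge fin by (auto simp: F_def G_def)
  have count: "count F v = card {x \<in> A. f x = v}" "count G v = card {y \<in> B. g y = v}" for v
    using fin by (simp_all add: F_def G_def count_image_mset' eq_commute)
  have "filter_mset (\<lambda>v. v > 1) F = filter_mset (\<lambda>v. v > 1) G"
    by (rule multiset_eqI) (simp add: count mult)
  \<comment> \<open>The common values above 1, with multiplicity. All remaining values of
    \<open>F\<close> and \<open>G\<close> are 1.\<close>
  then obtain L where L: "mset L = filter_mset (\<lambda>v. v > 1) F" "mset L = filter_mset (\<lambda>v. v > 1) G"
    using ex_mset by metis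
  have split: "X = mset L + replicate_mset (size X - length L) 1" "length L \<le> size X"
    if "set_mset X \<subseteq> {1..}" "mset L = filter_mset (\<lambda>v. v > 1) X" for X
  proof -
    let ?Y = "filter_mset (\<lambda>v. \<not> v > 1) X"
    have X: "X = mset L + ?Y" unfolding that(2) by (rule multiset_partition)
    have "set_mset ?Y \<subseteq> {1}" using that(1) by force
    then have Y: "?Y = replicate_mset (size ?Y) 1" by (rule set_mset_subset_singletonD)
    have sz: "size X = length L + size ?Y" by (subst X) simp
    then show "length L \<le> size X" by simp
    have "size ?Y = size X - length L" using sz by simp
    then show "X = mset L + replicate_mset (size X - length L) 1" using X Y by metis
  qed
  note sF = split[OF FG(1) L(1), unfolded FG(3)] and sG = split[OF FG(2) L(2), unfolded FG(4)]
  \<comment> \<open>Padding by ones up to length \<open>m\<close>, since a matched position may also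
    carry the value 1, that is, angle zero.\<close>
  define Lm where "Lm = L @ replicate (m - length L) 1"
  have len: "length L \<le> m" "length Lm = m" using sF sG by (auto simp: m Lm_def)
  define xs where "xs = Lm @ replicate (card A - m) 1"
  define ys where "ys = replicate (card B - m) 1 @ Lm"
  have rep: "replicate_mset a x + replicate_mset b x = replicate_mset (a + b) x" for a b and x :: real
    by (rule multiset_eqI) simp
  have "mset xs = F" "mset ys = G"
    using sF sG len m unfolding xs_def ys_def Lm_def
    by (simp_all add: rep add.assoc add.left_commute[of _ "mset L"])
  then have mx: "image_mset f (mset_set A) = mset xs" "image_mset g (mset_set B) = mset ys"
    by (simp_all add: F_def G_def)
  have lx: "length xs = card A" "length ys = card B" using len m by (auto simp: xs_def ys_def)
  obtain a where a: "bij_betw a {..<card A} A" "\<And>i. i < card A \<Longrightarrow> f (a i) = xs ! i"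
    using ex_bij_betw_nth[OF fin(1) mx(1)] unfolding lx by blast
  obtain b where b: "bij_betw b {..<card B} B" "\<And>i. i < card B \<Longrightarrow> g (b i) = ys ! i"
    using ex_bij_betw_nth[OF fin(2) mx(2)] unfolding lx by blast
  show thesis
  proof (rule that[OF a(1) b(1)])
    fix i
    show "f (a i) = g (b (card B - m + i))" if "i < m"
    proof -
      have "i < card A" "card B - m + i < card B" using that m by auto
      then show ?thesis using that len(2) by (simp add: a(2) b(2) xs_def ys_def nth_append)
    qed
    show "m \<le> i \<Longrightarrow> i < card A \<Longrightarrow> f (a i) = 1"
      using m len by (simp add: a xs_def nth_append)
    show "i < card B - m \<Longrightarrow> g (b i) = 1"
      using m len by (simp add: b ys_def nth_append)
  qed
qed

lemma permutation_matrix_conj: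
  fixes A :: "'a::semiring_1 mat"
  assumes \<rho>_less: "\<And>i. i < n \<Longrightarrow> \<rho> i < n" and "A \<in> carrier_mat n n" "i < n" "j < n"
  shows "(transpose_mat (mat n n (\<lambda>(i, j). if i = \<rho> j then 1 else 0)) * A
      * mat n n (\<lambda>(i, j). if i = \<rho> j then 1 else 0)) $$ (i, j) = A $$ (\<rho> i, \<rho> j)"
proof -
  let ?P = "mat n n (\<lambda>(i, j). if i = \<rho> j then 1 else 0) :: 'a mat"
  have P: "?P \<in> carrier_mat n n" by simp
  have "(transpose_mat ?P * A * ?P) $$ (i, j) = (\<Sum>l<n. (transpose_mat ?P * A) $$ (i, l) * ?P $$ (l, j))"
    using assms by (intro index_mult_mat_sum[of _ n n _ n]) (auto simp: mult_carrier_mat[of _ n n])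
  also have "\<dots> = (\<Sum>l<n. if l = \<rho> j then (transpose_mat ?P * A) $$ (i, l) else 0)"
    using assms by (intro sum.cong) (auto simp del: index_mult_mat(1))
  also have "\<dots> = (transpose_mat ?P * A) $$ (i, \<rho> j)" using assms by simp
  also have "\<dots> = (\<Sum>l<n. transpose_mat ?P $$ (i, l) * A $$ (l, \<rho> j))"
    using assms by (intro index_mult_mat_sum[of _ n n _ n]) (auto simp: mult_carrier_mat[of _ n n])
  also have "\<dots> = (\<Sum>l<n. if l = \<rho> i then A $$ (l, \<rho> j) else 0)"
    using assms by (intro sum.cong) auto
  also have "\<dots> = A $$ (\<rho> i, \<rho> j)" using assms by simp
  finally show ?thesis .
qed

context signed_pairing
begin

lemma permutation_matrix_K_group:
  assumes \<alpha>: "bij_betw \<alpha> {..<n} {..<n}" and s\<alpha>: "\<And>i. i < n \<Longrightarrow> s (\<alpha> i) = s i"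
  defines "k \<equiv> mat n n (\<lambda>(i, j). if i = \<alpha> j then 1 else 0) :: 'a::star_div_algebra mat"
  shows "k \<in> K_group"
    and "A \<in> carrier_mat n n \<Longrightarrow> i < n \<Longrightarrow> j < n \<Longrightarrow> (ctranspose k * A * k) $$ (i, j) = A $$ (\<alpha> i, \<alpha> j)"
proof -
  have k: "k \<in> carrier_mat n n" by (simp add: k_def)
  have \<alpha>_less: "\<alpha> i < n" if "i < n" for i using \<alpha> that by (auto simp: bij_betw_def)
  have inj: "\<alpha> i = \<alpha> j \<longleftrightarrow> i = j" if "i < n" "j < n" for i j
    using \<alpha> that by (auto simp: bij_betw_def inj_on_def)
  have kt: "ctranspose k = transpose_mat k" by (rule eq_matI) (auto simp: k_def)
  have conj: "(ctranspose k * A * k) $$ (i, j) = A $$ (\<alpha> i, \<alpha> j)"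
    if "A \<in> carrier_mat n n" "i < n" "j < n" for A i j
    unfolding kt unfolding k_def by (rule permutation_matrix_conj[OF _ that]) (rule \<alpha>_less)
  then show "A \<in> carrier_mat n n \<Longrightarrow> i < n \<Longrightarrow> j < n \<Longrightarrow> (ctranspose k * A * k) $$ (i, j) = A $$ (\<alpha> i, \<alpha> j)" .
  have "ctranspose k * k = 1\<^sub>m n"
  proof (rule eq_matI)
    fix i j assume "i < dim_row (1\<^sub>m n :: 'a mat)" "j < dim_col (1\<^sub>m n :: 'a mat)"
    then have ij: "i < n" "j < n" by auto
    have "(ctranspose k * k) $$ (i, j) = (ctranspose k * 1\<^sub>m n * k) $$ (i, j)"
      using k by (simp add: right_mult_one_mat[of _ n n])
    also have "\<dots> = 1\<^sub>m n $$ (\<alpha> i, \<alpha> j)" by (rule conj[OF one_carrier_mat ij])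
    also have "\<dots> = 1\<^sub>m n $$ (i, j)" using ij \<alpha>_less inj by auto
    finally show "(ctranspose k * k) $$ (i, j) = 1\<^sub>m n $$ (i, j)" .
  qed (use k in auto)
  moreover have "k * S = S * k"
  proof (rule eq_matI)
    fix i j assume "i < dim_row (S * k)" "j < dim_col (S * k)"
    then have ij: "i < n" "j < n" using k by auto
    show "(k * S) $$ (i, j) = (S * k) $$ (i, j)"
      unfolding rdiag_mult_index[OF k ij] mult_rdiag_index[OF k ij] using ij s\<alpha> by (simp add: k_def)
  qed (use k in auto)
  ultimately show "k \<in> K_group" using k by (simp add: K_group_def unitary_group_def)
qed

text \<open>The change of basis \<open>W\<close> keeps all standard basis vectors except those with
  \<open>s = -1\<close> and nonzero angle. Such a vector is replaced by the part of column
  \<open>\<tau> j\<close> of \<open>M\<close> in the negative block, scaled to length one;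
  \<open>M_opposite_rows\<close> makes the new columns orthonormal.\<close>

lemma hyperbolic_normal_form_diag:
  fixes U M :: "'a::star_div_algebra mat" and d :: "nat \<Rightarrow> real"
  assumes U: "S_unitary U"
    and M: "M = reflection U"
    and block_diagonal: "block_diagonal M"
    and d: "d = (\<lambda>i. re (M $$ (i, i)))"
    and \<phi>: "compat \<phi>" and d_cosh: "\<And>i. i < n \<Longrightarrow> d i = cosh (2 * \<phi> i) * e i"
  obtains k where "k \<in> K_group" "reflection U = k * hmat n \<tau> (\<lambda>i. 2 * \<phi> i) * J * ctranspose k"
proof -
  note hyps = U M block_diagonal d
  note bd = block_diag[OF hyps]
  note Mc = M_carrier[OF hyps]
  note M_diag = M_diag[OF hyps]
  define B where "B = {j. s j \<noteq> 1 \<and> \<phi> j \<noteq> 0}"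
  \<comment> \<open>The off-diagonal part of column \<open>\<tau> j\<close> has length
    \<open>\<bar>sinh (2 * \<phi> j)\<bar>\<close>. The minus sign accounts for
    \<open>e (\<tau> j) = - e j\<close>, so that column \<open>\<tau> j\<close> of the equation
    \<open>M * W = W * (?H * J)\<close> holds by construction.\<close>
  define r where "r j = - inverse (sinh (2 * \<phi> j) * e j)" for j
  define W :: "'a mat" where "W = mat n n (\<lambda>(k, j). if j \<in> B
    then (if s k = 1 then 0 else M $$ (k, \<tau> j) * of_real (r j)) else (if k = j then 1 else 0))"
  have Wc: "W \<in> carrier_mat n n" by (simp add: W_def)
  have W_B: "W $$ (k, j) = (if s k = 1 then 0 else M $$ (k, \<tau> j) * of_real (r j))" if "k < n" "j < n" "j \<in> B" for k j
    using that by (simp add: W_def)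
  have W_nB: "W $$ (k, j) = (if k = j then 1 else 0)" if "k < n" "j < n" "j \<notin> B" for k j
    using that by (simp add: W_def)
  have s_not1: "s i = -1" if "i < n" "s i \<noteq> 1" for i using s_cases[OF that(1)] that(2) by simp
  have \<phi>\<tau>: "\<phi> (\<tau> i) = \<phi> i" if "i < n" for i using \<phi> that by (simp add: compat_def)
  have \<tau>_ne: "\<tau> i \<noteq> i" if "i < n" "\<phi> i \<noteq> 0" for i using \<phi> that by (auto simp: compat_def)
  have s\<tau>: "s (\<tau> i) = - s i" "e (\<tau> i) = - e i" if "i < n" "\<phi> i \<noteq> 0" for i
    using s_\<tau> e_\<tau> \<tau>_ne that by auto
  have d_sinh: "(d i)\<^sup>2 - 1 = (sinh (2 * \<phi> i))\<^sup>2" if "i < n" for i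
  proof -
    have "(d i)\<^sup>2 = (cosh (2 * \<phi> i))\<^sup>2 * (e i * e i)"
      unfolding d_cosh[OF that] by (simp add: power2_eq_square)
    then show ?thesis using e_sq[OF that] cosh_square_eq[of "2 * \<phi> i"] by simp
  qed
  have sinh0: "sinh (2 * \<phi> i) \<noteq> 0" if "\<phi> i \<noteq> 0" for i using that by simp
  have M0: "M $$ (i, j) = 0" "M $$ (j, i) = 0" if "i < n" "j < n" "s i \<noteq> s j" "\<phi> i = 0" for i j
  proof -
    have "\<bar>d i\<bar> = 1" using d_cosh[OF that(1)] e_cases[OF that(1)] that(4) by auto
    then show "M $$ (i, j) = 0" "M $$ (j, i) = 0"
      using M_opposite_zero[OF hyps] that by blast+
  qed
  \<comment> \<open>A row with \<open>s i = -1\<close> and angle 0 has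
    \<open>\<bar>d i\<bar> = 1\<close>, so the off-diagonal part of \<open>M\<close> vanishes in it.
    The new columns are therefore supported on \<open>B\<close>.\<close>
  have W_0: "W $$ (i, j) = 0" if ij: "i < n" "j < n" "i \<notin> B" "j \<in> B" for i j
  proof (cases "s i = 1")
    case False
    then have "\<phi> i = 0" using ij by (simp add: B_def)
    moreover have "s (\<tau> j) = 1" using ij s\<tau>(1)[of j] s_not1[of j] by (simp add: B_def)
    ultimately have "M $$ (i, \<tau> j) = 0" using M0[of i "\<tau> j"] ij \<tau>_less False by simp
    then show ?thesis using ij by (simp add: W_B)
  qed (simp add: W_B ij)
  have WW: "ctranspose W * W = 1\<^sub>m n"
  proof (rule eq_matI)
    fix i j assume "i < dim_row (1\<^sub>m n :: 'a mat)" "j < dim_col (1\<^sub>m n :: 'a mat)"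
    then have ij: "i < n" "j < n" by auto
    have prod: "(ctranspose W * W) $$ (i, j) = (\<Sum>k<n. conjugate (W $$ (k, i)) * W $$ (k, j))"
      unfolding index_mult_mat_sum[OF ctranspose_carrier[OF Wc] Wc ij]
      using Wc ij by (intro sum.cong) auto
    have "(\<Sum>k<n. conjugate (W $$ (k, i)) * W $$ (k, j)) = (if i = j then 1 else 0)"
    proof (cases "i \<in> B \<and> j \<in> B")
      case False
      show ?thesis
      proof (cases "i \<in> B")
        case True
        then have j: "j \<notin> B" using False by simp
        have "(\<Sum>k<n. conjugate (W $$ (k, i)) * W $$ (k, j)) = (\<Sum>k<n. if k = j then conjugate (W $$ (j, i)) else 0)"
          using ij j by (intro sum.cong) (auto simp: W_nB)
        also have "\<dots> = 0" using W_0[OF ij(2,1) j True] by simp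
        finally show ?thesis using True j by auto
      next
        case i: False
        have "(\<Sum>k<n. conjugate (W $$ (k, i)) * W $$ (k, j)) = (\<Sum>k<n. if k = i then W $$ (i, j) else 0)"
          using ij i by (intro sum.cong) (auto simp: W_nB)
        also have "\<dots> = W $$ (i, j)" using ij by simp
        also have "\<dots> = (if i = j then 1 else 0)"
          using W_0[OF ij i] W_nB[OF ij] i by (cases "j \<in> B") auto
        finally show ?thesis .
      qed
    next
      case True
      then have nz: "\<phi> i \<noteq> 0" "\<phi> j \<noteq> 0" "s i \<noteq> 1" "s j \<noteq> 1" by (auto simp: B_def)
      note t = \<tau>_less[OF ij(1)] \<tau>_less[OF ij(2)]
      have "s i = -1" "s j = -1" using s_not1 nz ij by blast+
      then have st: "s (\<tau> i) = 1" "s (\<tau> j) = 1" using s\<tau>(1) nz ij by simp_all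
      let ?T = "{k\<in>{..<n}. s k \<noteq> s (\<tau> i)}"
      have "(\<Sum>k<n. conjugate (W $$ (k, i)) * W $$ (k, j)) = (\<Sum>k\<in>?T. conjugate (W $$ (k, i)) * W $$ (k, j))"
        using True ij st by (intro sum.mono_neutral_right) (auto simp: W_B)
      also have "\<dots> = (\<Sum>k\<in>?T. of_real (r i * r j) * (M $$ (\<tau> i, k) * conjugate (M $$ (\<tau> j, k))))"
      proof (rule sum.cong[OF refl])
        fix k assume k: "k \<in> ?T"
        have "M $$ (k, \<tau> i) = - conjugate (M $$ (\<tau> i, k))" "M $$ (k, \<tau> j) = - conjugate (M $$ (\<tau> j, k))"
          using k t st by (auto intro!: M_opposite[OF hyps])
        then have "conjugate (W $$ (k, i)) * W $$ (k, j) =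
          of_real (r i) * (M $$ (\<tau> i, k) * conjugate (M $$ (\<tau> j, k)) * of_real (r j))"
          using k True ij st by (simp add: W_B conjugate_times mult.assoc)
        then show "conjugate (W $$ (k, i)) * W $$ (k, j) =
          of_real (r i * r j) * (M $$ (\<tau> i, k) * conjugate (M $$ (\<tau> j, k)))"
          unfolding of_real_commute[of "M $$ (\<tau> i, k) * conjugate (M $$ (\<tau> j, k))"]
          by (simp only: of_real_mult mult.assoc)
      qed
      also have "\<dots> = of_real (r i * r j) * (if \<tau> i = \<tau> j then of_real ((d (\<tau> i))\<^sup>2 - 1) else 0)"
        unfolding sum_distrib_left[symmetric] M_opposite_rows[OF hyps t st(1)[folded st(2)]] ..
      also have "\<dots> = (if i = j then 1 else 0)"
      proof (cases "i = j")
        case True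
        have "r i * r i * (sinh (2 * \<phi> i))\<^sup>2 = 1"
          using sinh0[OF nz(1)] e_cases[OF ij(1)] by (auto simp: r_def field_simps power2_eq_square)
        then have "of_real (r i * r i) * of_real ((d (\<tau> i))\<^sup>2 - 1) = (1 :: 'a)"
          unfolding d_sinh[OF t(1)] \<phi>\<tau>[OF ij(1)] of_real_mult[symmetric] by simp
        then show ?thesis using True by simp
      next
        case False
        then have "\<tau> i \<noteq> \<tau> j" using \<tau>_\<tau> ij by metis
        then show ?thesis using False by simp
      qed
      finally show ?thesis .
    qed
    then show "(ctranspose W * W) $$ (i, j) = 1\<^sub>m n $$ (i, j)" using prod ij by simp
  qed (use Wc in auto)
  have WS: "W * S = S * W"
  proof (rule eq_matI)
    fix i j assume "i < dim_row (S * W)" "j < dim_col (S * W)"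
    then have ij: "i < n" "j < n" using Wc by auto
    have "W $$ (i, j) = 0" if "s i \<noteq> s j"
      using that ij s_not1[of i] s_not1[of j] by (cases "j \<in> B") (auto simp: W_B W_nB B_def)
    then have "W $$ (i, j) * of_real (s j) = of_real (s i) * W $$ (i, j)"
      by (cases "s i = s j") (simp_all add: of_real_commute[of "W $$ (i, j)"])
    then show "(W * S) $$ (i, j) = (S * W) $$ (i, j)"
      unfolding mult_rdiag_index[OF Wc ij] rdiag_mult_index[OF Wc ij] .
  qed (use Wc in auto)
  let ?H = "hmat n \<tau> (\<lambda>i. 2 * \<phi> i) :: 'a mat"
  have \<phi>2: "compat (\<lambda>i. 2 * \<phi> i)" by (rule compat_scale[OF \<phi>])
  have WHJ: "(W * (?H * J)) $$ (k, j) =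
    W $$ (k, j) * of_real (d j) + W $$ (k, \<tau> j) * of_real (sinh (2 * \<phi> j) * e j)" if kj: "k < n" "j < n" for k j
  proof -
    have "W * (?H * J) = W * ?H * J" using Wc by (simp add: assoc_mult_mat[of _ n n _ n _ n])
    then have "(W * (?H * J)) $$ (k, j) = (W * ?H) $$ (k, j) * of_real (e j)"
      using mult_rdiag_index[OF mult_carrier_mat[OF Wc hmat_carrier] kj] by simp
    also have "(W * ?H) $$ (k, j) = W $$ (k, j) * of_real (cosh (2 * \<phi> j)) + W $$ (k, \<tau> j) * of_real (sinh (2 * \<phi> j))"
      by (rule mult_hmat_index[OF Wc kj \<phi>2])
    finally show ?thesis using d_cosh[OF kj(2)] by (simp add: distrib_right mult.assoc)
  qed
  have MW: "M * W = W * (?H * J)"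
  proof (rule eq_matI)
    fix k j assume "k < dim_row (W * (?H * J))" "j < dim_col (W * (?H * J))"
    then have kj: "k < n" "j < n" using Wc by auto
    note tj = \<tau>_less[OF kj(2)]
    have prod: "(M * W) $$ (k, j) = (\<Sum>i<n. M $$ (k, i) * W $$ (i, j))"
      by (rule index_mult_mat_sum[OF Mc Wc kj])
    have not_B: "(M * W) $$ (k, j) = M $$ (k, j)" if "j \<notin> B"
    proof -
      have "(M * W) $$ (k, j) = (\<Sum>i<n. if i = j then M $$ (k, j) else 0)"
        unfolding prod using kj that by (intro sum.cong) (auto simp: W_nB)
      then show ?thesis using kj by simp
    qed
    \<comment> \<open>Column \<open>j\<close> is an eigenvector if its angle is 0. For a paired
      positive index the equation is the definition of the new basis vector at
      \<open>\<tau> j\<close>. The case of a new column needs the orthogonality of rows and the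
      opposite eigenvalues.\<close>
    consider (zero) "\<phi> j = 0" | (plus) "\<phi> j \<noteq> 0" "s j = 1" | (B) "j \<in> B" unfolding B_def by blast
    then show "(M * W) $$ (k, j) = (W * (?H * J)) $$ (k, j)"
    proof cases
      case zero
      then have j: "j \<notin> B" by (simp add: B_def)
      have "M $$ (k, j) = (if k = j then of_real (d j) else 0)"
        using M_diag kj bd[of k j] M0[of j k] zero by (cases "s k = s j") auto
      then show ?thesis unfolding not_B[OF j] WHJ[OF kj] W_nB[OF kj j] using zero by simp
    next
      case plus
      then have j: "j \<notin> B" by (simp add: B_def)
      have tB: "\<tau> j \<in> B" using plus s\<tau>(1)[OF kj(2)] \<phi>\<tau> kj by (simp add: B_def)
      have "r (\<tau> j) * (sinh (2 * \<phi> j) * e j) = 1"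
        using sinh0[OF plus(1)] s\<tau>(2)[OF kj(2) plus(1)] \<phi>\<tau>[OF kj(2)] e_cases[OF kj(2)]
        by (auto simp: r_def)
      then have rr: "of_real (r (\<tau> j)) * of_real (sinh (2 * \<phi> j) * e j) = (1 :: 'a)"
        unfolding of_real_mult[symmetric] by simp
      show ?thesis
        unfolding not_B[OF j] WHJ[OF kj] W_nB[OF kj j] W_B[OF kj(1) tj tB] \<tau>_\<tau>[OF kj(2)]
      proof (cases "s k = 1")
        case True
        then have "M $$ (k, j) = (if k = j then of_real (d j) else 0)"
          using M_diag kj bd[of k j] plus by auto
        then show "M $$ (k, j) = (if k = j then 1 else 0) * of_real (d j) +
          (if s k = 1 then 0 else M $$ (k, j) * of_real (r (\<tau> j))) * of_real (sinh (2 * \<phi> j) * e j)"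
          using True by simp
      next
        case False
        then have "k \<noteq> j" using plus by auto
        then show "M $$ (k, j) = (if k = j then 1 else 0) * of_real (d j) +
          (if s k = 1 then 0 else M $$ (k, j) * of_real (r (\<tau> j))) * of_real (sinh (2 * \<phi> j) * e j)"
          using False rr by (simp only: if_False mult.assoc mult_1_right mult_zero_left add_0_left)
      qed
    next
      case B
      then have nz: "\<phi> j \<noteq> 0" "s j \<noteq> 1" by (auto simp: B_def)
      have st: "s (\<tau> j) = 1" using s\<tau>(1)[OF kj(2) nz(1)] s_not1[OF kj(2) nz(2)] by simp
      then have tB: "\<tau> j \<notin> B" by (simp add: B_def)
      let ?T = "{i\<in>{..<n}. s i \<noteq> s (\<tau> j)}"
      have MW: "(M * W) $$ (k, j) = (\<Sum>i\<in>?T. M $$ (k, i) * (M $$ (i, \<tau> j) * of_real (r j)))"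
        unfolding prod
      proof (rule sum.mono_neutral_cong_right)
        show "\<forall>i\<in>{..<n} - ?T. M $$ (k, i) * W $$ (i, j) = 0" using B kj st by (auto simp: W_B)
        show "M $$ (k, i) * W $$ (i, j) = M $$ (k, i) * (M $$ (i, \<tau> j) * of_real (r j))" if "i \<in> ?T" for i
          using that B kj st by (auto simp: W_B)
      qed auto
      show ?thesis
      proof (cases "s k = 1")
        case True
        \<comment> \<open>In a positive row the sum is an inner product of two rows of the
          off-diagonal block, which is nonzero only for \<open>k = \<tau> j\<close>.\<close>
        have "(M * W) $$ (k, j) = (\<Sum>i\<in>{i\<in>{..<n}. s i \<noteq> s k}. - (M $$ (k, i) * conjugate (M $$ (\<tau> j, i))) * of_real (r j))"
          unfolding MW
        proof (rule sum.cong)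
          fix i assume i: "i \<in> {i\<in>{..<n}. s i \<noteq> s k}"
          then have "M $$ (i, \<tau> j) = - conjugate (M $$ (\<tau> j, i))"
            using tj st True by (intro M_opposite[OF hyps]) auto
          then show "M $$ (k, i) * (M $$ (i, \<tau> j) * of_real (r j)) =
            - (M $$ (k, i) * conjugate (M $$ (\<tau> j, i))) * of_real (r j)" by (simp add: mult.assoc)
        qed (use st True in auto)
        also have "\<dots> = - (if k = \<tau> j then of_real ((d k)\<^sup>2 - 1) else 0) * of_real (r j)"
          unfolding sum_distrib_right[symmetric] sum_negf
            M_opposite_rows[OF hyps kj(1) tj True[folded st]] ..
        also have "\<dots> = (if k = \<tau> j then of_real (sinh (2 * \<phi> j) * e j) else 0)"
        proof -
          have "- ((sinh (2 * \<phi> j))\<^sup>2) * r j = sinh (2 * \<phi> j) * e j"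
            using sinh0[OF nz(1)] e_cases[OF kj(2)] by (auto simp: r_def field_simps power2_eq_square)
          then have "- of_real ((d (\<tau> j))\<^sup>2 - 1) * of_real (r j) = (of_real (sinh (2 * \<phi> j) * e j) :: 'a)"
            unfolding d_sinh[OF tj] \<phi>\<tau>[OF kj(2)] of_real_minus[symmetric] of_real_mult[symmetric] by simp
          then show ?thesis by (cases "k = \<tau> j") simp_all
        qed
        also have "\<dots> = (W * (?H * J)) $$ (k, j)"
          unfolding WHJ[OF kj] W_nB[OF kj(1) tj tB] W_B[OF kj B] using True by simp
        finally show ?thesis .
      next
        case False
        then have sk: "s k \<noteq> s (\<tau> j)" and kt: "k \<noteq> \<tau> j" using st by auto
        have "(M * W) $$ (k, j) = (\<Sum>i\<in>?T. if i = k then M $$ (k, k) * (M $$ (k, \<tau> j) * of_real (r j)) else 0)"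
          unfolding MW
        proof (rule sum.cong[OF refl])
          fix i assume i: "i \<in> ?T"
          then have "s k = s i" using kj st s_not1[of i] s_not1[of k] False by auto
          then have "M $$ (k, i) = 0" if "i \<noteq> k" using i kj that by (intro bd) auto
          then show "M $$ (k, i) * (M $$ (i, \<tau> j) * of_real (r j)) =
            (if i = k then M $$ (k, k) * (M $$ (k, \<tau> j) * of_real (r j)) else 0)"
            by auto
        qed
        also have "\<dots> = M $$ (k, k) * (M $$ (k, \<tau> j) * of_real (r j))" using kj sk by simp
        \<comment> \<open>Unless the entry vanishes, \<open>d k\<close> and \<open>d j\<close> are
          both opposite to \<open>d (\<tau> j)\<close>, hence equal.\<close>
        also have "\<dots> = M $$ (k, \<tau> j) * of_real (r j) * of_real (d j)"
        proof (cases "M $$ (k, \<tau> j) = 0")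
          case False
          then have "d (\<tau> j) = - d k" by (intro M_opposite_eigenvalues[OF hyps kj(1) tj sk])
          moreover have "d (\<tau> j) = - d j"
            using d_cosh[OF tj] d_cosh[OF kj(2)] \<phi>\<tau>[OF kj(2)] s\<tau>(2)[OF kj(2) nz(1)] by simp
          ultimately have "d k = d j" by simp
          then show ?thesis using M_diag[OF kj(1)] of_real_commute[of "M $$ (k, \<tau> j) * of_real (r j)" "d j"]
            by simp
        qed simp
        also have "\<dots> = (W * (?H * J)) $$ (k, j)"
          unfolding WHJ[OF kj] W_nB[OF kj(1) tj tB] W_B[OF kj B] using False kt by simp
        finally show ?thesis .
      qed
    qed
  qed (use Wc Mc in auto)
  have W: "W \<in> K_group" using Wc WW WS by (simp add: K_group_def unitary_group_def)
  have "M = M * (W * ctranspose W)" using K_groupD(3)[OF W] Mc by simp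
  also have "\<dots> = M * W * ctranspose W"
    using Mc Wc by (simp add: assoc_mult_mat[of _ n n _ n _ n])
  also have "\<dots> = W * ?H * J * ctranspose W"
    unfolding MW using Wc by (simp add: assoc_mult_mat[of _ n n _ n _ n] mult_carrier_mat[of _ n n _ n])
  finally show thesis using that W M by simp
qed

end

section \<open>Direct sums and index permutations\<close>

lemma dsum_dim [simp]:
  "dim_row (dsum A B) = dim_row A + dim_row B" "dim_col (dsum A B) = dim_col A + dim_col B"
  by (simp_all add: dsum_def)

lemma dsum_carrier [simp]:
  "A \<in> carrier_mat a b \<Longrightarrow> B \<in> carrier_mat c d \<Longrightarrow> dsum A B \<in> carrier_mat (a + c) (b + d)"
  by (simp add: dsum_def)

lemma dsum_index:
  assumes "A \<in> carrier_mat a b" "B \<in> carrier_mat c d" "i < a + c" "j < b + d"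
  shows "dsum A B $$ (i, j) = (if i < a then if j < b then A $$ (i, j) else 0
    else if j < b then 0 else B $$ (i - a, j - b))"
  using assms by (auto simp: dsum_def)

lemma dsum_mult:
  fixes A1 :: "'a::semiring_0 mat"
  assumes "A1 \<in> carrier_mat a b" "B1 \<in> carrier_mat c d" "A2 \<in> carrier_mat b a'" "B2 \<in> carrier_mat d c'"
  shows "dsum A1 B1 * dsum A2 B2 = dsum (A1 * A2) (B1 * B2)"
  using assms by (simp add: dsum_def mult_four_block_mat[of _ a b _ d _ c _ _ a' _ c'] zero_carrier_mat)

lemma dsum_ctranspose:
  fixes A :: "'a::star_div_algebra mat"
  shows "ctranspose (dsum A B) = dsum (ctranspose A) (ctranspose B)"
  by (rule eq_matI) (auto simp: dsum_def)

lemma dsum_inject: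
  assumes "dsum A B = dsum C D" "A \<in> carrier_mat a b" "C \<in> carrier_mat a b" "B \<in> carrier_mat c d" "D \<in> carrier_mat c d"
  shows "A = C" "B = D"
proof -
  show "A = C"
  proof (rule eq_matI)
    fix i j assume "i < dim_row C" "j < dim_col C"
    then show "A $$ (i, j) = C $$ (i, j)"
      using arg_cong[OF assms(1), of "\<lambda>X. X $$ (i, j)"] assms(2-) by (simp add: dsum_def)
  qed (use assms in auto)
  show "B = D"
  proof (rule eq_matI)
    fix i j assume "i < dim_row D" "j < dim_col D"
    then show "B $$ (i, j) = D $$ (i, j)"
      using arg_cong[OF assms(1), of "\<lambda>X. X $$ (a + i, b + j)"] assms(2-) by (simp add: dsum_def)
  qed (use assms in auto)
qed

lemma rdiag_cong: "(\<And>i. i < n \<Longrightarrow> f i = g i) \<Longrightarrow> rdiag n f = rdiag n g"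
  by (rule eq_matI) (auto simp: rdiag_index)

lemma rdiag_add: "rdiag (a + b) f = dsum (rdiag a f) (rdiag b (\<lambda>i. f (a + i)))"
  by (rule eq_matI) (auto simp: rdiag_index dsum_index[of _ a a _ b b])

lemma signature_mat_rdiag: "signature_mat p q = rdiag (p + q) (\<lambda>i. if i < p then 1 else -1)"
proof -
  have "rdiag q (\<lambda>_. -1) = (- 1\<^sub>m q :: 'a mat)" by (rule eq_matI) (auto simp: rdiag_index)
  moreover have "rdiag p (\<lambda>i. if i < p then 1 else -1) = (1\<^sub>m p :: 'a mat)"
    by (rule eq_matI) (auto simp: rdiag_index)
  ultimately show ?thesis unfolding rdiag_add signature_mat_def by simp
qed

text \<open>Entries joining different values of \<open>f\<close> vanish, and \<open>f\<close>
  separates the two index ranges. This is applied with \<open>S\<close> to the compact factor and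
  with the reindexed \<open>J\<close> to \<open>V\<close>.\<close>

lemma commute_rdiag_dsum:
  fixes A :: "'a::star_div_algebra mat"
  assumes A: "A \<in> carrier_mat (a + b) (a + b)"
    and comm: "A * rdiag (a + b) f = rdiag (a + b) f * A"
    and f: "\<And>i j. i < a \<Longrightarrow> a \<le> j \<Longrightarrow> j < a + b \<Longrightarrow> f i \<noteq> f j"
  obtains B C where "B \<in> carrier_mat a a" "C \<in> carrier_mat b b" "A = dsum B C"
proof -
  have z: "A $$ (i, j) = 0" if "i < a + b" "j < a + b" "f i \<noteq> f j" for i j
  proof -
    have "A $$ (i, j) * of_real (f j) = of_real (f i) * A $$ (i, j)"
      using arg_cong[OF comm, of "\<lambda>X. X $$ (i, j)"] A that
      by (simp add: mult_rdiag_index[OF A] rdiag_mult_index[OF A] del: index_mult_mat(1))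
    then have "of_real (f j) * A $$ (i, j) = of_real (f i) * A $$ (i, j)"
      by (simp add: of_real_commute[of "A $$ (i, j)"])
    then show ?thesis using that by (metis mult_right_cancel of_real_eq_iff)
  qed
  define B where "B = mat a a (\<lambda>(i, j). A $$ (i, j))"
  define C where "C = mat b b (\<lambda>(i, j). A $$ (a + i, a + j))"
  have BC: "B \<in> carrier_mat a a" "C \<in> carrier_mat b b" by (simp_all add: B_def C_def)
  have "A = dsum B C"
  proof (rule eq_matI)
    fix i j assume "i < dim_row (dsum B C)" "j < dim_col (dsum B C)"
    then have ij: "i < a + b" "j < a + b" using BC by auto
    show "A $$ (i, j) = dsum B C $$ (i, j)"
      unfolding dsum_index[OF BC ij] using ij z[OF ij] f[of i j] f[of j i]
      by (auto simp: B_def C_def not_less)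
  qed (use A BC in auto)
  then show thesis using that BC by blast
qed

lemma dsum_commute_rdiag:
  fixes A :: "'a::star_div_algebra mat"
  assumes A: "A \<in> carrier_mat a a" and B: "B \<in> carrier_mat b b"
    and f: "\<And>i j. i < a \<Longrightarrow> j < a \<Longrightarrow> f i = f j" "\<And>i j. i < b \<Longrightarrow> j < b \<Longrightarrow> f (a + i) = f (a + j)"
  shows "dsum A B * rdiag (a + b) f = rdiag (a + b) f * dsum A B"
proof (rule eq_matI)
  fix i j assume "i < dim_row (rdiag (a + b) f * dsum A B)" "j < dim_col (rdiag (a + b) f * dsum A B)"
  then have ij: "i < a + b" "j < a + b" using A B by auto
  have "f i = f j" if "\<not> i < a" "\<not> j < a"
    using f(2)[of "i - a" "j - a"] that ij by simp
  then show "(dsum A B * rdiag (a + b) f) $$ (i, j) = (rdiag (a + b) f * dsum A B) $$ (i, j)"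
    unfolding mult_rdiag_index[OF dsum_carrier[OF A B] ij] rdiag_mult_index[OF dsum_carrier[OF A B] ij]
      dsum_index[OF A B ij] using f(1)[of i j] by (auto simp: of_real_commute[of "_ $$ _"])
qed (use A B in auto)

text \<open>The unitary and the indefinite unitary groups are both defined by a congruence of this
  kind, so one splitting serves both.\<close>

lemma dsum_congruence_iff:
  fixes A :: "'a::star_div_algebra mat"
  assumes A: "A \<in> carrier_mat a a" and B: "B \<in> carrier_mat b b"
  shows "ctranspose (dsum A B) * rdiag (a + b) f * dsum A B = rdiag (a + b) f \<longleftrightarrow>
    ctranspose A * rdiag a f * A = rdiag a f \<and>
    ctranspose B * rdiag b (\<lambda>i. f (a + i)) * B = rdiag b (\<lambda>i. f (a + i))"
proof -
  let ?F = "rdiag a f :: 'a mat" and ?G = "rdiag b (\<lambda>i. f (a + i)) :: 'a mat"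
  have c: "ctranspose A * ?F * A \<in> carrier_mat a a" "ctranspose B * ?G * B \<in> carrier_mat b b"
    using A B by (auto intro!: mult_carrier_mat)
  have "ctranspose (dsum A B) * dsum ?F ?G * dsum A B = dsum (ctranspose A * ?F * A) (ctranspose B * ?G * B)"
    using A B mult_carrier_mat[OF ctranspose_carrier[OF A] rdiag_carrier, of f]
      mult_carrier_mat[OF ctranspose_carrier[OF B] rdiag_carrier, of "\<lambda>i. f (a + i)"]
    by (simp only: dsum_ctranspose dsum_mult[of _ a a _ b b _ a _ b] rdiag_carrier ctranspose_carrier)
  then show ?thesis
    unfolding rdiag_add using dsum_inject[OF _ c(1) rdiag_carrier c(2) rdiag_carrier] by metis
qed

lemma unitary_group_rdiag:
  "G \<in> unitary_group n \<longleftrightarrow> G \<in> carrier_mat n n \<and> ctranspose G * rdiag n (\<lambda>_. 1) * G = rdiag n (\<lambda>_. 1)"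
  for G :: "'a::star_div_algebra mat"
  by (auto simp: unitary_group_def rdiag_one right_mult_one_mat[of _ n n])

lemma dsum_unitary_group_iff:
  fixes A :: "'a::star_div_algebra mat"
  assumes "A \<in> carrier_mat a a" "B \<in> carrier_mat b b"
  shows "dsum A B \<in> unitary_group (a + b) \<longleftrightarrow> A \<in> unitary_group a \<and> B \<in> unitary_group b"
  unfolding unitary_group_rdiag dsum_congruence_iff[OF assms] using assms by simp

lemma congruence_rdiag_index:
  fixes A :: "'a::star_div_algebra mat"
  assumes A: "A \<in> carrier_mat n n" and ij: "i < n" "j < n"
  shows "(ctranspose A * rdiag n f * A) $$ (i, j) =
    (\<Sum>k<n. conjugate (A $$ (k, i)) * of_real (f k) * A $$ (k, j))"
  unfolding index_mult_mat_sum[OF mult_carrier_mat[OF ctranspose_carrier[OF A] rdiag_carrier] A ij]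
  using A ij by (intro sum.cong) (auto simp: mult_rdiag_index[OF ctranspose_carrier[OF A]] simp del: index_mult_mat(1))

lemma mat_eq_iff_index:
  assumes "A \<in> carrier_mat n m" "B \<in> carrier_mat n m"
  shows "A = B \<longleftrightarrow> (\<forall>i<n. \<forall>j<m. A $$ (i, j) = B $$ (i, j))"
  using assms by (auto intro!: eq_matI)

text \<open>Transports \<open>S\<close>-unitarity and commutation with \<open>J\<close> to the block
  order in which \<open>V\<close> becomes a direct sum.\<close>

lemma reindex_rdiag_iff:
  fixes V D :: "'a::star_div_algebra mat"
  assumes \<rho>: "bij_betw \<rho> {..<n} {..<n}" and V: "V \<in> carrier_mat n n" and D: "D \<in> carrier_mat n n"
    and VD: "\<And>i j. i < n \<Longrightarrow> j < n \<Longrightarrow> V $$ (i, j) = D $$ (\<rho> i, \<rho> j)"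
    and f: "\<And>i. i < n \<Longrightarrow> f i = f' (\<rho> i)"
  shows "ctranspose V * rdiag n f * V = rdiag n f \<longleftrightarrow> ctranspose D * rdiag n f' * D = rdiag n f'"
    and "V * rdiag n f = rdiag n f * V \<longleftrightarrow> D * rdiag n f' = rdiag n f' * D"
proof -
  have less: "\<rho> i < n" if "i < n" for i using \<rho> that by (auto simp: bij_betw_def)
  have inj: "\<rho> i = \<rho> j \<longleftrightarrow> i = j" if "i < n" "j < n" for i j
    using \<rho> that by (auto simp: bij_betw_def inj_on_def)
  have all: "(\<forall>i<n. \<forall>j<n. P i j) \<longleftrightarrow> (\<forall>i<n. \<forall>j<n. P (\<rho> i) (\<rho> j))" for P
  proof -
    have "{..<n} = \<rho> ` {..<n}" using \<rho> by (simp add: bij_betw_def)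
    then have "(\<forall>i\<in>{..<n}. \<forall>j\<in>{..<n}. P i j) \<longleftrightarrow> (\<forall>i\<in>\<rho> ` {..<n}. \<forall>j\<in>\<rho> ` {..<n}. P i j)" by simp
    then show ?thesis by (simp add: Ball_def lessThan_def image_iff) (metis less)
  qed
  have cc: "ctranspose A * rdiag n g * A \<in> carrier_mat n n" "A * rdiag n g \<in> carrier_mat n n"
    "rdiag n g * A \<in> carrier_mat n n" if "A \<in> carrier_mat n n" for A :: "'a mat" and g
    using that by (auto intro!: mult_carrier_mat)
  have "(ctranspose V * rdiag n f * V) $$ (i, j) = (ctranspose D * rdiag n f' * D) $$ (\<rho> i, \<rho> j)"
    if ij: "i < n" "j < n" for i j
  proof -
    have "(\<Sum>k<n. conjugate (V $$ (k, i)) * of_real (f k) * V $$ (k, j)) =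
      (\<Sum>k<n. conjugate (D $$ (\<rho> k, \<rho> i)) * of_real (f' (\<rho> k)) * D $$ (\<rho> k, \<rho> j))"
      using ij by (intro sum.cong) (auto simp: VD f)
    also have "\<dots> = (\<Sum>k<n. conjugate (D $$ (k, \<rho> i)) * of_real (f' k) * D $$ (k, \<rho> j))"
      by (rule sum.reindex_bij_betw[OF \<rho>])
    finally show ?thesis
      unfolding congruence_rdiag_index[OF V ij] congruence_rdiag_index[OF D less[OF ij(1)] less[OF ij(2)]] .
  qed
  moreover have "rdiag n f $$ (i, j) = (rdiag n f' $$ (\<rho> i, \<rho> j) :: 'a)" if "i < n" "j < n" for i j
    using that less inj by (simp add: rdiag_index f)
  ultimately show "ctranspose V * rdiag n f * V = rdiag n f \<longleftrightarrow> ctranspose D * rdiag n f' * D = rdiag n f'"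
    unfolding mat_eq_iff_index[OF cc(1)[OF V] rdiag_carrier] mat_eq_iff_index[OF cc(1)[OF D] rdiag_carrier]
    by (subst (2) all) simp
  have "(V * rdiag n f) $$ (i, j) = (D * rdiag n f') $$ (\<rho> i, \<rho> j)"
    "(rdiag n f * V) $$ (i, j) = (rdiag n f' * D) $$ (\<rho> i, \<rho> j)" if ij: "i < n" "j < n" for i j
    using ij less by (simp_all add: mult_rdiag_index[OF V] mult_rdiag_index[OF D] rdiag_mult_index[OF V]
        rdiag_mult_index[OF D] VD f del: index_mult_mat(1))
  then show "V * rdiag n f = rdiag n f * V \<longleftrightarrow> D * rdiag n f' = rdiag n f' * D"
    unfolding mat_eq_iff_index[OF cc(2)[OF V] cc(3)[OF V]] mat_eq_iff_index[OF cc(2)[OF D] cc(3)[OF D]]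
    by (subst (2) all) simp
qed

lemma hmat_cong:
  "(\<And>i. i < n \<Longrightarrow> \<tau> i = \<tau>' i) \<Longrightarrow> (\<And>i. i < n \<Longrightarrow> \<phi> i = \<phi>' i) \<Longrightarrow> hmat n \<tau> \<phi> = hmat n \<tau>' \<phi>'"
  by (rule eq_matI) (auto simp: hmat_index)

lemma hyp_mat_hmat:
  assumes "n \<le> m"
  shows "hyp_mat m n \<theta> = hmat (m + n) (\<lambda>a. if a < n then a + m else if a < m then a else a - m)
    (\<lambda>a. if a < n then \<theta> $ a else if a < m then 0 else \<theta> $ (a - m))"
proof (rule eq_matI)
  fix i j
  let ?H = "hmat (m + n) (\<lambda>a. if a < n then a + m else if a < m then a else a - m)
    (\<lambda>a. if a < n then \<theta> $ a else if a < m then 0 else \<theta> $ (a - m)) :: 'a mat"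
  assume "i < dim_row ?H" "j < dim_col ?H"
  then have ij: "i < m + n" "j < m + n" by auto
  show "hyp_mat m n \<theta> $$ (i, j) = ?H $$ (i, j)"
    unfolding hmat_index[OF ij] using ij assms
    by (cases "i < n"; cases "i < m"; cases "j < n"; cases "j < m")
      (auto simp: hyp_mat_def dsum_def mat_diag_def Let_def)
qed (use assms in \<open>auto simp: hyp_mat_def dsum_def mat_diag_def Let_def\<close>)

lemma dsum_hmat:
  assumes "\<And>i. i < a \<Longrightarrow> \<tau>1 i < a" "\<And>i. i < b \<Longrightarrow> \<tau>2 i < b"
  shows "dsum (hmat a \<tau>1 \<phi>1) (hmat b \<tau>2 \<phi>2) =
    hmat (a + b) (\<lambda>i. if i < a then \<tau>1 i else a + \<tau>2 (i - a)) (\<lambda>i. if i < a then \<phi>1 i else \<phi>2 (i - a))"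
proof (rule eq_matI)
  fix i j
  let ?H = "hmat (a + b) (\<lambda>i. if i < a then \<tau>1 i else a + \<tau>2 (i - a)) (\<lambda>i. if i < a then \<phi>1 i else \<phi>2 (i - a)) :: 'a mat"
  assume "i < dim_row ?H" "j < dim_col ?H"
  then have ij: "i < a + b" "j < a + b" by auto
  show "dsum (hmat a \<tau>1 \<phi>1) (hmat b \<tau>2 \<phi>2) $$ (i, j) = ?H $$ (i, j)"
  proof (cases "i < a")
    case True
    then show ?thesis using ij assms(1)[of i] by (simp add: hmat_index dsum_index[OF hmat_carrier hmat_carrier])
  next
    case False
    define i' j' where "i' = i - a" and "j' = j - a"
    have i: "i = a + i'" "i' < b" using False ij by (auto simp: i'_def)
    show ?thesis
    proof (cases "j < a")
      case True
      then show ?thesis using i ij by (simp add: hmat_index dsum_index[OF hmat_carrier hmat_carrier])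
    next
      case False
      then have j: "j = a + j'" "j' < b" using ij by (auto simp: j'_def)
      then show ?thesis using i ij by (simp add: hmat_index dsum_index[OF hmat_carrier hmat_carrier])
    qed
  qed
qed simp_all

lemma permutation_matrix_conj_hmat:
  assumes "\<And>i. i < n \<Longrightarrow> \<rho> i < n" "inj_on \<rho> {..<n}"
    and "\<And>i. i < n \<Longrightarrow> \<tau> i < n" "\<And>i. i < n \<Longrightarrow> \<rho> (\<tau> i) = \<tau>' (\<rho> i)" "\<And>i. i < n \<Longrightarrow> \<phi> i = \<phi>' (\<rho> i)"
  shows "transpose_mat (mat n n (\<lambda>(i, j). if i = \<rho> j then 1 else 0)) * hmat n \<tau>' \<phi>'
      * mat n n (\<lambda>(i, j). if i = \<rho> j then 1 else 0) = hmat n \<tau> \<phi>"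
proof (rule eq_matI)
  fix i j assume "i < dim_row (hmat n \<tau> \<phi>)" "j < dim_col (hmat n \<tau> \<phi>)"
  then have ij: "i < n" "j < n" by auto
  have inj: "\<rho> a = \<rho> b \<longleftrightarrow> a = b" if "a < n" "b < n" for a b
    using assms(2) that by (auto simp: inj_on_def)
  have "(transpose_mat (mat n n (\<lambda>(i, j). if i = \<rho> j then 1 else 0)) * hmat n \<tau>' \<phi>'
      * mat n n (\<lambda>(i, j). if i = \<rho> j then 1 else 0)) $$ (i, j) = hmat n \<tau>' \<phi>' $$ (\<rho> i, \<rho> j)"
    by (rule permutation_matrix_conj) (use assms ij in auto)
  also have "\<dots> = hmat n \<tau> \<phi> $$ (i, j)"
    using ij assms(1,3,5) inj by (simp add: hmat_index assms(4)[symmetric])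
  finally show "(transpose_mat (mat n n (\<lambda>(i, j). if i = \<rho> j then 1 else 0)) * hmat n \<tau>' \<phi>'
      * mat n n (\<lambda>(i, j). if i = \<rho> j then 1 else 0)) $$ (i, j) = hmat n \<tau> \<phi> $$ (i, j)" .
qed simp_all

section \<open>The two permutation matrices as index maps\<close>

lemma less_sum4_cases:
  fixes i :: nat
  assumes "i < a + b + c + d"
  shows "i < a \<or> (\<exists>k. i = a + k \<and> k < b) \<or> (\<exists>k. i = a + b + k \<and> k < c)
    \<or> (\<exists>k. i = a + b + c + k \<and> k < d)"
  using assms by presburger

text \<open>The row of the only 1 in column \<open>j\<close> of \<open>perm_mat1\<close>;
  \<open>index2\<close> plays the same role for \<open>perm_mat2\<close>.\<close>

definition index1 :: "nat \<Rightarrow> nat \<Rightarrow> nat \<Rightarrow> nat \<Rightarrow> nat" where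
  "index1 p1 p2 q1 j = (if j < p1 then j else if j < p1 + p2 then j + q1
    else if j < p1 + p2 + q1 then j - p2 else j)"

definition index2 :: "nat \<Rightarrow> nat \<Rightarrow> nat \<Rightarrow> nat \<Rightarrow> nat \<Rightarrow> nat" where
  "index2 p1 p2 q1 q2 j = (if j < p1 then j else if j < p1 + p2 + q1 then j + q2 else j - p2 - q1)"

lemma perm_mat1_eq:
  "perm_mat1 p1 p2 q1 q2 = mat (p1 + p2 + q1 + q2) (p1 + p2 + q1 + q2)
     (\<lambda>(i, j). if i = index1 p1 p2 q1 j then 1 else 0)"
proof (rule eq_matI)
  fix i j
  let ?P = "mat (p1 + p2 + q1 + q2) (p1 + p2 + q1 + q2)
     (\<lambda>(i, j). if i = index1 p1 p2 q1 j then 1 else 0) :: 'a mat"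
  assume "i < dim_row ?P" "j < dim_col ?P"
  then have ij: "i < p1 + p2 + q1 + q2" "j < p1 + p2 + q1 + q2" and i: "i < p1 + q1 + p2 + q2" by auto
  have "perm_mat1 p1 p2 q1 q2 $$ (i, j) = (if i = index1 p1 p2 q1 j then 1 else (0 :: 'a))"
    using less_sum4_cases[OF i] less_sum4_cases[OF ij(2)]
    unfolding perm_mat1_def index1_def
    by (elim disjE exE conjE) simp_all
  then show "perm_mat1 p1 p2 q1 q2 $$ (i, j) = ?P $$ (i, j)" using ij by simp
qed (simp_all add: perm_mat1_def)

lemma perm_mat2_eq:
  "perm_mat2 p1 p2 q1 q2 = mat (p1 + p2 + q1 + q2) (p1 + p2 + q1 + q2)
     (\<lambda>(i, j). if i = index2 p1 p2 q1 q2 j then 1 else 0)"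
proof (rule eq_matI)
  fix i j
  let ?P = "mat (p1 + p2 + q1 + q2) (p1 + p2 + q1 + q2)
     (\<lambda>(i, j). if i = index2 p1 p2 q1 q2 j then 1 else 0) :: 'a mat"
  assume "i < dim_row ?P" "j < dim_col ?P"
  then have ij: "i < p1 + p2 + q1 + q2" "j < p1 + p2 + q1 + q2" and i: "i < p1 + q2 + p2 + q1" by auto
  have "perm_mat2 p1 p2 q1 q2 $$ (i, j) = (if i = index2 p1 p2 q1 q2 j then 1 else (0 :: 'a))"
    using less_sum4_cases[OF i] less_sum4_cases[OF ij(2)]
    unfolding perm_mat2_def index2_def
    by (elim disjE exE conjE) simp_all
  then show "perm_mat2 p1 p2 q1 q2 $$ (i, j) = ?P $$ (i, j)" using ij by simp
qed (simp_all add: perm_mat2_def)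

lemma index1_bij: "bij_betw (index1 p1 p2 q1) {..<p1 + p2 + q1 + q2} {..<p1 + p2 + q1 + q2}"
  \<comment> \<open>Exchanging the two middle block sizes inverts the map.\<close>
  by (rule bij_betw_byWitness[where f' = "index1 p1 q1 p2"]) (auto simp: index1_def)

lemma index2_bij: "bij_betw (index2 p1 p2 q1 q2) {..<p1 + p2 + q1 + q2} {..<p1 + p2 + q1 + q2}"
  by (rule bij_betw_byWitness[where f' = "\<lambda>j. if j < p1 then j else if j < p1 + q2 then j + p2 + q1 else j - q2"])
    (auto simp: index2_def)

section \<open>The concrete block sizes\<close>

locale kah_sizes =
  fixes p1 p2 q1 q2 :: nat
begin

abbreviation n where "n \<equiv> p1 + p2 + q1 + q2"
definition m1 where "m1 = min p1 q2"
definition m2 where "m2 = min p2 q1"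

definition sgn_pq :: "nat \<Rightarrow> real" where
  "sgn_pq i = (if i < p1 + p2 then 1 else -1)"

definition sgn_12 :: "nat \<Rightarrow> real" where
  "sgn_12 i = (if i < p1 \<or> p1 + p2 \<le> i \<and> i < p1 + p2 + q1 then 1 else -1)"

text \<open>\<open>c1\<close> starts the last \<open>m1\<close> positions of the \<open>q2\<close>
  block and \<open>c2\<close> the last \<open>m2\<close> positions of the \<open>q1\<close> block.
  Partners sit at the end of these blocks because in \<open>hyp_mat\<close> the identity block
  precedes the final one.\<close>

definition c1 where "c1 = p1 + p2 + q1 + (q2 - m1)"
definition c2 where "c2 = p1 + p2 + (q1 - m2)"

lemma bounds:
  "m1 \<le> p1" "m1 \<le> q2" "m2 \<le> p2" "m2 \<le> q1"
  "c1 + m1 = n" "c2 + m2 = p1 + p2 + q1" "p1 + p2 \<le> c2" "p1 + p2 + q1 \<le> c1"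
  by (auto simp: c1_def c2_def m1_def m2_def)

text \<open>The hyperbolic rotations mix the indices \<open>i\<close> and \<open>partner i\<close>.\<close>

definition partner :: "nat \<Rightarrow> nat" where
  "partner i = (if i < m1 then c1 + i
    else if p1 \<le> i \<and> i < p1 + m2 then c2 + (i - p1)
    else if c2 \<le> i \<and> i < p1 + p2 + q1 then p1 + (i - c2)
    else if c1 \<le> i \<and> i < n then i - c1 else i)"

definition angle :: "real vec \<Rightarrow> real vec \<Rightarrow> nat \<Rightarrow> real" where
  "angle \<theta> \<gamma> i = (if i < m1 then \<theta> $ i
    else if p1 \<le> i \<and> i < p1 + m2 then \<gamma> $ (i - p1)
    else if c2 \<le> i \<and> i < p1 + p2 + q1 then \<gamma> $ (i - c2)
    else if c1 \<le> i \<and> i < n then \<theta> $ (i - c1) else 0)"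

lemma partner_less: "i < n \<Longrightarrow> partner i < n"
  using bounds by (auto simp: partner_def)

lemma partner_cases:
  assumes "i < n"
  obtains (A) "i < m1" "partner i = c1 + i"
  | (B) k where "k < m2" "i = p1 + k" "partner i = c2 + k"
  | (C) k where "k < m2" "i = c2 + k" "partner i = p1 + k"
  | (D) k where "k < m1" "i = c1 + k" "partner i = k"
  | (E) "partner i = i" "m1 \<le> i" "\<not> (p1 \<le> i \<and> i < p1 + m2)" "\<not> (c2 \<le> i \<and> i < p1 + p2 + q1)" "i < c1"
proof -
  note c = bounds
  consider "i < m1" | "\<not> i < m1" "p1 \<le> i" "i < p1 + m2" | "c2 \<le> i" "i < p1 + p2 + q1" | "c1 \<le> i"
    | "m1 \<le> i" "\<not> (p1 \<le> i \<and> i < p1 + m2)" "\<not> (c2 \<le> i \<and> i < p1 + p2 + q1)" "i < c1"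
    by linarith
  then show thesis
  proof cases
    case 1
    then show thesis using A by (simp add: partner_def)
  next
    case 2
    then show thesis using B[of "i - p1"] by (simp add: partner_def)
  next
    case 3
    then show thesis using C[of "i - c2"] c by (simp add: partner_def)
  next
    case 4
    then show thesis using D[of "i - c1"] c assms by (simp add: partner_def)
  next
    case 5
    then show thesis using E c by (simp add: partner_def)
  qed
qed

lemma partner_simps:
  "k < m1 \<Longrightarrow> partner k = c1 + k" "k < m1 \<Longrightarrow> partner (c1 + k) = k"
  "k < m2 \<Longrightarrow> partner (p1 + k) = c2 + k" "k < m2 \<Longrightarrow> partner (c2 + k) = p1 + k"
  using bounds by (auto simp: partner_def)

lemma angle_simps:
  "k < m1 \<Longrightarrow> angle \<theta> \<gamma> k = \<theta> $ k" "k < m1 \<Longrightarrow> angle \<theta> \<gamma> (c1 + k) = \<theta> $ k"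
  "k < m2 \<Longrightarrow> angle \<theta> \<gamma> (p1 + k) = \<gamma> $ k" "k < m2 \<Longrightarrow> angle \<theta> \<gamma> (c2 + k) = \<gamma> $ k"
  using bounds by (auto simp: angle_def)

lemma sgn_simps:
  "k < m1 \<Longrightarrow> sgn_pq k = 1" "k < m1 \<Longrightarrow> sgn_pq (c1 + k) = -1"
  "k < m2 \<Longrightarrow> sgn_pq (p1 + k) = 1" "k < m2 \<Longrightarrow> sgn_pq (c2 + k) = -1"
  "k < m1 \<Longrightarrow> sgn_12 k = 1" "k < m1 \<Longrightarrow> sgn_12 (c1 + k) = -1"
  "k < m2 \<Longrightarrow> sgn_12 (p1 + k) = -1" "k < m2 \<Longrightarrow> sgn_12 (c2 + k) = 1"
  using bounds by (auto simp: sgn_pq_def sgn_12_def)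

text \<open>Distinct partners lie in the blocks \<open>p1\<close> and \<open>q2\<close>, or in
  \<open>p2\<close> and \<open>q1\<close>; in either case both sign patterns change.\<close>

sublocale signed_pairing n partner sgn_pq sgn_12
proof
  fix i assume i: "i < n"
  show "partner i < n" by (rule partner_less[OF i])
  show "partner (partner i) = i"
    using i by (cases rule: partner_cases) (simp_all add: partner_simps)
  show "sgn_pq i = 1 \<or> sgn_pq i = -1" "sgn_12 i = 1 \<or> sgn_12 i = -1"
    by (auto simp: sgn_pq_def sgn_12_def)
  assume ne: "partner i \<noteq> i"
  show "sgn_pq (partner i) = - sgn_pq i"
    using i by (cases rule: partner_cases) (use ne in \<open>simp_all add: sgn_simps\<close>)
  show "sgn_12 (partner i) = - sgn_12 i"
    using i by (cases rule: partner_cases) (use ne in \<open>simp_all add: sgn_simps\<close>)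
qed

lemma compat_angle: "compat (angle \<theta> \<gamma>)"
proof -
  have "angle \<theta> \<gamma> (partner i) = angle \<theta> \<gamma> i \<and> (partner i = i \<longrightarrow> angle \<theta> \<gamma> i = 0)" if "i < n" for i
    using that
  proof (cases rule: partner_cases)
    case E
    then show ?thesis by (auto simp: angle_def)
  qed (use bounds in \<open>auto simp: partner_simps angle_simps\<close>)
  then show ?thesis by (simp add: compat_def)
qed

text \<open>The converse of \<open>compat_angle\<close>: every compatible angle function comes from
  two vectors, which turns the abstract normal form back into \<theta> and \<gamma>.\<close>

lemma angle_of_compat:
  assumes "compat \<phi>" and "i < n"
  shows "angle (vec m1 \<phi>) (vec m2 (\<lambda>i. \<phi> (p1 + i))) i = \<phi> i"
  using assms(2)
proof (cases rule: partner_cases)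
  case (C k)
  then have "\<phi> i = \<phi> (p1 + k)" using assms by (metis compat_def)
  then show ?thesis using C by (simp add: angle_simps)
next
  case (D k)
  then have "\<phi> i = \<phi> (k)" using assms by (metis compat_def)
  then show ?thesis using D by (simp add: angle_simps)
next
  case E
  then show ?thesis using assms by (auto simp: angle_def compat_def)
qed (simp_all add: angle_simps)

text \<open>The block matrices of the middle factor disappear here, because \<open>index2\<close>
  carries \<open>partner\<close> to the pairings inside the two hyperbolic factors.\<close>

lemma middle_factor:
  "transpose_mat (perm_mat2 p1 p2 q1 q2) * dsum (hyp_mat (max p1 q2) m1 \<theta>) (hyp_mat (max p2 q1) m2 \<gamma>)
     * perm_mat2 p1 p2 q1 q2 = (hmat n partner (angle \<theta> \<gamma>) :: 'a::real_algebra_1 mat)"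
proof -
  have sizes: "max p1 q2 + m1 = p1 + q2" "max p2 q1 + m2 = p2 + q1" "m1 \<le> max p1 q2" "m2 \<le> max p2 q1"
    by (auto simp: m1_def m2_def)
  have c: "c1 = p2 + q1 + max p1 q2" "c2 = p1 + max p2 q1"
    by (auto simp: m1_def m2_def c1_def c2_def)
  have n: "p1 + q2 + (p2 + q1) = n" by simp
  let ?\<tau>1 = "\<lambda>a. if a < m1 then a + max p1 q2 else if a < max p1 q2 then a else a - max p1 q2"
  let ?\<tau>2 = "\<lambda>a. if a < m2 then a + max p2 q1 else if a < max p2 q1 then a else a - max p2 q1"
  let ?\<phi>1 = "\<lambda>a. if a < m1 then \<theta> $ a else if a < max p1 q2 then 0 else \<theta> $ (a - max p1 q2)"
  let ?\<phi>2 = "\<lambda>a. if a < m2 then \<gamma> $ a else if a < max p2 q1 then 0 else \<gamma> $ (a - max p2 q1)"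
  let ?\<tau> = "\<lambda>i. if i < p1 + q2 then ?\<tau>1 i else p1 + q2 + ?\<tau>2 (i - (p1 + q2))"
  let ?\<phi> = "\<lambda>i. if i < p1 + q2 then ?\<phi>1 i else ?\<phi>2 (i - (p1 + q2))"
  let ?\<rho> = "index2 p1 p2 q1 q2"
  have "dsum (hmat (p1 + q2) ?\<tau>1 ?\<phi>1) (hmat (p2 + q1) ?\<tau>2 ?\<phi>2) = (hmat (p1 + q2 + (p2 + q1)) ?\<tau> ?\<phi> :: 'a mat)"
    by (rule dsum_hmat) (use sizes in auto)
  moreover have "transpose_mat (mat n n (\<lambda>(i, j). if i = ?\<rho> j then 1 else 0)) * hmat n ?\<tau> ?\<phi>
      * mat n n (\<lambda>(i, j). if i = ?\<rho> j then 1 else 0) = (hmat n partner (angle \<theta> \<gamma>) :: 'a mat)"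
  proof (rule permutation_matrix_conj_hmat)
    show "inj_on ?\<rho> {..<n}" using index2_bij by (auto simp: bij_betw_def)
    fix i assume i: "i < n"
    \<comment> \<open>\<open>index2\<close> is a translation on each of these three ranges.\<close>
    consider "i < p1" | k where "i = p1 + k" "k < p2 + q1" | k where "i = p2 + q1 + k" "p1 \<le> k" "k < p1 + q2"
    proof -
      have "i < p1 \<or> i = p1 + (i - p1) \<and> i - p1 < p2 + q1 \<or>
          i = p2 + q1 + (i - (p2 + q1)) \<and> p1 \<le> i - (p2 + q1) \<and> i - (p2 + q1) < p1 + q2"
        using i by linarith
      then show thesis using that by blast
    qed
    note blocks = this
    show "?\<rho> i < n" "partner i < n" using i partner_less by (auto simp: index2_def)
    show "?\<rho> (partner i) = ?\<tau> (?\<rho> i)"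
      using i
    proof (cases rule: partner_cases)
      case A
      then show ?thesis using bounds sizes c by (simp add: index2_def)
    next
      case (B k)
      then show ?thesis using bounds sizes c by (simp add: index2_def)
    next
      case (C k)
      then show ?thesis using bounds sizes c by (simp add: index2_def)
    next
      case (D k)
      then show ?thesis using bounds sizes c by (simp add: index2_def)
    next
      case E
      from blocks show ?thesis
        by cases (use E bounds(1-4) sizes(3,4) c in \<open>auto simp: index2_def simp del: max_less_iff_conj less_max_iff_disj max.bounded_iff\<close>)
    qed
    show "angle \<theta> \<gamma> i = ?\<phi> (?\<rho> i)"
      using i
    proof (cases rule: partner_cases)
      case A
      then show ?thesis using bounds sizes c by (simp add: index2_def angle_simps)
    next
      case (B k)
      then show ?thesis using bounds sizes c by (simp add: index2_def angle_simps)
    next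
      case (C k)
      then have "angle \<theta> \<gamma> i = \<gamma> $ k" by (simp add: angle_simps)
      moreover have "?\<rho> i = p1 + q2 + (max p2 q1 + k)" using C(1,2) bounds(6,7) c(2) by (simp add: index2_def)
      moreover have "\<not> max p2 q1 + k < m2"
        using C(1) sizes(4) by linarith
      ultimately show ?thesis by simp
    next
      case (D k)
      then have "angle \<theta> \<gamma> i = \<theta> $ k" by (simp add: angle_simps)
      moreover have "?\<rho> i = max p1 q2 + k" using D(2) bounds(8) c(1) by (simp add: index2_def)
      moreover have "max p1 q2 + k < p1 + q2" "\<not> max p1 q2 + k < m1"
        using D(1) sizes(1,3) by linarith+
      ultimately show ?thesis by simp
    next
      case E
      from blocks show ?thesis
        by cases (use E bounds(1-4) sizes(3,4) c in \<open>auto simp: index2_def angle_def simp del: max_less_iff_conj less_max_iff_disj max.bounded_iff\<close>)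
    qed
  qed
  ultimately show ?thesis
    unfolding hyp_mat_hmat[OF sizes(3)] hyp_mat_hmat[OF sizes(4)] sizes(1,2) perm_mat2_eq n by simp
qed

end

section \<open>The factorization in terms of the compact group and the commutant of
  \<open>J\<close>\<close>

lemma indef_unitary_group_rdiag:
  fixes V :: "'a::star_div_algebra mat"
  shows "V \<in> indef_unitary_group p q \<longleftrightarrow> V \<in> carrier_mat (p + q) (p + q) \<and>
    ctranspose V * rdiag (p + q) (\<lambda>i. if i < p then 1 else -1) * V = rdiag (p + q) (\<lambda>i. if i < p then 1 else -1)"
  by (simp add: indef_unitary_group_def signature_mat_rdiag)

context kah_sizes
begin

lemma assoc_n: "p1 + p2 + (q1 + q2) = n" "p1 + q1 + (p2 + q2) = n"
  by simp_all

lemma K_group_dsum: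
  fixes k :: "'a::star_div_algebra mat"
  shows "k \<in> K_group \<longleftrightarrow> (\<exists>Up \<in> unitary_group (p1 + p2). \<exists>Uq \<in> unitary_group (q1 + q2). k = dsum Up Uq)"
proof
  assume k: "k \<in> K_group"
  note kc = K_groupD(1)[OF k, folded assoc_n(1)]
  obtain Up Uq where U: "Up \<in> carrier_mat (p1 + p2) (p1 + p2)" "Uq \<in> carrier_mat (q1 + q2) (q1 + q2)"
    and keq: "k = dsum Up Uq"
    by (rule commute_rdiag_dsum[OF kc K_groupD(4)[OF k, folded assoc_n(1)]]) (auto simp: sgn_pq_def)
  have "k \<in> unitary_group (p1 + p2 + (q1 + q2))" using k by (simp add: K_group_def assoc_n)
  then show "\<exists>Up \<in> unitary_group (p1 + p2). \<exists>Uq \<in> unitary_group (q1 + q2). k = dsum Up Uq"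
    using keq unfolding keq dsum_unitary_group_iff[OF U] by blast
next
  assume "\<exists>Up \<in> unitary_group (p1 + p2). \<exists>Uq \<in> unitary_group (q1 + q2). k = dsum Up Uq"
  then obtain Up Uq where U: "Up \<in> unitary_group (p1 + p2)" "Uq \<in> unitary_group (q1 + q2)" "k = dsum Up Uq"
    by blast
  have "k * S = S * k"
    unfolding U(3) assoc_n(1)[symmetric]
    by (rule dsum_commute_rdiag[OF unitary_groupD(1)[OF U(1)] unitary_groupD(1)[OF U(2)]]) (auto simp: sgn_pq_def)
  moreover have "k \<in> unitary_group n"
    unfolding U(3) assoc_n(1)[symmetric]
    using U dsum_unitary_group_iff[OF unitary_groupD(1)[OF U(1)] unitary_groupD(1)[OF U(2)]] by blast
  ultimately show "k \<in> K_group" by (simp add: K_group_def)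
qed

text \<open>The sign patterns in the block order $p_1, q_1, p_2, q_2$ of the rows of \<open>perm_mat1\<close>.\<close>

definition sgn_pq' :: "nat \<Rightarrow> real" where
  "sgn_pq' i = (if i < p1 \<or> p1 + q1 \<le> i \<and> i < p1 + q1 + p2 then 1 else -1)"

definition sgn_12' :: "nat \<Rightarrow> real" where
  "sgn_12' i = (if i < p1 + q1 then 1 else -1)"

lemma index1_sgn:
  "i < n \<Longrightarrow> sgn_pq i = sgn_pq' (index1 p1 p2 q1 i)" "i < n \<Longrightarrow> sgn_12 i = sgn_12' (index1 p1 p2 q1 i)"
  by (auto simp: sgn_pq_def sgn_pq'_def sgn_12_def sgn_12'_def index1_def)

text \<open>In the row order of \<open>perm_mat1\<close>, \<open>J\<close> changes sign only once,
  so commuting with it means being a direct sum. For a direct sum, \<open>S\<close>-unitarity splits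
  into the two indefinite unitary conditions.\<close>

lemma V_factor_iff:
  fixes V :: "'a::star_div_algebra mat"
  defines "P1 \<equiv> perm_mat1 p1 p2 q1 q2 :: 'a mat"
  shows "S_unitary V \<and> V * J = J * V \<longleftrightarrow> (\<exists>V1 \<in> indef_unitary_group p1 q1.
    \<exists>V2 \<in> indef_unitary_group p2 q2. V = transpose_mat P1 * dsum V1 V2 * P1)"
proof -
  let ?\<rho> = "index1 p1 p2 q1"
  have less: "?\<rho> i < n" if "i < n" for i using that by (auto simp: index1_def)
  have P1: "P1 \<in> carrier_mat n n" by (simp add: P1_def perm_mat1_eq)
  have conj: "(transpose_mat P1 * D * P1) $$ (i, j) = D $$ (?\<rho> i, ?\<rho> j)"
    if "D \<in> carrier_mat n n" "i < n" "j < n" for D i j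
    unfolding P1_def perm_mat1_eq by (rule permutation_matrix_conj[OF _ that]) (rule less)
  have conjc: "transpose_mat P1 * D * P1 \<in> carrier_mat n n" if "D \<in> carrier_mat n n" for D
    using that P1 by (auto intro!: mult_carrier_mat)
  have iff: "S_unitary V \<and> V * J = J * V \<longleftrightarrow>
      ctranspose D * rdiag n sgn_pq' * D = rdiag n sgn_pq' \<and> D * rdiag n sgn_12' = rdiag n sgn_12' * D"
    if "V \<in> carrier_mat n n" "D \<in> carrier_mat n n"
      "\<And>i j. i < n \<Longrightarrow> j < n \<Longrightarrow> V $$ (i, j) = D $$ (?\<rho> i, ?\<rho> j)" for V D :: "'a mat"
    using reindex_rdiag_iff(1)[of ?\<rho> n V D sgn_pq sgn_pq', OF index1_bij that index1_sgn(1)]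
      reindex_rdiag_iff(2)[of ?\<rho> n V D sgn_12 sgn_12', OF index1_bij that index1_sgn(2)] that(1)
    by (simp add: S_unitary_def)
  have indef: "ctranspose (dsum V1 V2) * rdiag n sgn_pq' * dsum V1 V2 = rdiag n sgn_pq' \<longleftrightarrow>
      V1 \<in> indef_unitary_group p1 q1 \<and> V2 \<in> indef_unitary_group p2 q2"
    if c: "V1 \<in> carrier_mat (p1 + q1) (p1 + q1)" "V2 \<in> carrier_mat (p2 + q2) (p2 + q2)" for V1 V2 :: "'a mat"
  proof -
    have "rdiag (p1 + q1) sgn_pq' = (rdiag (p1 + q1) (\<lambda>i. if i < p1 then 1 else -1) :: 'a mat)"
      "rdiag (p2 + q2) (\<lambda>i. sgn_pq' (p1 + q1 + i)) = (rdiag (p2 + q2) (\<lambda>i. if i < p2 then 1 else -1) :: 'a mat)"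
      by (rule rdiag_cong; auto simp: sgn_pq'_def)+
    then show ?thesis
      unfolding assoc_n(2)[symmetric] dsum_congruence_iff[OF c] indef_unitary_group_rdiag using c by simp
  qed
  show ?thesis
  proof
    assume V: "S_unitary V \<and> V * J = J * V"
    then have Vc: "V \<in> carrier_mat n n" by (simp add: S_unitary_def)
    define \<rho>' where "\<rho>' = index1 p1 q1 p2"
    have \<rho>': "\<rho>' (?\<rho> i) = i" for i by (auto simp: \<rho>'_def index1_def)
    define D where "D = mat n n (\<lambda>(i, j). V $$ (\<rho>' i, \<rho>' j))"
    have Dc: "D \<in> carrier_mat n n" by (simp add: D_def)
    have VD: "V $$ (i, j) = D $$ (?\<rho> i, ?\<rho> j)" if "i < n" "j < n" for i j
      using that less by (simp add: D_def \<rho>')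
    have D: "ctranspose D * rdiag n sgn_pq' * D = rdiag n sgn_pq'" "D * rdiag n sgn_12' = rdiag n sgn_12' * D"
      using iff[OF Vc Dc VD] V by auto
    obtain V1 V2 where V12: "V1 \<in> carrier_mat (p1 + q1) (p1 + q1)" "V2 \<in> carrier_mat (p2 + q2) (p2 + q2)"
      "D = dsum V1 V2"
      by (rule commute_rdiag_dsum[OF Dc[folded assoc_n(2)] D(2)[folded assoc_n(2)]]) (auto simp: sgn_12'_def)
    have "V = transpose_mat P1 * D * P1"
      by (rule eq_matI) (use Vc conjc[OF Dc] in \<open>auto simp: VD conj[OF Dc] simp del: index_mult_mat(1)\<close>)
    then show "\<exists>V1 \<in> indef_unitary_group p1 q1. \<exists>V2 \<in> indef_unitary_group p2 q2.
        V = transpose_mat P1 * dsum V1 V2 * P1"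
      using D(1) indef[OF V12(1,2)] V12(3) by blast
  next
    assume "\<exists>V1 \<in> indef_unitary_group p1 q1. \<exists>V2 \<in> indef_unitary_group p2 q2.
        V = transpose_mat P1 * dsum V1 V2 * P1"
    then obtain V1 V2 where V12: "V1 \<in> indef_unitary_group p1 q1" "V2 \<in> indef_unitary_group p2 q2"
      and V: "V = transpose_mat P1 * dsum V1 V2 * P1" by blast
    have c: "V1 \<in> carrier_mat (p1 + q1) (p1 + q1)" "V2 \<in> carrier_mat (p2 + q2) (p2 + q2)"
      using V12 by (simp_all add: indef_unitary_group_def)
    have Dc: "dsum V1 V2 \<in> carrier_mat n n" using dsum_carrier[OF c] unfolding assoc_n .
    have "dsum V1 V2 * rdiag n sgn_12' = rdiag n sgn_12' * dsum V1 V2"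
      unfolding assoc_n(2)[symmetric] by (rule dsum_commute_rdiag[OF c]) (auto simp: sgn_12'_def)
    then show "S_unitary V \<and> V * J = J * V"
      using iff[OF conjc[OF Dc] Dc conj[OF Dc]] indef[OF c] V12 unfolding V by blast
  qed
qed

text \<open>From here on, uniqueness and existence are statements about \<open>reflection U\<close>
  alone.\<close>

lemma kah_factorization_iff:
  fixes U :: "'a::star_div_algebra mat"
  shows "kah_factorization p1 p2 q1 q2 U \<theta> \<gamma> \<longleftrightarrow>
    (\<exists>k \<in> K_group. \<exists>V. (S_unitary V \<and> V * J = J * V) \<and> U = k * hmat n partner (angle \<theta> \<gamma>) * V)"
proof -
  define P2 H where "P2 = (perm_mat2 p1 p2 q1 q2 :: 'a mat)"
    and "H = (dsum (hyp_mat (max p1 q2) (min p1 q2) \<theta>) (hyp_mat (max p2 q1) (min p2 q1) \<gamma>) :: 'a mat)"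
  have Pc: "P2 \<in> carrier_mat n n" by (simp add: P2_def perm_mat2_eq)
  have hc: "(hyp_mat (max a b) (min a b) \<phi> :: 'a mat) \<in> carrier_mat (a + b) (a + b)" for a b \<phi>
  proof -
    have e: "max a b + min a b = a + b" and le: "min a b \<le> max a b" by auto
    show ?thesis unfolding hyp_mat_hmat[OF le] e by (rule hmat_carrier)
  qed
  have Hc: "H \<in> carrier_mat n n"
  proof -
    have "p1 + q2 + (p2 + q1) = n" by simp
    then show ?thesis
      using dsum_carrier[OF hc[of p1 q2 \<theta>] hc[of p2 q1 \<gamma>]] unfolding H_def by metis
  qed
  have mid: "transpose_mat P2 * H * P2 = hmat n partner (angle \<theta> \<gamma>)"
    using middle_factor[of \<theta> \<gamma>] unfolding P2_def H_def m1_def m2_def .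
  have assoc: "k * transpose_mat P2 * H * P2 * V = k * hmat n partner (angle \<theta> \<gamma>) * V"
    if "k \<in> carrier_mat n n" "V \<in> carrier_mat n n" for k V
    unfolding mid[symmetric]
    using that Pc Hc by (simp add: assoc_mult_mat[of _ n n _ n _ n] mult_carrier_mat[of _ n n _ n])
  have "kah_factorization p1 p2 q1 q2 U \<theta> \<gamma> \<longleftrightarrow> (\<exists>k \<in> K_group. \<exists>V. (S_unitary V \<and> V * J = J * V) \<and>
      U = k * transpose_mat P2 * H * P2 * V)"
    unfolding kah_factorization_def Let_def V_factor_iff Bex_def K_group_dsum P2_def[symmetric] H_def[symmetric]
    by blast
  also have "\<dots> \<longleftrightarrow> (\<exists>k \<in> K_group. \<exists>V. (S_unitary V \<and> V * J = J * V) \<and> U = k * hmat n partner (angle \<theta> \<gamma>) * V)"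
    using assoc K_groupD(1) S_unitary_carrier by metis
  finally show ?thesis .
qed

lemma indef_unitary_group_S_unitary:
  "U \<in> indef_unitary_group (p1 + p2) (q1 + q2) \<longleftrightarrow> S_unitary (U :: 'a::star_div_algebra mat)"
proof -
  have "rdiag n (\<lambda>i. if i < p1 + p2 then 1 else -1) = (rdiag n sgn_pq :: 'a mat)"
    by (rule rdiag_cong) (simp add: sgn_pq_def)
  then show ?thesis unfolding indef_unitary_group_rdiag S_unitary_def assoc_n by simp
qed

end

section \<open>Uniqueness\<close>

text \<open>Only values above 1 are compared, because in a count of eigenvalues the value 1 may also
  stem from unpaired indices. All values are at least 1 and both vectors have length
  \<open>m\<close>, so the multiplicity of 1 follows. Equal values of cosh mean equal moduli of the
  angles.\<close>

lemma eq_up_to_order_signsI: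
  assumes x: "x \<in> carrier_vec m" and y: "y \<in> carrier_vec m"
    and cnt: "\<And>v. v > 1 \<Longrightarrow> card {i \<in> {..<m}. cosh (2 * x $ i) = v} = card {i \<in> {..<m}. cosh (2 * y $ i) = v}"
  shows "eq_up_to_order_signs x y"
proof -
  let ?f = "\<lambda>z :: real vec. \<lambda>i. cosh (2 * z $ i)"
  have gt1: "card {i \<in> {..<m}. ?f z i = 1} + card {i \<in> {..<m}. ?f z i > 1} = m" for z
  proof -
    have "{i \<in> {..<m}. ?f z i = 1} \<union> {i \<in> {..<m}. ?f z i > 1} = {..<m}"
      using cosh_real_ge_1[of "2 * z $ _"] by (auto simp: le_less)
    moreover have "card ({i \<in> {..<m}. ?f z i = 1} \<union> {i \<in> {..<m}. ?f z i > 1}) =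
      card {i \<in> {..<m}. ?f z i = 1} + card {i \<in> {..<m}. ?f z i > 1}"
      by (rule card_Un_disjoint) auto
    ultimately show ?thesis by simp
  qed
  have fin: "finite {i \<in> {..<m}. P i}" for P by simp
  have card_gt1: "card {i \<in> {..<m}. ?f z i > 1} =
      (\<Sum>v\<in>{v \<in> ?f x ` {..<m} \<union> ?f y ` {..<m}. v > 1}. card {i \<in> {..<m}. ?f z i = v})"
    if "z = x \<or> z = y" for z
  proof -
    have "{i \<in> {..<m}. ?f z i > 1} = (\<Union>v\<in>{v \<in> ?f x ` {..<m} \<union> ?f y ` {..<m}. v > 1}. {i \<in> {..<m}. ?f z i = v})"
      using that by auto
    then show ?thesis by (simp only:) (rule card_UN_disjoint; auto)
  qed
  have "card {i \<in> {..<m}. ?f x i > 1} = card {i \<in> {..<m}. ?f y i > 1}"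
    unfolding card_gt1[OF disjI1[OF refl]] card_gt1[OF disjI2[OF refl]]
    by (rule sum.cong[OF refl]) (use cnt in blast)
  then have one: "card {i \<in> {..<m}. ?f x i = 1} = card {i \<in> {..<m}. ?f y i = 1}"
    using gt1[of x] gt1[of y] by linarith
  have "image_mset (?f x) (mset_set {..<m}) = image_mset (?f y) (mset_set {..<m})"
  proof (rule multiset_eqI)
    fix v
    have count: "count (image_mset (?f z) (mset_set {..<m})) v = card {i \<in> {..<m}. ?f z i = v}" for z
      by (simp add: count_image_mset' eq_commute)
    consider "v > 1" | "v = 1" | "v < 1" by linarith
    then show "count (image_mset (?f x) (mset_set {..<m})) v = count (image_mset (?f y) (mset_set {..<m})) v"
    proof cases
      case 1
      then show ?thesis unfolding count by (rule cnt)
    next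
      case 2
      show ?thesis unfolding count unfolding 2 by (rule one)
    next
      case 3
      then have "{i \<in> {..<m}. ?f z i = v} = {}" for z
        using cosh_real_ge_1[of "2 * z $ _"] by (auto simp: not_le[symmetric])
      then show ?thesis by (simp only: count)
    qed
  qed
  then obtain \<pi> where \<pi>: "\<pi> permutes {..<m}" "\<forall>i\<in>{..<m}. ?f x i = ?f y (\<pi> i)"
    by (rule image_mset_eq_implies_permutes[OF finite_lessThan])
  have sign: "x $ i = (if x $ i = y $ \<pi> i then 1 else -1) * y $ \<pi> i" if "i < m" for i
  proof -
    have "\<bar>2 * x $ i\<bar> = \<bar>2 * y $ \<pi> i\<bar>"
      using \<pi>(2) that by (metis arcosh_cosh_real abs_ge_zero cosh_real_abs lessThan_iff)
    then show ?thesis by (auto simp: abs_eq_iff)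
  qed
  define \<sigma> :: "nat \<Rightarrow> real" where "\<sigma> i = (if x $ i = y $ \<pi> i then 1 else -1)" for i
  have "\<sigma> i \<in> {1, -1}" for i by (simp add: \<sigma>_def)
  moreover have "\<forall>i<m. x $ i = \<sigma> i * y $ \<pi> i" using sign unfolding \<sigma>_def by blast
  ultimately have "\<exists>\<pi> s. \<pi> permutes {..<m} \<and> (\<forall>i<m. s i \<in> {1, -1} \<and> x $ i = s i * y $ \<pi> i)"
    using \<pi>(1) by blast
  then show ?thesis unfolding eq_up_to_order_signs_def using x y by simp
qed

context kah_sizes
begin

text \<open>\<open>ctranspose l * k\<close> intertwines the two normal forms and is a direct sum, so
  its top left block intertwines their top left blocks. These are diagonal, since every nonzero sinh
  entry joins an index below \<open>p1 + p2\<close> to one above.\<close>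

lemma eigenvalue_match:
  fixes k l :: "'a::star_div_algebra mat"
  assumes k: "k \<in> K_group" and l: "l \<in> K_group" and \<phi>: "compat \<phi>" and \<psi>: "compat \<psi>"
    and eq: "k * hmat n partner \<phi> * J * ctranspose k = l * hmat n partner \<psi> * J * ctranspose l"
  shows "card {i \<in> {..<p1 + p2}. cosh (\<phi> i) * sgn_12 i = v} = card {i \<in> {..<p1 + p2}. cosh (\<psi> i) * sgn_12 i = v}"
proof -
  note kc = K_groupD[OF k] and lc = K_groupD[OF l]
  define G where "G = ctranspose l * k"
  have G: "G \<in> K_group" unfolding G_def by (intro K_group_mult K_group_ctranspose k l)
  note Gc = K_groupD(1)[OF G]
  let ?H = "\<lambda>\<phi>. hmat n partner \<phi> :: 'a mat"
  note [simp] = kc(1) lc(1) mult_carrier_mat[of _ n n _ n] assoc_mult_mat[of _ n n _ n _ n]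
  have "G * (?H \<phi> * J) = ctranspose l * (k * ?H \<phi> * J * (ctranspose k * k))"
    unfolding G_def kc(2) by simp
  also have "\<dots> = ctranspose l * ((k * ?H \<phi> * J * ctranspose k) * k)" by simp
  also have "\<dots> = ctranspose l * (l * (?H \<psi> * (J * (ctranspose l * k))))" unfolding eq by simp
  also have "\<dots> = ?H \<psi> * J * G"
    using mult_mat_cancel_left[OF lc(2), of "?H \<psi> * (J * (ctranspose l * k))" n] by (simp add: G_def)
  finally have inter: "G * (?H \<phi> * J) = ?H \<psi> * J * G" .
  obtain A B where A: "A \<in> unitary_group (p1 + p2)" and B: "B \<in> unitary_group (q1 + q2)" and GAB: "G = dsum A B"
    using G unfolding K_group_dsum by blast
  note Ac = unitary_groupD(1)[OF A] and Bc = unitary_groupD(1)[OF B]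
  have Gi: "G $$ (i, j) = (if j < p1 + p2 then A $$ (i, j) else 0)" if "i < p1 + p2" "j < n" for i j
    unfolding GAB using that by (subst dsum_index[OF Ac Bc]) auto
  have Gj: "G $$ (i, j) = (if i < p1 + p2 then A $$ (i, j) else 0)" if "i < n" "j < p1 + p2" for i j
    unfolding GAB using that by (subst dsum_index[OF Ac Bc]) auto
  have far: "partner i = i \<and> sinh (\<chi> i) = 0 \<or> p1 + p2 \<le> partner i"
    if "i < p1 + p2" "compat \<chi>" for i \<chi>
  proof (cases "partner i = i")
    case True
    then show ?thesis using that by (simp add: compat_def)
  next
    case False
    then show ?thesis using s_\<tau>[of i] that by (auto simp: sgn_pq_def split: if_splits)
  qed
  have "A * rdiag (p1 + p2) (\<lambda>i. cosh (\<phi> i) * sgn_12 i) = rdiag (p1 + p2) (\<lambda>i. cosh (\<psi> i) * sgn_12 i) * A"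
  proof (rule eq_matI)
    fix i j
    assume "i < dim_row (rdiag (p1 + p2) (\<lambda>i. cosh (\<psi> i) * sgn_12 i) * A)"
      "j < dim_col (rdiag (p1 + p2) (\<lambda>i. cosh (\<psi> i) * sgn_12 i) * A)"
    then have ij: "i < p1 + p2" "j < p1 + p2" using Ac by auto
    then have ij': "i < n" "j < n" by auto
    have "(G * (?H \<phi> * J)) $$ (i, j) = (G * ?H \<phi>) $$ (i, j) * of_real (sgn_12 j)"
      using mult_rdiag_index[OF mult_carrier_mat[OF Gc hmat_carrier] ij', of partner \<phi> sgn_12] Gc by simp
    also have "(G * ?H \<phi>) $$ (i, j) = G $$ (i, j) * of_real (cosh (\<phi> j)) + G $$ (i, partner j) * of_real (sinh (\<phi> j))"
      by (rule mult_hmat_index[OF Gc ij' \<phi>])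
    also have "G $$ (i, partner j) * of_real (sinh (\<phi> j)) = 0"
      using far[OF ij(2) \<phi>] Gi[OF ij(1) partner_less[OF ij'(2)]] by auto
    finally have left: "(G * (?H \<phi> * J)) $$ (i, j) = A $$ (i, j) * of_real (cosh (\<phi> j) * sgn_12 j)"
      using Gi[OF ij(1) ij'(2)] ij(2) by (simp add: mult.assoc)
    have JGc: "J * G \<in> carrier_mat n n" using Gc by simp
    have "(?H \<psi> * J * G) $$ (i, j) = (?H \<psi> * (J * G)) $$ (i, j)" using Gc by simp
    also have "\<dots> = of_real (cosh (\<psi> i)) * (J * G) $$ (i, j) + of_real (sinh (\<psi> i)) * (J * G) $$ (partner i, j)"
      by (rule hmat_mult_index[OF JGc ij'])
    also have "of_real (sinh (\<psi> i)) * (J * G) $$ (partner i, j) = 0"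
      using far[OF ij(1) \<psi>] Gj[OF partner_less[OF ij'(1)] ij(2)]
        rdiag_mult_index[OF Gc partner_less[OF ij'(1)] ij'(2), of sgn_12] by auto
    also have "(J * G) $$ (i, j) = of_real (sgn_12 i) * A $$ (i, j)"
      using rdiag_mult_index[OF Gc ij', of sgn_12] Gi[OF ij(1) ij'(2)] ij(2) by simp
    finally have right: "(?H \<psi> * J * G) $$ (i, j) = of_real (cosh (\<psi> i) * sgn_12 i) * A $$ (i, j)"
      by (simp add: mult.assoc)
    show "(A * rdiag (p1 + p2) (\<lambda>i. cosh (\<phi> i) * sgn_12 i)) $$ (i, j) =
      (rdiag (p1 + p2) (\<lambda>i. cosh (\<psi> i) * sgn_12 i) * A) $$ (i, j)"
      unfolding mult_rdiag_index[OF Ac ij] rdiag_mult_index[OF Ac ij]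
      using left right inter by simp
  qed (use Ac in auto)
  then show ?thesis by (rule unitary_intertwiner_multiplicities[OF A])
qed

lemma angle_unique:
  fixes U :: "'a::star_div_algebra mat"
  assumes \<theta>: "\<theta> \<in> carrier_vec m1" "\<theta>' \<in> carrier_vec m1" and \<gamma>: "\<gamma> \<in> carrier_vec m2" "\<gamma>' \<in> carrier_vec m2"
    and fact: "kah_factorization p1 p2 q1 q2 U \<theta> \<gamma>" and fact': "kah_factorization p1 p2 q1 q2 U \<theta>' \<gamma>'"
  shows "eq_up_to_order_signs \<theta>' \<theta>" and "eq_up_to_order_signs \<gamma>' \<gamma>"
proof -
  obtain k V where k: "k \<in> K_group" "S_unitary V" "V * J = J * V" "U = k * hmat n partner (angle \<theta> \<gamma>) * V"
    using fact unfolding kah_factorization_iff by blast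
  obtain l W where l: "l \<in> K_group" "S_unitary W" "W * J = J * W" "U = l * hmat n partner (angle \<theta>' \<gamma>') * W"
    using fact' unfolding kah_factorization_iff by blast
  let ?D = "\<lambda>\<theta> \<gamma> v. {i \<in> {..<p1 + p2}. cosh (2 * angle \<theta> \<gamma> i) * sgn_12 i = v}"
  \<comment> \<open>Both factorizations compute the same reflection of \<open>U\<close>, with
    compact factors \<open>k\<close> and \<open>l\<close>.\<close>
  have card: "card (?D \<theta>' \<gamma>' v) = card (?D \<theta> \<gamma> v)" for v
    using reflection_factorization[OF k(1) compat_angle k(2-4)] reflection_factorization[OF l(1) compat_angle l(2-4)]
    by (intro eigenvalue_match[OF l(1) k(1) compat_scale[OF compat_angle] compat_scale[OF compat_angle]]) simp
  \<comment> \<open>\<open>v > 1\<close> excludes the unpaired indices of the \<open>p1\<close>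
    block, whose value is 1, and the whole \<open>p2\<close> block, where the values are
    negative.\<close>
  have pos: "?D \<theta> \<gamma> v = {i \<in> {..<m1}. cosh (2 * \<theta> $ i) = v}" if "v > 1" for v and \<theta> \<gamma> :: "real vec"
  proof -
    have "cosh (2 * angle \<theta> \<gamma> i) * sgn_12 i = v \<longleftrightarrow> i < m1 \<and> cosh (2 * \<theta> $ i) = v" if "i < p1 + p2" for i
      using that \<open>v > 1\<close> bounds(1,3,5-8) cosh_real_ge_1[of "2 * angle \<theta> \<gamma> i"] cosh_real_pos[of "2 * angle \<theta> \<gamma> i"]
      by (cases "i < p1") (auto simp: angle_def sgn_12_def)
    then show ?thesis using bounds(1) by auto
  qed
  have neg: "?D \<theta> \<gamma> (- v) = (\<lambda>i. p1 + i) ` {i \<in> {..<m2}. cosh (2 * \<gamma> $ i) = v}" if "v > 1" for v and \<theta> \<gamma> :: "real vec"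
  proof -
    have "cosh (2 * angle \<theta> \<gamma> i) * sgn_12 i = - v \<longleftrightarrow> p1 \<le> i \<and> i - p1 < m2 \<and> cosh (2 * \<gamma> $ (i - p1)) = v"
      if "i < p1 + p2" for i
      using that \<open>v > 1\<close> bounds(1,3,5-8) cosh_real_ge_1[of "2 * angle \<theta> \<gamma> i"] cosh_real_pos[of "2 * angle \<theta> \<gamma> i"]
      by (cases "i < p1") (auto simp: angle_def sgn_12_def)
    then have "?D \<theta> \<gamma> (- v) = {i \<in> {..<p1 + p2}. p1 \<le> i \<and> i - p1 < m2 \<and> cosh (2 * \<gamma> $ (i - p1)) = v}"
      by auto
    also have "\<dots> = (\<lambda>i. p1 + i) ` {i \<in> {..<m2}. cosh (2 * \<gamma> $ i) = v}"
    proof (intro equalityI subsetI)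
      fix i assume "i \<in> {i \<in> {..<p1 + p2}. p1 \<le> i \<and> i - p1 < m2 \<and> cosh (2 * \<gamma> $ (i - p1)) = v}"
      then show "i \<in> (\<lambda>i. p1 + i) ` {i \<in> {..<m2}. cosh (2 * \<gamma> $ i) = v}"
        by (intro image_eqI[of _ _ "i - p1"]) auto
    qed (use bounds(3) in auto)
    finally show ?thesis .
  qed
  show "eq_up_to_order_signs \<theta>' \<theta>"
  proof (rule eq_up_to_order_signsI[OF \<theta>(2,1)])
    fix v :: real
    assume "v > 1"
    show "card {i \<in> {..<m1}. cosh (2 * \<theta>' $ i) = v} = card {i \<in> {..<m1}. cosh (2 * \<theta> $ i) = v}"
      using card[of v] unfolding pos[OF \<open>v > 1\<close>] .
  qed
  show "eq_up_to_order_signs \<gamma>' \<gamma>"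
  proof (rule eq_up_to_order_signsI[OF \<gamma>(2,1)])
    fix v :: real
    assume "v > 1"
    have eq: "card (?D \<theta> \<gamma> (- v)) = card {i \<in> {..<m2}. cosh (2 * \<gamma> $ i) = v}" for \<theta> \<gamma> :: "real vec"
      unfolding neg[OF \<open>v > 1\<close>] by (subst card_image) auto
    show "card {i \<in> {..<m2}. cosh (2 * \<gamma>' $ i) = v} = card {i \<in> {..<m2}. cosh (2 * \<gamma> $ i) = v}"
      using card[of "- v"] unfolding eq .
  qed
qed

end

section \<open>Existence\<close>

context kah_sizes
begin

text \<open>Conjugation by \<open>S\<close> has no effect inside a block of constant sign, so
  \<open>ctranspose_reflection\<close> makes both diagonal blocks self-adjoint. They are
  diagonalized independently, and the two unitary matrices together form one element of
  \<open>K_group\<close>.\<close>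

lemma ex_block_diagonal:
  fixes U :: "'a::star_div_algebra mat"
  assumes U: "S_unitary U"
  obtains k where "k \<in> K_group" "block_diagonal (reflection (k * U))"
proof -
  let ?p = "p1 + p2" and ?q = "q1 + q2"
  note Uc = S_unitary_carrier[OF U]
  define M where "M = reflection U"
  have Mc: "M \<in> carrier_mat n n" unfolding M_def by (rule reflection_carrier[OF Uc])
  have conj: "conjugate (M $$ (j, i)) = M $$ (i, j)" if "i < n" "j < n" "sgn_pq i = sgn_pq j" for i j
    unfolding M_def using reflection_conjugate[OF Uc that(1,2)] that s_sq[of j] by simp
  define X where "X = mat ?p ?p (\<lambda>(i, j). M $$ (i, j))"
  define Y where "Y = mat ?p ?q (\<lambda>(i, j). M $$ (i, ?p + j))"
  define W where "W = mat ?q ?p (\<lambda>(i, j). M $$ (?p + i, j))"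
  define Z where "Z = mat ?q ?q (\<lambda>(i, j). M $$ (?p + i, ?p + j))"
  have c: "X \<in> carrier_mat ?p ?p" "Y \<in> carrier_mat ?p ?q" "W \<in> carrier_mat ?q ?p" "Z \<in> carrier_mat ?q ?q"
    by (simp_all add: X_def Y_def W_def Z_def)
  have MX: "M = four_block_mat X Y W Z"
    by (rule eq_matI) (use Mc in \<open>auto simp: X_def Y_def W_def Z_def\<close>)
  have "ctranspose X = X"
    by (rule eq_matI) (auto simp: X_def conj sgn_pq_def)
  then obtain G d where G: "G \<in> unitary_group ?p" "ctranspose G * X * G = rdiag ?p d"
    using spectral_theorem[OF c(1)] by metis
  have "ctranspose Z = Z"
    by (rule eq_matI) (auto simp: Z_def conj sgn_pq_def)
  then obtain H f where H: "H \<in> unitary_group ?q" "ctranspose H * Z * H = rdiag ?q f"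
    using spectral_theorem[OF c(4)] by metis
  note Gc = unitary_groupD(1)[OF G(1)] and Hc = unitary_groupD(1)[OF H(1)]
  define k where "k = dsum G H"
  have k: "k \<in> K_group" unfolding K_group_dsum k_def using G(1) H(1) by blast
  have "reflection (ctranspose k * U) = ctranspose k * M * k"
    unfolding M_def using reflection_K_mult[OF K_group_ctranspose[OF k] Uc] by simp
  also have "\<dots> = dsum (ctranspose G) (ctranspose H) * four_block_mat X Y W Z * dsum G H"
    unfolding k_def MX dsum_ctranspose ..
  also have "\<dots> = four_block_mat (ctranspose G * X * G) (ctranspose G * Y * H)
      (ctranspose H * W * G) (ctranspose H * Z * H)"
  proof -
    note G' = ctranspose_carrier[OF Gc] and H' = ctranspose_carrier[OF Hc]
    have "dsum (ctranspose G) (ctranspose H) * four_block_mat X Y W Z =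
      four_block_mat (ctranspose G * X) (ctranspose G * Y) (ctranspose H * W) (ctranspose H * Z)"
      unfolding dsum_def using Gc Hc
      by (subst mult_four_block_mat[OF G' _ _ H' c])
        (use c Gc Hc in \<open>auto intro!: cong_four_block_mat simp: left_add_zero_mat right_add_zero_mat\<close>)
    also have "\<dots> * dsum G H = four_block_mat (ctranspose G * X * G) (ctranspose G * Y * H)
      (ctranspose H * W * G) (ctranspose H * Z * H)"
      unfolding dsum_def using Gc Hc
      by (subst mult_four_block_mat[OF mult_carrier_mat[OF G' c(1)] mult_carrier_mat[OF G' c(2)]
            mult_carrier_mat[OF H' c(3)] mult_carrier_mat[OF H' c(4)] Gc _ _ Hc])
        (use c Gc Hc in \<open>auto intro!: cong_four_block_mat simp: left_add_zero_mat right_add_zero_mat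
          mult_carrier_mat[of _ ?p ?p] mult_carrier_mat[of _ ?q ?q]\<close>)
    finally show ?thesis .
  qed
  finally have eq: "reflection (ctranspose k * U) = four_block_mat (rdiag ?p d) (ctranspose G * Y * H)
      (ctranspose H * W * G) (rdiag ?q f)" unfolding G(2) H(2) .
  have "block_diagonal (reflection (ctranspose k * U))"
    unfolding block_diagonal_def eq by (auto simp: sgn_pq_def rdiag_index)
  then show thesis using that K_group_ctranspose[OF k] by blast
qed

lemma sign_block_cards:
  "card {l \<in> {..<n}. sgn_pq l = 1 \<and> sgn_12 l = 1} = p1"
  "card {l \<in> {..<n}. sgn_pq l = 1 \<and> sgn_12 l = -1} = p2"
  "card {l \<in> {..<n}. sgn_pq l = -1 \<and> sgn_12 l = 1} = q1"
  "card {l \<in> {..<n}. sgn_pq l = -1 \<and> sgn_12 l = -1} = q2"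
proof -
  have "{l \<in> {..<n}. sgn_pq l = 1 \<and> sgn_12 l = 1} = {..<p1}"
    "{l \<in> {..<n}. sgn_pq l = 1 \<and> sgn_12 l = -1} = {p1..<p1 + p2}"
    "{l \<in> {..<n}. sgn_pq l = -1 \<and> sgn_12 l = 1} = {p1 + p2..<p1 + p2 + q1}"
    "{l \<in> {..<n}. sgn_pq l = -1 \<and> sgn_12 l = -1} = {p1 + p2 + q1..<n}"
    by (auto simp: sgn_pq_def sgn_12_def split: if_splits)
  then show "card {l \<in> {..<n}. sgn_pq l = 1 \<and> sgn_12 l = 1} = p1"
    "card {l \<in> {..<n}. sgn_pq l = 1 \<and> sgn_12 l = -1} = p2"
    "card {l \<in> {..<n}. sgn_pq l = -1 \<and> sgn_12 l = 1} = q1"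
    "card {l \<in> {..<n}. sgn_pq l = -1 \<and> sgn_12 l = -1} = q2"
    by simp_all
qed

text \<open>\<open>sign_count\<close> gives the four sign classes the sizes \<open>p1\<close>,
  \<open>p2\<close>, \<open>q1\<close>, \<open>q2\<close>, and
  \<open>opposite_multiplicities\<close> allows each class to be matched with the one where both
  signs are reversed. Listing the classes block after block yields \<alpha>.\<close>

lemma ex_eigenvalue_arrangement:
  fixes U M :: "'a::star_div_algebra mat"
  assumes U: "S_unitary U" and M: "M = reflection U" and bd: "block_diagonal M"
    and d: "d = (\<lambda>i. re (M $$ (i, i)))"
  obtains \<alpha> where "bij_betw \<alpha> {..<n} {..<n}" and "\<And>i. i < n \<Longrightarrow> sgn_pq (\<alpha> i) = sgn_pq i"
    and "\<And>i. i < n \<Longrightarrow> sgn_12 i * d (\<alpha> i) \<ge> 1"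
    and "\<And>i. i < n \<Longrightarrow> sgn_12 (partner i) * d (\<alpha> (partner i)) = sgn_12 i * d (\<alpha> i)"
    and "\<And>i. i < n \<Longrightarrow> partner i = i \<Longrightarrow> sgn_12 i * d (\<alpha> i) = 1"
proof -
  note hyps = U M bd d
  define A where "A \<sigma> \<epsilon> = {i \<in> {..<n}. sgn_pq i = \<sigma> \<and> \<epsilon> * d i > 0}" for \<sigma> \<epsilon>
  have fin: "finite (A \<sigma> \<epsilon>)" for \<sigma> \<epsilon> by (simp add: A_def)
  have cards: "card (A 1 1) = p1" "card (A 1 (-1)) = p2" "card (A (-1) 1) = q1" "card (A (-1) (-1)) = q2"
    unfolding A_def using sign_count[OF hyps, of 1 1] sign_count[OF hyps, of 1 "-1"]
      sign_count[OF hyps, of "-1" 1] sign_count[OF hyps, of "-1" "-1"] sign_block_cards by simp_all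
  have ge: "\<epsilon> * d i \<ge> 1" if "i \<in> A \<sigma> \<epsilon>" "\<epsilon> = 1 \<or> \<epsilon> = -1" for \<sigma> \<epsilon> i
    using that abs_d_ge_1[OF hyps, of i] by (auto simp: A_def)
  have mult: "card {i \<in> A 1 \<epsilon>. \<epsilon> * d i = v} = card {i \<in> A (-1) (-\<epsilon>). -\<epsilon> * d i = v}"
    if v: "v > 1" and \<epsilon>: "\<epsilon> = 1 \<or> \<epsilon> = -1" for v \<epsilon> :: real
  proof -
    have "{i \<in> A 1 \<epsilon>. \<epsilon> * d i = v} = {i \<in> {..<n}. sgn_pq i = 1 \<and> d i = \<epsilon> * v}"
      "{i \<in> A (-1) (-\<epsilon>). -\<epsilon> * d i = v} = {i \<in> {..<n}. sgn_pq i = -1 \<and> d i = - (\<epsilon> * v)}"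
      unfolding A_def using v \<epsilon> by (elim disjE; force)+
    moreover have "\<bar>\<epsilon> * v\<bar> > 1" using v \<epsilon> by auto
    ultimately show ?thesis using opposite_multiplicities[OF hyps, of "\<epsilon> * v"] by (simp only:)
  qed
  have ex: "\<exists>a b. bij_betw a {..<card (A 1 \<epsilon>)} (A 1 \<epsilon>) \<and> bij_betw b {..<card (A (-1) (-\<epsilon>))} (A (-1) (-\<epsilon>)) \<and>
      (\<forall>i<m. \<epsilon> * d (a i) = -\<epsilon> * d (b (card (A (-1) (-\<epsilon>)) - m + i))) \<and>
      (\<forall>i. m \<le> i \<longrightarrow> i < card (A 1 \<epsilon>) \<longrightarrow> \<epsilon> * d (a i) = 1) \<and>
      (\<forall>i < card (A (-1) (-\<epsilon>)) - m. -\<epsilon> * d (b i) = 1)"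
    if \<epsilon>: "\<epsilon> = 1 \<or> \<epsilon> = -1" and m: "m = min (card (A 1 \<epsilon>)) (card (A (-1) (-\<epsilon>)))" for \<epsilon> m
  proof (rule pair_equal_multiplicities[of "A 1 \<epsilon>" "A (-1) (-\<epsilon>)" "\<lambda>i. \<epsilon> * d i" "\<lambda>i. -\<epsilon> * d i" m])
    show "\<epsilon> * d i \<ge> 1" if "i \<in> A 1 \<epsilon>" for i using ge[OF that \<epsilon>] .
    show "-\<epsilon> * d i \<ge> 1" if "i \<in> A (-1) (-\<epsilon>)" for i using ge[OF that] \<epsilon> by auto
    show "card {i \<in> A 1 \<epsilon>. \<epsilon> * d i = v} = card {i \<in> A (-1) (-\<epsilon>). -\<epsilon> * d i = v}" if "v > 1" for v
      by (rule mult[OF that \<epsilon>])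
  qed (use fin m in blast)+
  \<comment> \<open>The case \<open>\<epsilon> = 1\<close> pairs the block \<open>p1\<close> with
    \<open>q2\<close> and will give \<theta>; the case \<open>\<epsilon> = -1\<close> below pairs
    \<open>p2\<close> with \<open>q1\<close> and will give \<gamma>.\<close>
  obtain a b where a: "bij_betw a {..<p1} (A 1 1)" and b: "bij_betw b {..<q2} (A (-1) (-1))"
    and ab: "\<forall>i<m1. d (a i) = - d (b (q2 - m1 + i))"
    and a1: "\<forall>i. m1 \<le> i \<longrightarrow> i < p1 \<longrightarrow> d (a i) = 1"
    and b1: "\<forall>i < q2 - m1. - d (b i) = 1"
    using ex[of 1 m1] by (auto simp: cards m1_def)
  obtain a' b' where a': "bij_betw a' {..<p2} (A 1 (-1))" and b': "bij_betw b' {..<q1} (A (-1) 1)"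
    and ab': "\<forall>i<m2. - d (a' i) = d (b' (q1 - m2 + i))"
    and a1': "\<forall>i. m2 \<le> i \<longrightarrow> i < p2 \<longrightarrow> - d (a' i) = 1"
    and b1': "\<forall>i < q1 - m2. d (b' i) = 1"
    using ex[of "-1" m2] by (auto simp: cards m2_def)
  define \<alpha> where "\<alpha> i = (if i < p1 then a i else if i < p1 + p2 then a' (i - p1)
    else if i < p1 + p2 + q1 then b' (i - (p1 + p2)) else b (i - (p1 + p2 + q1)))" for i
  have \<alpha>_block: "i < p1 \<Longrightarrow> \<alpha> i = a i" "i < p2 \<Longrightarrow> \<alpha> (p1 + i) = a' i"
    "i < q1 \<Longrightarrow> \<alpha> (p1 + p2 + i) = b' i" "\<alpha> (p1 + p2 + q1 + i) = b i" for i
    by (simp_all add: \<alpha>_def)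
  have sg: "i < p1 \<Longrightarrow> sgn_pq i = 1 \<and> sgn_12 i = 1" "i < p2 \<Longrightarrow> sgn_pq (p1 + i) = 1 \<and> sgn_12 (p1 + i) = -1"
    "i < q1 \<Longrightarrow> sgn_pq (p1 + p2 + i) = -1 \<and> sgn_12 (p1 + p2 + i) = 1"
    "sgn_pq (p1 + p2 + q1 + i) = -1 \<and> sgn_12 (p1 + p2 + q1 + i) = -1" for i
    by (simp_all add: sgn_pq_def sgn_12_def)
  have \<alpha>_A: "\<alpha> i \<in> A (sgn_pq i) (sgn_12 i)" if "i < n" for i
    using less_sum4_cases[OF that] a b a' b'
    by (elim disjE exE conjE) (auto simp: \<alpha>_block sg dest: bij_betwE)
  have injs: "i < p1 \<Longrightarrow> j < p1 \<Longrightarrow> a i = a j \<longleftrightarrow> i = j" "i < p2 \<Longrightarrow> j < p2 \<Longrightarrow> a' i = a' j \<longleftrightarrow> i = j"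
    "i < q1 \<Longrightarrow> j < q1 \<Longrightarrow> b' i = b' j \<longleftrightarrow> i = j" "i < q2 \<Longrightarrow> j < q2 \<Longrightarrow> b i = b j \<longleftrightarrow> i = j" for i j
    using a b a' b' by (auto simp: bij_betw_def inj_on_def)
  \<comment> \<open>The sign class of \<open>\<alpha> i\<close> reveals the block of
    \<open>i\<close>, so injectivity reduces to injectivity on each block.\<close>
  have inj: "i = j" if ij: "i < n" "j < n" "\<alpha> i = \<alpha> j" for i j
  proof -
    have "sgn_pq i = sgn_pq j" "sgn_12 i * d (\<alpha> i) > 0" "sgn_12 j * d (\<alpha> i) > 0"
      using \<alpha>_A[OF ij(1)] \<alpha>_A[OF ij(2)] ij(3) by (auto simp: A_def)
    then have "sgn_pq i = sgn_pq j" "sgn_12 i = sgn_12 j"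
      using e_cases[OF ij(1)] e_cases[OF ij(2)] by auto
    then show ?thesis
      using less_sum4_cases[OF ij(1)] less_sum4_cases[OF ij(2)] ij(3)
      by (elim disjE exE conjE) (simp_all add: \<alpha>_block sg injs)
  qed
  have "\<alpha> ` {..<n} = {..<n}"
  proof (rule endo_inj_surj)
    show "\<alpha> ` {..<n} \<subseteq> {..<n}" using \<alpha>_A by (auto simp: A_def)
  qed (use inj in \<open>auto simp: inj_on_def\<close>)
  then have bij: "bij_betw \<alpha> {..<n} {..<n}" using inj by (auto simp: bij_betw_def inj_on_def)
  have c: "c1 + i = p1 + p2 + q1 + (q2 - m1 + i)" "c2 + i = p1 + p2 + (q1 - m2 + i)" for i
    by (simp_all add: c1_def c2_def)
  have val: "i < m1 \<Longrightarrow> sgn_12 (c1 + i) * d (\<alpha> (c1 + i)) = sgn_12 i * d (\<alpha> i)"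
    "i < m2 \<Longrightarrow> sgn_12 (c2 + i) * d (\<alpha> (c2 + i)) = sgn_12 (p1 + i) * d (\<alpha> (p1 + i))" for i
  proof -
    assume i: "i < m1"
    then have "i < p1" using bounds(1) by simp
    then show "sgn_12 (c1 + i) * d (\<alpha> (c1 + i)) = sgn_12 i * d (\<alpha> i)"
      using ab[rule_format, OF i] sg(1)[of i] sg(4)[of "q2 - m1 + i"] unfolding c \<alpha>_block(4) by (simp add: \<alpha>_block)
  next
    assume i: "i < m2"
    then have "i < p2" "q1 - m2 + i < q1" using bounds(3,4) by simp_all
    then show "sgn_12 (c2 + i) * d (\<alpha> (c2 + i)) = sgn_12 (p1 + i) * d (\<alpha> (p1 + i))"
      using ab'[rule_format, OF i] sg(2)[of i] sg(3)[of "q1 - m2 + i"] unfolding c by (simp add: \<alpha>_block)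
  qed
  show thesis
  proof (rule that[OF bij])
    fix i assume i: "i < n"
    show "sgn_pq (\<alpha> i) = sgn_pq i" using \<alpha>_A[OF i] by (simp add: A_def)
    show "sgn_12 i * d (\<alpha> i) \<ge> 1" using ge[OF \<alpha>_A[OF i]] e_cases[OF i] by blast
    show "sgn_12 (partner i) * d (\<alpha> (partner i)) = sgn_12 i * d (\<alpha> i)"
      using i by (cases rule: partner_cases) (simp_all add: val)
    assume "partner i = i"
    with i show "sgn_12 i * d (\<alpha> i) = 1"
    proof (cases rule: partner_cases)
      case E
      from less_sum4_cases[OF i] show ?thesis
      proof (elim disjE exE conjE)
        assume "i < p1"
        then show ?thesis using E a1 by (simp add: \<alpha>_block sg)
      next
        fix k assume "i = p1 + k" "k < p2"
        then show ?thesis using E a1' by (simp add: \<alpha>_block sg)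
      next
        fix k assume "i = p1 + p2 + k" "k < q1"
        then show ?thesis using E b1' c[of 0] by (simp add: \<alpha>_block sg)
      next
        fix k assume "i = p1 + p2 + q1 + k" "k < q2"
        then show ?thesis using E b1 c[of 0] by (simp add: \<alpha>_block sg)
      qed
    qed (use bounds in auto)
  qed
qed

lemma ex_normal_form:
  fixes U :: "'a::star_div_algebra mat"
  assumes U: "S_unitary U"
  obtains k \<phi> where "k \<in> K_group" "compat \<phi>"
    "reflection U = k * hmat n partner (\<lambda>i. 2 * \<phi> i) * J * ctranspose k"
proof -
  obtain l where l: "l \<in> K_group" "block_diagonal (reflection (l * U))" by (rule ex_block_diagonal[OF U])
  define U1 where "U1 = l * U"
  have U1: "S_unitary U1" unfolding U1_def by (rule S_unitary_K_mult[OF l(1) U])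
  define d where "d = (\<lambda>i. re (reflection U1 $$ (i, i)))"
  obtain \<alpha> where bij: "bij_betw \<alpha> {..<n} {..<n}" and s\<alpha>: "\<And>i. i < n \<Longrightarrow> sgn_pq (\<alpha> i) = sgn_pq i"
    and ge: "\<And>i. i < n \<Longrightarrow> sgn_12 i * d (\<alpha> i) \<ge> 1"
    and pair: "\<And>i. i < n \<Longrightarrow> sgn_12 (partner i) * d (\<alpha> (partner i)) = sgn_12 i * d (\<alpha> i)"
    and fixed: "\<And>i. i < n \<Longrightarrow> partner i = i \<Longrightarrow> sgn_12 i * d (\<alpha> i) = 1"
    by (rule ex_eigenvalue_arrangement[OF U1 refl l(2)[folded U1_def] d_def]) blast
  define P where "P = (mat n n (\<lambda>(i, j). if i = \<alpha> j then 1 else 0) :: 'a mat)"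
  have P: "P \<in> K_group"
    "A \<in> carrier_mat n n \<Longrightarrow> i < n \<Longrightarrow> j < n \<Longrightarrow> (ctranspose P * A * P) $$ (i, j) = A $$ (\<alpha> i, \<alpha> j)" for A i j
    unfolding P_def using permutation_matrix_K_group[OF bij, where 'a = 'a] s\<alpha> by blast+
  define U2 where "U2 = ctranspose P * U1"
  have U2: "S_unitary U2" unfolding U2_def by (rule S_unitary_K_mult[OF K_group_ctranspose[OF P(1)] U1])
  have "reflection U2 = ctranspose P * reflection U1 * P"
    unfolding U2_def using reflection_K_mult[OF K_group_ctranspose[OF P(1)] S_unitary_carrier[OF U1]] by simp
  then have M2: "reflection U2 $$ (i, j) = reflection U1 $$ (\<alpha> i, \<alpha> j)" if "i < n" "j < n" for i j
    using P(2)[OF reflection_carrier[OF S_unitary_carrier[OF U1]] that] by simp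
  have \<alpha>: "\<alpha> i < n" "\<alpha> i = \<alpha> j \<longleftrightarrow> i = j" if "i < n" "j < n" for i j
    using bij that by (auto simp: bij_betw_def inj_on_def)
  have bd2: "block_diagonal (reflection U2)"
    using l(2) \<alpha> s\<alpha> M2 unfolding U1_def[symmetric] block_diagonal_def by metis
  \<comment> \<open>The angle is halved because the reflection carries doubled angles.
    \<open>arcosh\<close> inverts cosh here since the arranged values are at least 1, and it sends
    the unpaired values 1 to angle 0.\<close>
  define \<phi> where "\<phi> i = arcosh (sgn_12 i * d (\<alpha> i)) / 2" for i
  have \<phi>: "compat \<phi>" using pair fixed by (simp add: compat_def \<phi>_def)
  have d2: "re (reflection U2 $$ (i, i)) = cosh (2 * \<phi> i) * sgn_12 i" if "i < n" for i
  proof -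
    have "cosh (2 * \<phi> i) = sgn_12 i * d (\<alpha> i)" using ge[OF that] by (simp add: \<phi>_def)
    then show ?thesis using M2[OF that that] e_cases[OF that] by (auto simp: d_def)
  qed
  obtain k where k: "k \<in> K_group" "reflection U2 = k * hmat n partner (\<lambda>i. 2 * \<phi> i) * J * ctranspose k"
    by (rule hyperbolic_normal_form_diag[OF U2 refl bd2 refl \<phi>]) (use d2 in blast)+
  \<comment> \<open>Diagonalization and sorting acted on the reflection by conjugation with elements
    of \<open>K_group\<close>, so undoing them only changes the compact factor.\<close>
  have L: "ctranspose l * P \<in> K_group" by (rule K_group_mult[OF K_group_ctranspose[OF l(1)] P(1)])
  note lc = K_groupD[OF l(1)] and Pc = K_groupD[OF P(1)] and kc = K_groupD(1)[OF k(1)]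
  note Uc = S_unitary_carrier[OF U]
  have "P * U2 = U1"
    unfolding U2_def by (rule mult_mat_cancel_left[OF Pc(3) Pc(1) ctranspose_carrier[OF Pc(1)] S_unitary_carrier[OF U1]])
  moreover have "ctranspose l * U1 = U"
    unfolding U1_def by (rule mult_mat_cancel_left[OF lc(2) ctranspose_carrier[OF lc(1)] lc(1) Uc])
  ultimately have "U = ctranspose l * P * U2"
    using assoc_mult_mat[OF ctranspose_carrier[OF lc(1)] Pc(1) S_unitary_carrier[OF U2]] by simp
  then have "reflection U = (ctranspose l * P) * (k * hmat n partner (\<lambda>i. 2 * \<phi> i) * J * ctranspose k) * ctranspose (ctranspose l * P)"
    using reflection_K_mult[OF L S_unitary_carrier[OF U2]] k(2) by simp
  also have "\<dots> = (ctranspose l * P * k) * hmat n partner (\<lambda>i. 2 * \<phi> i) * J * ctranspose (ctranspose l * P * k)"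
    using lc(1) Pc(1) kc
    by (simp add: ctranspose_mult[of _ n n _ n] assoc_mult_mat[of _ n n _ n _ n] mult_carrier_mat[of _ n n _ n])
  finally show thesis using that K_group_mult[OF L k(1)] \<phi> by blast
qed

lemma ex_factorization:
  fixes U :: "'a::star_div_algebra mat"
  assumes U: "S_unitary U"
  obtains \<theta> \<gamma> where "\<theta> \<in> carrier_vec m1" "\<gamma> \<in> carrier_vec m2" "kah_factorization p1 p2 q1 q2 U \<theta> \<gamma>"
proof -
  obtain k \<phi> where k: "k \<in> K_group" and \<phi>: "compat \<phi>"
    and M: "reflection U = k * hmat n partner (\<lambda>i. 2 * \<phi> i) * J * ctranspose k"
    by (rule ex_normal_form[OF U])
  obtain V where V: "S_unitary V" "V * J = J * V" "U = k * hmat n partner \<phi> * V"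
    by (rule factorization_of_reflection[OF k \<phi> U M])
  let ?\<theta> = "vec m1 \<phi>" and ?\<gamma> = "vec m2 (\<lambda>i. \<phi> (p1 + i))"
  have "hmat n partner (angle ?\<theta> ?\<gamma>) = (hmat n partner \<phi> :: 'a mat)"
    by (rule hmat_cong) (simp_all add: angle_of_compat[OF \<phi>])
  then have "kah_factorization p1 p2 q1 q2 U ?\<theta> ?\<gamma>"
    unfolding kah_factorization_iff using k V by metis
  then show thesis by (intro that[of ?\<theta> ?\<gamma>]) auto
qed

end

lemma kah_factorization_exists_unique:
  fixes U :: "'a::star_div_algebra mat"
  assumes "U \<in> indef_unitary_group (p1 + p2) (q1 + q2)"
  shows "\<exists>\<theta> \<in> carrier_vec (min p1 q2). \<exists>\<gamma> \<in> carrier_vec (min p2 q1).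
    kah_factorization p1 p2 q1 q2 U \<theta> \<gamma> \<and>
    (\<forall>\<theta>' \<in> carrier_vec (min p1 q2). \<forall>\<gamma>' \<in> carrier_vec (min p2 q1).
       kah_factorization p1 p2 q1 q2 U \<theta>' \<gamma>' \<longrightarrow>
       eq_up_to_order_signs \<theta>' \<theta> \<and> eq_up_to_order_signs \<gamma>' \<gamma>)"
proof -
  interpret kah_sizes p1 p2 q1 q2 .
  have "S_unitary U" using assms by (simp add: indef_unitary_group_S_unitary)
  then obtain \<theta> \<gamma> where "\<theta> \<in> carrier_vec m1" "\<gamma> \<in> carrier_vec m2" "kah_factorization p1 p2 q1 q2 U \<theta> \<gamma>"
    by (rule ex_factorization)
  then show ?thesis
    using angle_unique[of \<theta> _ \<gamma> _ U] unfolding m1_def m2_def by blast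
qed

theorem theorem7p5:
  fixes p q p1 p2 q1 q2 m1 m2 :: nat
  assumes "p \<ge> q" and "p1 + p2 = p" and "q1 + q2 = q"
    and "m1 = min p1 q2" and "m2 = min p2 q1"
  shows
    "(\<forall>U \<in> indef_unitary_group p q :: real mat set.
       \<exists>\<theta> \<in> carrier_vec m1. \<exists>\<gamma> \<in> carrier_vec m2.
         kah_factorization p1 p2 q1 q2 U \<theta> \<gamma> \<and>
         (\<forall>\<theta>' \<in> carrier_vec m1. \<forall>\<gamma>' \<in> carrier_vec m2.
            kah_factorization p1 p2 q1 q2 U \<theta>' \<gamma>' \<longrightarrow>
            eq_up_to_order_signs \<theta>' \<theta> \<and> eq_up_to_order_signs \<gamma>' \<gamma>)) \<and>
     (\<forall>U \<in> indef_unitary_group p q :: complex mat set.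
       \<exists>\<theta> \<in> carrier_vec m1. \<exists>\<gamma> \<in> carrier_vec m2.
         kah_factorization p1 p2 q1 q2 U \<theta> \<gamma> \<and>
         (\<forall>\<theta>' \<in> carrier_vec m1. \<forall>\<gamma>' \<in> carrier_vec m2.
            kah_factorization p1 p2 q1 q2 U \<theta>' \<gamma>' \<longrightarrow>
            eq_up_to_order_signs \<theta>' \<theta> \<and> eq_up_to_order_signs \<gamma>' \<gamma>)) \<and>
     (\<forall>U \<in> indef_unitary_group p q :: quat mat set.
       \<exists>\<theta> \<in> carrier_vec m1. \<exists>\<gamma> \<in> carrier_vec m2.
         kah_factorization p1 p2 q1 q2 U \<theta> \<gamma> \<and>
         (\<forall>\<theta>' \<in> carrier_vec m1. \<forall>\<gamma>' \<in> carrier_vec m2.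
            kah_factorization p1 p2 q1 q2 U \<theta>' \<gamma>' \<longrightarrow>
            eq_up_to_order_signs \<theta>' \<theta> \<and> eq_up_to_order_signs \<gamma>' \<gamma>))"
  unfolding assms(4,5) assms(2,3)[symmetric]
  by (intro conjI ballI kah_factorization_exists_unique)

end
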